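(* Let $\mu\in\mathcal{M}(\mathbb{R}_+^d)$. For every $a\in\operatorname{int}\mathbb{R}_+^d$ let $P_k(a,z),Q_k(a,z)$, $k\ge0$, be the orthogonal polynomials of the first and second kind associated with the push-forward measure $(a\cdot)_*\mu$ on $\mathbb{R}_+$. Assume that all these measures $(a\cdot)_*\mu$, $a\in\operatorname{int}\mathbb{R}_+^d$, are indeterminate, so that the associated entire functions $A(a,z),B(a,z),C(a,z),D(a,z)$ and the limit $d_0(a)$ exist. Then there exists a bijective correspondence, given by $$\nu\ \longmapsto\ F(a,z)=\int_{\mathbb{R}_+^d}\frac{d\nu(x)}{a\cdot x-z},$$ between all measures $\nu\in V_\mu(\mathbb{R}_+^d)$ and all $\mathcal{C}^\infty$ functions $F(a,z)$, $a\in\operatorname{int}\mathbb{R}_+^d$, $z\in\mathbb{C}\setminus\mathbb{R}_+$, with the following properties: (1) $F$ is homogeneous of degree $-1$: $F(\lambda a,\lambda z)=\lambda^{-1}F(a,z)$ for all $\lambda>0$; (2) $F(a,z)\in\Delta((a\cdot)_*\mu,z)$, and $$F(a,z)=-\frac{C(a,z)\Psi_a(z)+A(a,z)}{D(a,z)\Psi_a(z)+B(a,z)},\qquad z\in\mathbb{C}\setminus\mathbb{R}_+,$$ where, for each $a$, $\Psi_a$ is a Nevanlinna function analytic in $\mathbb{C}\setminus\mathbb{R}_+$ satisfying $\Psi_a(t)\ge d_0(a)$ for all $t<0$; (3) the function $(a,t)\mapsto F(a,-t)$, $a\in\operatorname{int}\mathbb{R}_+^d$, $t>0$, is completely monoto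nic.
   Context: $\mathbb{R}_+=[0,\infty)$. $\mathcal{M}(\mathbb{R}^d)$ is the set of positive Borel measures on $\mathbb{R}^d$ with all moments finite; for closed $K\subseteq\mathbb{R}^d$, $\mathcal{M}(K)$ is the set of those supported in $K$. For $\mu\in\mathcal{M}(K)$, $V_\mu(K)$ is the set of all $\nu\in\mathcal{M}(K)$ having the same moments as $\mu$; $\mu$ is determinate on $K$ if $V_\mu(K)=\{\mu\}$, and indeterminate otherwise; here $(a\cdot)_*\mu$ is regarded as a measure on $K=\mathbb{R}_+$ (Stieltjes problem). For $a\in\operatorname{int}\mathbb{R}_+^d$, $(a\cdot)_*\mu$ is the push-forward of $\mu$ under $x\mapsto a\cdot x$, i.e. $\int_{\mathbb{R}_+}\phi\,d[(a\cdot)_*\mu]=\int_{\mathbb{R}_+^d}\phi(a\cdot x)\,d\mu(x)$. For a measure $\sigma\in\mathcal{M}(\mathbb{R}_+)$ (with infinite support), $P_k$ are its orthonormal polynomials ($\deg P_k=k$, positive leading coefficients) and $Q_k(x)=\int\frac{P_k(x)-P_k(u)}{x-u}\,d\sigma(u)$ are the polynomials of the second kind. If $\sigma$ is indeterminate, one has entire functions $A(z)=z\sum_{k\ge0}Q_k(0)Q_k(z)$, $B(z)=-1+z\sum_{k\ge0}Q_k(0)P_k(z)$, $C(z)=1+z\sum_{k\ge0}P_k(0)Q_k(z)$, $D(z)=z\sum_{k\ge0}P_k(0)P_k(z)$, and $d_0=-\lim_{k\to\infty}Q_k(0)/P_k(0)$. With $\sigma=(a\cdot)_*\mu$ these are denoted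 $P_k(a,z),Q_k(a,z),A(a,z),\dots,D(a,z),d_0(a)$. $\Delta(\sigma,z)$ (the Weyl disk set) denotes the set of values $\int_{\mathbb{R}_+}\frac{d\tau(t)}{t-z}$, $\tau\in V_\sigma(\mathbb{R}_+)$, for $z\in\mathbb{C}\setminus\mathbb{R}_+$. A Nevanlinna function is an analytic map from the upper half-plane into the closure of the upper half-plane in the Riemann sphere (the constant $\infty$ is allowed, with the fraction in (2) then read as $-C/D$, and $\infty\ge d_0$); "analytic in $\mathbb{C}\setminus\mathbb{R}_+$ with $\Psi(t)\ge d_0$ for $t<0$" means that it is constant (in $[d_0,\infty]$) or extends analytically through $(-\infty,0)$ to $\mathbb{C}\setminus\mathbb{R}_+$ with real values $\geq d_0$ on $(-\infty,0)$. A $\mathcal{C}^\infty$ function $G(a,t)$ on $\operatorname{int}\mathbb{R}_+^d\times(0,\infty)$ is completely monotonic if $(-1)^{|\alpha|+j}\partial_a^\alpha\partial_t^jG\ge0$ for all $\alpha\in\mathbb{N}_0^d$, $j\in\mathbb{N}_0$. *)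

theory Defs
  imports "HOL-Analysis.Analysis" "HOL-Computational_Algebra.Polynomial"
begin

subsection \<open>Moment problems on closed sets\<close>

definition nonneg_orthant :: "'a::euclidean_space set" where
  "nonneg_orthant = {x. \<forall>b\<in>Basis. 0 \<le> x \<bullet> b}"

text \<open>Only the values of \<open>\<alpha>\<close> on \<open>Basis\<close> matter; for the type \<^typ>\<open>real\<close>, where
  \<open>Basis = {1}\<close>, the monomials are the powers \<open>x ^ \<alpha> 1\<close>.\<close>

definition monomial :: "('a::euclidean_space \<Rightarrow> nat) \<Rightarrow> 'a \<Rightarrow> real" where
  "monomial \<alpha> x = (\<Prod>b\<in>Basis. (x \<bullet> b) ^ \<alpha> b)"

text \<open>For a closed set \<open>K\<close>, the support of \<open>\<mu>\<close> is contained in \<open>K\<close> iff the complement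
  of \<open>K\<close> is a null set.\<close>

definition moment_measures :: "'a::euclidean_space set \<Rightarrow> 'a measure set" where
  "moment_measures K = {\<mu>. sets \<mu> = sets borel \<and> emeasure \<mu> (- K) = 0 \<and>
     (\<forall>\<alpha>. integrable \<mu> (monomial \<alpha>))}"

definition moment_solutions :: "'a::euclidean_space measure \<Rightarrow> 'a set \<Rightarrow> 'a measure set" where
  "moment_solutions \<mu> K = {\<nu> \<in> moment_measures K.
     \<forall>\<alpha>. (\<integral>x. monomial \<alpha> x \<partial>\<nu>) = (\<integral>x. monomial \<alpha> x \<partial>\<mu>)}"

definition determinate :: "'a::euclidean_space measure \<Rightarrow> 'a set \<Rightarrow> bool" where
  "determinate \<mu> K \<longleftrightarrow> moment_solutions \<mu> K = {\<mu>}"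

definition push_forward :: "'a::euclidean_space \<Rightarrow> 'a measure \<Rightarrow> real measure" where
  "push_forward a \<mu> = distr \<mu> borel (\<lambda>x. a \<bullet> x)"

subsection \<open>Orthogonal polynomials and the Nevanlinna matrix\<close>

text \<open>The sequence described here exists and is unique when \<open>\<sigma>\<close> has infinite support and
  finite moments, in particular when \<open>\<sigma>\<close> is indeterminate.\<close>

definition orthonormal_polys :: "real measure \<Rightarrow> nat \<Rightarrow> real poly" where
  "orthonormal_polys \<sigma> = (THE p.
     (\<forall>k. degree (p k) = k \<and> 0 < lead_coeff (p k)) \<and>
     (\<forall>j k. (\<integral>x. poly (p j) x * poly (p k) x \<partial>\<sigma>) = (if j = k then 1 else 0)))"

definition orthoP_poly :: "real measure \<Rightarrow> nat \<Rightarrow> complex poly" where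
  "orthoP_poly \<sigma> k = map_poly complex_of_real (orthonormal_polys \<sigma> k)"

definition orthoP :: "real measure \<Rightarrow> nat \<Rightarrow> complex \<Rightarrow> complex" where
  "orthoP \<sigma> k z = poly (orthoP_poly \<sigma> k) z"

text \<open>The difference quotient is a polynomial in both arguments. Its value on the diagonal
  has to be given explicitly, since the measure may have an atom at the point of evaluation,
  for instance at 0.\<close>

definition diff_quotient :: "complex poly \<Rightarrow> complex \<Rightarrow> complex \<Rightarrow> complex" where
  "diff_quotient p z u =
     (if z = u then poly (pderiv p) z else (poly p z - poly p u) / (z - u))"

definition orthoQ :: "real measure \<Rightarrow> nat \<Rightarrow> complex \<Rightarrow> complex" where
  "orthoQ \<sigma> k z = (\<integral>u. diff_quotient (orthoP_poly \<sigma> k) z (complex_of_real u) \<partial>\<sigma>)"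

definition nevA :: "real measure \<Rightarrow> complex \<Rightarrow> complex" where
  "nevA \<sigma> z = z * (\<Sum>k. orthoQ \<sigma> k 0 * orthoQ \<sigma> k z)"

definition nevB :: "real measure \<Rightarrow> complex \<Rightarrow> complex" where
  "nevB \<sigma> z = - 1 + z * (\<Sum>k. orthoQ \<sigma> k 0 * orthoP \<sigma> k z)"

definition nevC :: "real measure \<Rightarrow> complex \<Rightarrow> complex" where
  "nevC \<sigma> z = 1 + z * (\<Sum>k. orthoP \<sigma> k 0 * orthoQ \<sigma> k z)"

definition nevD :: "real measure \<Rightarrow> complex \<Rightarrow> complex" where
  "nevD \<sigma> z = z * (\<Sum>k. orthoP \<sigma> k 0 * orthoP \<sigma> k z)"

text \<open>The quotients \<open>Q\<^sub>k(0) / P\<^sub>k(0)\<close> are real.\<close>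

definition nev_d0 :: "real measure \<Rightarrow> real" where
  "nev_d0 \<sigma> = - lim (\<lambda>k. Re (orthoQ \<sigma> k 0 / orthoP \<sigma> k 0))"

definition weyl_disk :: "real measure \<Rightarrow> complex \<Rightarrow> complex set" where
  "weyl_disk \<sigma> z = {\<integral>t. 1 / (complex_of_real t - z) \<partial>\<tau> |\<tau>. \<tau> \<in> moment_solutions \<sigma> {0..}}"

subsection \<open>Nevanlinna functions\<close>

text \<open>An analytic map from the upper half-plane into its closure in the Riemann sphere that takes
  the value \<open>\<infinity>\<close> is constant, by the open mapping theorem. So \<open>None\<close> stands for the
  constant \<open>\<infinity>\<close>, and \<open>Some \<psi>\<close> for a function \<open>\<psi>\<close> with finite values.\<close>

definition nevanlinna :: "(complex \<Rightarrow> complex) option \<Rightarrow> bool" where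
  "nevanlinna \<Psi> \<longleftrightarrow> (case \<Psi> of
     None \<Rightarrow> True
   | Some \<psi> \<Rightarrow> \<psi> holomorphic_on {z. 0 < Im z} \<and> (\<forall>z. 0 < Im z \<longrightarrow> 0 \<le> Im (\<psi> z)))"

definition analytic_off_nonneg_ge :: "real \<Rightarrow> (complex \<Rightarrow> complex) option \<Rightarrow> bool" where
  "analytic_off_nonneg_ge c \<Psi> \<longleftrightarrow> (case \<Psi> of
     None \<Rightarrow> True
   | Some \<psi> \<Rightarrow> \<psi> holomorphic_on (- \<real>\<^sub>\<ge>\<^sub>0) \<and>
       (\<forall>t<0. \<psi> (complex_of_real t) \<in> \<real> \<and> c \<le> Re (\<psi> (complex_of_real t))))"

definition nevanlinna_fraction ::
    "real measure \<Rightarrow> (complex \<Rightarrow> complex) option \<Rightarrow> complex \<Rightarrow> complex" where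
  "nevanlinna_fraction \<sigma> \<Psi> z = (case \<Psi> of
     None \<Rightarrow> - (nevC \<sigma> z / nevD \<sigma> z)
   | Some \<psi> \<Rightarrow> - ((nevC \<sigma> z * \<psi> z + nevA \<sigma> z) / (nevD \<sigma> z * \<psi> z + nevB \<sigma> z)))"

subsection \<open>Smoothness and complete monotonicity\<close>

definition dir_deriv ::
    "'a::real_normed_vector \<Rightarrow> ('a \<Rightarrow> 'b::real_normed_vector) \<Rightarrow> 'a \<Rightarrow> 'b" where
  "dir_deriv v f x = frechet_derivative f (at x) v"

primrec Ck_on ::
    "nat \<Rightarrow> 'a::euclidean_space set \<Rightarrow> ('a \<Rightarrow> 'b::real_normed_vector) \<Rightarrow> bool" where
  "Ck_on 0 S f \<longleftrightarrow> continuous_on S f"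
| "Ck_on (Suc k) S f \<longleftrightarrow>
     (\<forall>x\<in>S. f differentiable (at x)) \<and> (\<forall>v. Ck_on k S (dir_deriv v f))"

text \<open>To be used for open sets only.\<close>

definition smooth_on ::
    "'a::euclidean_space set \<Rightarrow> ('a \<Rightarrow> 'b::real_normed_vector) \<Rightarrow> bool" where
  "smooth_on S f \<longleftrightarrow> (\<forall>k. Ck_on k S f)"

text \<open>A multi-index \<open>\<alpha>\<close> is given by a list \<open>bs\<close> of coordinate vectors in which each \<open>b\<close>
  occurs \<open>\<alpha> b\<close> times, so that \<open>|\<alpha>| = length bs\<close>. The order in the list is irrelevant since
  the partial derivatives of smooth functions commute.\<close>

definition completely_monotonic :: "('a::euclidean_space \<times> real \<Rightarrow> real) \<Rightarrow> bool" where
  "completely_monotonic G \<longleftrightarrow>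
     smooth_on (interior nonneg_orthant \<times> {0<..}) G \<and>
     (\<forall>bs j. set bs \<subseteq> Basis \<longrightarrow>
       (\<forall>a \<in> interior nonneg_orthant. \<forall>t>0.
          0 \<le> (- 1) ^ (length bs + j) *
            fold (\<lambda>b. dir_deriv (b, 0)) bs ((dir_deriv (0, 1) ^^ j) G) (a, t)))"

subsection \<open>The correspondence\<close>

definition transform_domain :: "('a::euclidean_space \<times> complex) set" where
  "transform_domain = interior nonneg_orthant \<times> (- \<real>\<^sub>\<ge>\<^sub>0)"

text \<open>Functions on \<^const>\<open>transform_domain\<close> are represented by total functions that are
  undefined outside of it, so that equality is equality on the domain.\<close>

definition stieltjes_transform ::
    "'a::euclidean_space measure \<Rightarrow> 'a \<times> complex \<Rightarrow> complex" where
  "stieltjes_transform \<nu> =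
     (\<lambda>(a, z) \<in> transform_domain. \<integral>x. 1 / (complex_of_real (a \<bullet> x) - z) \<partial>\<nu>)"

end

theory Submission
  imports Defs "HOL-Probability.Probability" "HOL-Complex_Analysis.Complex_Analysis"
begin

text \<open>
  Injectivity: \<open>F\<close> at negative \<open>z\<close> determines \<open>\<integral> d\<nu>(x) / (a\<bullet>x + t)\<close> for all \<open>(a, t)\<close>. After a
  projective change of variables this is the transform \<open>c \<mapsto> \<integral> d\<rho>(y) / (c\<bullet>y)\<close> of a finite measure on
  the unit simplex; its expansion at \<open>c = (1, \<dots>, 1)\<close> yields all moments of \<open>\<rho>\<close>, hence \<open>\<rho>\<close>.

  Every transform satisfies (2): for a solution \<open>\<sigma>\<close> of the one-dimensional problem with transform
  \<open>w\<close>, the sequence \<open>w P\<^sub>k + Q\<^sub>k\<close> consists of the Fourier coefficients of \<open>1 / (t - z)\<close>. Bessel's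
  inequality confines the value of \<open>\<Psi>\<close> solved from the fraction to the closed half-plane, and on the
  negative axis the Stieltjes condition gives \<open>\<Psi> \<ge> d\<^sub>0\<close>.

  Surjectivity: \<open>G(a, t) = F(a, -t)\<close> is completely monotonic and homogeneous of degree \<open>-1\<close>. Up
  to sign, its derivatives of order \<open>n\<close> at \<open>(1, \<dots>, 1)\<close> are nonnegative weights on multi-indices and give
  discrete measures on the simplex whose moments converge; a weak limit \<open>\<rho>\<close> represents
  \<open>G(c) = \<integral> d\<rho>(y) / (c\<bullet>y)\<close>. Boundedness of \<open>t G(a, t)\<close> prevents \<open>\<rho>\<close> from charging the face at
  infinity, so \<open>\<rho>\<close> comes from a measure \<open>\<nu>\<close> on the orthant. Membership in the Weyl disks for all
  \<open>t > 0\<close> fixes the asymptotic expansion of \<open>G(a, \<cdot>)\<close>, hence all moments of the projections of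
  \<open>\<nu>\<close>, and analytic continuation from the negative axis gives \<open>F\<close> off it.
\<close>


section \<open>Iterated directional derivatives\<close>

text \<open>Homogeneity of degree -1 makes the pairs (a, t) projective. Through x \<mapsto> (x, 1) /
  (1 + One \<bullet> x) a measure on the orthant becomes a measure on a compact simplex one
  dimension up, where moments determine measures and weak limits exist. The price is the face with
  last coordinate 0, the points at infinity of the orthant. Indeterminacy always enters in the same
  form: some solution has a resolvent that differs from that of \<sigma> at a negative point. This
  yields three things: the moment functional is positive definite, so orthonormal polynomials exist;
  P_k and Q_k are square summable at that point, and from there everywhere; d_0 is finite. The
  obstacle in (2) is the denominator C + w D that appears when the fraction is solved for \<Psi>. It
  could vanish at single points, on the negative axis in particular. Open mapping arguments show
  that it vanishes identically, the case of the constant \<infinity>, or nowhere. In the converse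
  direction smoothness of F in z is only real smoothness; the fraction in (2) is what makes F
  holomorphic in z, so that values on the negative axis decide.\<close>

lemma Ck_on_cong:
  assumes "open S" "\<And>x. x \<in> S \<Longrightarrow> f x = g x"
  shows "Ck_on k S f \<longleftrightarrow> Ck_on k S g"
proof -
  have d: "dir_deriv v f x = dir_deriv v g x \<and> (f differentiable (at x) \<longleftrightarrow> g differentiable (at x))"
    if x: "x \<in> S" and e: "\<And>x. x \<in> S \<Longrightarrow> f x = g x" for f g :: "'a \<Rightarrow> 'b" and v x
  proof -
    have "(f has_derivative D) (at x) \<longleftrightarrow> (g has_derivative D) (at x)" for D
      using has_derivative_transform_within_open[OF _ assms(1) x] e by (metis (no_types, lifting))
    thus ?thesis unfolding dir_deriv_def frechet_derivative_def differentiable_def by simp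
  qed
  show ?thesis using assms(2)
  proof (induction k arbitrary: f g)
    case 0
    then show ?case by (simp cong: continuous_on_cong)
  next
    case (Suc k)
    have "Ck_on k S (dir_deriv v f) \<longleftrightarrow> Ck_on k S (dir_deriv v g)" for v
      by (rule Suc.IH) (use d Suc.prems in blast)
    moreover have "(\<forall>x\<in>S. f differentiable (at x)) \<longleftrightarrow> (\<forall>x\<in>S. g differentiable (at x))"
      using d Suc.prems by blast
    ultimately show ?case by simp
  qed
qed

lemma dir_deriv_cong:
  assumes "open S" "x \<in> S" "\<And>y. y \<in> S \<Longrightarrow> f y = g y"
  shows "dir_deriv v f x = dir_deriv v g x"
proof -
  have "(f has_derivative D) (at x) \<longleftrightarrow> (g has_derivative D) (at x)" for D
    using has_derivative_transform_within_open[OF _ assms(1,2)] assms(3) by (metis (no_types, lifting))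
  thus ?thesis unfolding dir_deriv_def frechet_derivative_def by simp
qed

lemma dir_deriv_eqI: "(f has_derivative D) (at x) \<Longrightarrow> dir_deriv v f x = D v"
  unfolding dir_deriv_def using frechet_derivative_at by metis

lemma smooth_on_differentiable: "smooth_on S f \<Longrightarrow> x \<in> S \<Longrightarrow> f differentiable (at x)"
  unfolding smooth_on_def using Ck_on.simps(2) by blast

lemma smooth_on_has_derivative:
  "smooth_on S f \<Longrightarrow> x \<in> S \<Longrightarrow> (f has_derivative (\<lambda>v. dir_deriv v f x)) (at x)"
  unfolding dir_deriv_def
  using smooth_on_differentiable frechet_derivative_works by (metis (no_types, lifting) eta_contract_eq)

lemma smooth_on_dir_deriv: "smooth_on S f \<Longrightarrow> smooth_on S (dir_deriv v f)"
  unfolding smooth_on_def using Ck_on.simps(2) by blast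

lemma smooth_on_dir_deriv_pow: "smooth_on S f \<Longrightarrow> smooth_on S ((dir_deriv v ^^ k) f)"
  by (induction k) (auto intro: smooth_on_dir_deriv)

lemma smooth_on_continuous: "smooth_on S f \<Longrightarrow> continuous_on S f"
  unfolding smooth_on_def using Ck_on.simps(1) by blast

lemma dir_deriv_linear:
  assumes "smooth_on S f" "x \<in> S" shows "linear (\<lambda>v. dir_deriv v f x)"
  using smooth_on_has_derivative[OF assms] has_derivative_linear by blast

lemma dir_deriv_sum:
  assumes "\<And>i. i \<in> I \<Longrightarrow> smooth_on S (f i)" "x \<in> S"
  shows "dir_deriv v (\<lambda>x. \<Sum>i\<in>I. c i *\<^sub>R f i x) x = (\<Sum>i\<in>I. c i *\<^sub>R dir_deriv v (f i) x)"
proof -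
  have "((\<lambda>x. \<Sum>i\<in>I. c i *\<^sub>R f i x) has_derivative (\<lambda>v. \<Sum>i\<in>I. c i *\<^sub>R dir_deriv v (f i) x)) (at x)"
    by (intro has_derivative_sum has_derivative_scaleR_right smooth_on_has_derivative[where S=S] assms)
  thus ?thesis by (rule dir_deriv_eqI)
qed

lemma smooth_on_line_derivative:
  fixes f :: "'a::euclidean_space \<Rightarrow> real"
  assumes "smooth_on S f" "x + r *\<^sub>R v \<in> S"
  shows "((\<lambda>r. f (x + r *\<^sub>R v)) has_field_derivative dir_deriv v f (x + r *\<^sub>R v)) (at r)"
proof -
  have "((\<lambda>r. x + r *\<^sub>R v) has_derivative (\<lambda>s. s *\<^sub>R v)) (at r)"
    by (auto intro!: derivative_eq_intros)
  from diff_chain_at[OF this smooth_on_has_derivative[OF assms]]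
  have "((\<lambda>r. f (x + r *\<^sub>R v)) has_derivative (\<lambda>s. dir_deriv (s *\<^sub>R v) f (x + r *\<^sub>R v))) (at r)"
    by (simp add: o_def)
  moreover have "dir_deriv (s *\<^sub>R v) f (x + r *\<^sub>R v) = dir_deriv v f (x + r *\<^sub>R v) * s" for s
    using linear_scale[OF dir_deriv_linear[OF assms], of s v] by simp
  ultimately show ?thesis unfolding has_field_derivative_def by simp
qed

text \<open>The mean value theorem is applied twice, along v to the increment of f in direction w,
  then along w to the first derivative. The second difference is symmetric in v and w, so exchanging
  them yields the mixed derivative in the other order.\<close>

lemma second_difference_mvt:
  fixes f :: "'a::euclidean_space \<Rightarrow> real"
  assumes sm: "smooth_on S f" and h: "0 < h"
    and S: "\<And>s t. 0 \<le> s \<Longrightarrow> s \<le> h \<Longrightarrow> 0 \<le> t \<Longrightarrow> t \<le> h \<Longrightarrow> x + s *\<^sub>R v + t *\<^sub>R w \<in> S"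
  obtains s t where "0 < s" "s < h" "0 < t" "t < h"
    "f (x + h *\<^sub>R v + h *\<^sub>R w) - f (x + h *\<^sub>R v) - f (x + h *\<^sub>R w) + f x
      = h * h * dir_deriv w (dir_deriv v f) (x + s *\<^sub>R v + t *\<^sub>R w)"
proof -
  define g where "g s = f (x + h *\<^sub>R w + s *\<^sub>R v) - f (x + s *\<^sub>R v)" for s
  have g': "(g has_field_derivative (dir_deriv v f (x + h *\<^sub>R w + s *\<^sub>R v) - dir_deriv v f (x + s *\<^sub>R v))) (at s)"
    if "0 \<le> s" "s \<le> h" for s
    unfolding g_def using S[OF that, of 0] S[OF that, of h] h
    by (intro DERIV_diff smooth_on_line_derivative[OF sm]) (auto simp: add_ac)
  obtain s where s: "0 < s" "s < h"
    "g h - g 0 = (h - 0) * (dir_deriv v f (x + h *\<^sub>R w + s *\<^sub>R v) - dir_deriv v f (x + s *\<^sub>R v))"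
    using MVT2[OF h g'] by blast
  have k': "((\<lambda>t. dir_deriv v f (x + s *\<^sub>R v + t *\<^sub>R w)) has_field_derivative
      dir_deriv w (dir_deriv v f) (x + s *\<^sub>R v + t *\<^sub>R w)) (at t)" if "0 \<le> t" "t \<le> h" for t
    using S[of s t] that s by (intro smooth_on_line_derivative[OF smooth_on_dir_deriv[OF sm]]) auto
  obtain t where t: "0 < t" "t < h"
    "dir_deriv v f (x + s *\<^sub>R v + h *\<^sub>R w) - dir_deriv v f (x + s *\<^sub>R v + 0 *\<^sub>R w)
      = (h - 0) * dir_deriv w (dir_deriv v f) (x + s *\<^sub>R v + t *\<^sub>R w)"
    using MVT2[OF h k'] by blast
  show ?thesis
    by (rule that[OF s(1,2) t(1,2)]) (use s(3) t(3) in \<open>simp add: g_def add_ac\<close>)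
qed

text \<open>Both mixed derivatives are values of the same second difference divided by h^2, taken at
  points p and q arbitrarily close to x; continuity at x then forces equality.\<close>

lemma dir_deriv_commute:
  fixes f :: "'a::euclidean_space \<Rightarrow> real"
  assumes sm: "smooth_on S f" and S: "open S" "x \<in> S"
  shows "dir_deriv w (dir_deriv v f) x = dir_deriv v (dir_deriv w f) x"
proof -
  have key: "\<exists>p q. dist p x < e \<and> dist q x < e \<and> dir_deriv w (dir_deriv v f) p = dir_deriv v (dir_deriv w f) q"
    if "e > 0" for e
  proof -
    obtain d where d: "d > 0" "ball x d \<subseteq> S" using S open_contains_ball by blast
    define m where "m = min d e"
    \<comment> \<open>The factor 2 and the summand 1 put the whole parallelogram strictly inside the
      ball of radius m, also when v = w = 0.\<close>
    define h where "h = m / (2 * (norm v + norm w + 1))"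
    have pos: "norm v + norm w + 1 > 0" by (smt (verit) norm_ge_zero)
    have h: "h > 0" using pos d that by (auto simp: h_def m_def)
    have near: "dist (x + s *\<^sub>R v + t *\<^sub>R w) x < m" if "0 \<le> s" "s \<le> h" "0 \<le> t" "t \<le> h" for s t
    proof -
      have "dist (x + s *\<^sub>R v + t *\<^sub>R w) x = norm (s *\<^sub>R v + t *\<^sub>R w)" by (simp add: dist_norm add.assoc)
      also have "\<dots> \<le> s * norm v + t * norm w" using norm_triangle_ineq[of "s *\<^sub>R v" "t *\<^sub>R w"] that by simp
      also have "\<dots> \<le> h * norm v + h * norm w" using that by (intro add_mono mult_right_mono) auto
      also have "\<dots> < h * (2 * (norm v + norm w + 1))"
        using h by (simp add: distrib_left) (smt (verit) mult_nonneg_nonneg norm_ge_zero)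
      also have "\<dots> = m" using pos by (simp add: h_def)
      finally show ?thesis .
    qed
    have inS: "x + s *\<^sub>R v + t *\<^sub>R w \<in> S" if "0 \<le> s" "s \<le> h" "0 \<le> t" "t \<le> h" for s t
      using near[OF that] d(2) by (auto simp: m_def dist_commute subset_iff)
    have inS': "x + s *\<^sub>R w + t *\<^sub>R v \<in> S" if "0 \<le> s" "s \<le> h" "0 \<le> t" "t \<le> h" for s t
      using inS[of t s] that by (simp add: add_ac)
    obtain s t where 1: "0 < s" "s < h" "0 < t" "t < h"
      "f (x + h *\<^sub>R v + h *\<^sub>R w) - f (x + h *\<^sub>R v) - f (x + h *\<^sub>R w) + f x
      = h * h * dir_deriv w (dir_deriv v f) (x + s *\<^sub>R v + t *\<^sub>R w)"
      using second_difference_mvt[OF sm h inS] by blast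
    obtain s' t' where 2: "0 < s'" "s' < h" "0 < t'" "t' < h"
      "f (x + h *\<^sub>R w + h *\<^sub>R v) - f (x + h *\<^sub>R w) - f (x + h *\<^sub>R v) + f x
      = h * h * dir_deriv v (dir_deriv w f) (x + s' *\<^sub>R w + t' *\<^sub>R v)"
      using second_difference_mvt[OF sm h inS'] by blast
    have "h * h * dir_deriv w (dir_deriv v f) (x + s *\<^sub>R v + t *\<^sub>R w)
       = h * h * dir_deriv v (dir_deriv w f) (x + s' *\<^sub>R w + t' *\<^sub>R v)"
      unfolding 1(5)[symmetric] 2(5)[symmetric] by (simp add: add_ac)
    hence "dir_deriv w (dir_deriv v f) (x + s *\<^sub>R v + t *\<^sub>R w) = dir_deriv v (dir_deriv w f) (x + s' *\<^sub>R w + t' *\<^sub>R v)"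
      using h by simp
    moreover have "dist (x + s *\<^sub>R v + t *\<^sub>R w) x < e" using near[of s t] 1 by (simp add: m_def)
    moreover have "dist (x + s' *\<^sub>R w + t' *\<^sub>R v) x < e"
      using near[of t' s'] 2 by (simp add: m_def add_ac)
    ultimately show ?thesis by blast
  qed
  have "isCont (dir_deriv w (dir_deriv v f)) x" "isCont (dir_deriv v (dir_deriv w f)) x"
    using smooth_on_continuous[OF smooth_on_dir_deriv[OF smooth_on_dir_deriv[OF sm]]] S
    by (auto simp: continuous_on_eq_continuous_at)
  note c = this[unfolded continuous_at_eps_delta]
  show ?thesis
  proof (rule ccontr)
    assume ne: "dir_deriv w (dir_deriv v f) x \<noteq> dir_deriv v (dir_deriv w f) x"
    define e where "e = \<bar>dir_deriv w (dir_deriv v f) x - dir_deriv v (dir_deriv w f) x\<bar> / 2"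
    have e: "e > 0" using ne by (simp add: e_def)
    obtain d1 where d1: "d1 > 0" "\<And>y. dist y x < d1 \<Longrightarrow> dist (dir_deriv w (dir_deriv v f) y) (dir_deriv w (dir_deriv v f) x) < e"
      using c(1) e by blast
    obtain d2 where d2: "d2 > 0" "\<And>y. dist y x < d2 \<Longrightarrow> dist (dir_deriv v (dir_deriv w f) y) (dir_deriv v (dir_deriv w f) x) < e"
      using c(2) e by blast
    obtain p q where "dist p x < min d1 d2" "dist q x < min d1 d2" 
      "dir_deriv w (dir_deriv v f) p = dir_deriv v (dir_deriv w f) q" using key[of "min d1 d2"] d1 d2 by auto
    hence "dist (dir_deriv w (dir_deriv v f) p) (dir_deriv w (dir_deriv v f) x) < e"
      "dist (dir_deriv w (dir_deriv v f) p) (dir_deriv v (dir_deriv w f) x) < e"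
      using d1(2)[of p] d2(2)[of q] by auto
    hence "dist (dir_deriv w (dir_deriv v f) x) (dir_deriv v (dir_deriv w f) x) < 2 * e"
      using dist_triangle_half_r[of _ _ "2 * e"] by simp
    thus False by (simp add: e_def dist_real_def)
  qed
qed


lemma dir_deriv_pow_cong:
  assumes "open S" "\<And>y. y \<in> S \<Longrightarrow> f y = g y" "x \<in> S"
  shows "(dir_deriv v ^^ n) f x = (dir_deriv v ^^ n) g x"
  using assms(3)
proof (induction n arbitrary: x)
  case (Suc n)
  show ?case using dir_deriv_cong[OF assms(1) Suc.prems Suc.IH] by simp
qed (simp add: assms(2))

lemma dir_deriv_pow_sum:
  fixes f :: "'i \<Rightarrow> 'a::euclidean_space \<Rightarrow> real"
  assumes S: "open S" and sm: "\<And>i. i \<in> I \<Longrightarrow> smooth_on S (f i)" "x \<in> S"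
  shows "(dir_deriv v ^^ n) (\<lambda>x. \<Sum>i\<in>I. c i * f i x) x = (\<Sum>i\<in>I. c i * (dir_deriv v ^^ n) (f i) x)"
  using sm(2)
proof (induction n arbitrary: x)
  case (Suc n)
  have "(dir_deriv v ^^ Suc n) (\<lambda>x. \<Sum>i\<in>I. c i * f i x) x
      = dir_deriv v (\<lambda>x. \<Sum>i\<in>I. c i * (dir_deriv v ^^ n) (f i) x) x"
    using dir_deriv_cong[OF S Suc.prems Suc.IH] by simp
  also have "\<dots> = (\<Sum>i\<in>I. c i * dir_deriv v ((dir_deriv v ^^ n) (f i)) x)"
    using dir_deriv_sum[of I S "\<lambda>i. (dir_deriv v ^^ n) (f i)" x v c] sm(1) Suc.prems
    by (simp add: smooth_on_dir_deriv_pow)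
  finally show ?case by simp
qed simp

lemma dir_deriv_pow_commute:
  fixes f :: "'a::euclidean_space \<Rightarrow> real"
  assumes sm: "smooth_on S f" and S: "open S" "x \<in> S"
  shows "dir_deriv w ((dir_deriv v ^^ n) f) x = (dir_deriv v ^^ n) (dir_deriv w f) x"
  using S(2)
proof (induction n arbitrary: x)
  case (Suc n)
  have "dir_deriv w ((dir_deriv v ^^ Suc n) f) x = dir_deriv v (dir_deriv w ((dir_deriv v ^^ n) f)) x"
    using dir_deriv_commute[OF smooth_on_dir_deriv_pow[OF sm] S(1) Suc.prems, of w v n v] by simp
  also have "\<dots> = (dir_deriv v ^^ Suc n) (dir_deriv w f) x"
    using dir_deriv_cong[OF S(1) Suc.prems Suc.IH] by simp
  finally show ?case .
qed simp

lemma dir_deriv_pow_scale: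
  fixes f :: "'a::euclidean_space \<Rightarrow> real"
  assumes sm: "smooth_on S f" and S: "open S" "x \<in> S"
  shows "(dir_deriv (\<alpha> *\<^sub>R v) ^^ n) f x = \<alpha> ^ n * (dir_deriv v ^^ n) f x"
  using S(2)
proof (induction n arbitrary: x)
  case (Suc n)
  have sm': "smooth_on S ((dir_deriv v ^^ n) f)" by (rule smooth_on_dir_deriv_pow[OF sm])
  have "(dir_deriv (\<alpha> *\<^sub>R v) ^^ Suc n) f x = dir_deriv (\<alpha> *\<^sub>R v) (\<lambda>x. \<Sum>i\<in>{()}. \<alpha> ^ n *\<^sub>R (dir_deriv v ^^ n) f x) x"
    using dir_deriv_cong[OF S(1) Suc.prems Suc.IH] by simp
  also have "\<dots> = \<alpha> ^ n * dir_deriv (\<alpha> *\<^sub>R v) ((dir_deriv v ^^ n) f) x"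
    using dir_deriv_sum[of "{()}" S "\<lambda>_. (dir_deriv v ^^ n) f" x "\<alpha> *\<^sub>R v" "\<lambda>_. \<alpha> ^ n"] sm' Suc.prems by simp
  also have "\<dots> = \<alpha> ^ Suc n * (dir_deriv v ^^ Suc n) f x"
    using linear_scale[OF dir_deriv_linear[OF sm' Suc.prems], of \<alpha> v] by simp
  finally show ?case .
qed simp

text \<open>Derivatives in the directions u and v commute on S, so this is the binomial theorem; the
  inductive step is Pascal's rule after an index shift.\<close>

lemma dir_deriv_pow_add:
  fixes f :: "'a::euclidean_space \<Rightarrow> real"
  assumes sm: "smooth_on S f" and S: "open S" "x \<in> S"
  shows "(dir_deriv (u + v) ^^ n) f x
    = (\<Sum>k\<le>n. real (n choose k) * (dir_deriv u ^^ (n - k)) ((dir_deriv v ^^ k) f) x)"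
  using S(2)
proof (induction n arbitrary: x)
  case (Suc n)
  define a where "a j k = (dir_deriv u ^^ j) ((dir_deriv v ^^ k) f)" for j k
  have sma: "smooth_on S (a j k)" for j k by (simp add: a_def smooth_on_dir_deriv_pow sm)
  have step: "dir_deriv (u + v) (a j k) x = a (Suc j) k x + a j (Suc k) x" for j k
    using linear_add[OF dir_deriv_linear[OF sma Suc.prems], of u v j k]
      dir_deriv_pow_commute[OF smooth_on_dir_deriv_pow[OF sm, where v=v and k=k] S(1) Suc.prems, where w=v and v=u and n=j]
    by (simp add: a_def)
  have "(dir_deriv (u + v) ^^ Suc n) f x = dir_deriv (u + v) (\<lambda>x. \<Sum>k\<le>n. real (n choose k) *\<^sub>R a (n - k) k x) x"
    using dir_deriv_cong[OF S(1) Suc.prems Suc.IH] by (simp add: a_def)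
  also have "\<dots> = (\<Sum>k\<le>n. real (n choose k) * (a (Suc n - k) k x + a (n - k) (Suc k) x))"
    using sma Suc.prems by (subst dir_deriv_sum[where S=S]) (auto simp: step Suc_diff_le)
  also have "\<dots> = (\<Sum>k\<le>n. real (n choose k) * a (Suc n - k) k x) + (\<Sum>k\<le>n. real (n choose k) * a (n - k) (Suc k) x)"
    by (simp add: distrib_left sum.distrib)
  also have "(\<Sum>k\<le>n. real (n choose k) * a (Suc n - k) k x)
      = a (Suc n) 0 x + (\<Sum>k\<le>n. real (n choose Suc k) * a (n - k) (Suc k) x)"
  proof -
    have "(\<Sum>k\<le>n. real (n choose k) * a (Suc n - k) k x) = (\<Sum>k\<le>Suc n. real (n choose k) * a (Suc n - k) k x)"
      by (simp add: binomial_eq_0)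
    also have "\<dots> = a (Suc n) 0 x + (\<Sum>k\<le>n. real (n choose Suc k) * a (n - k) (Suc k) x)"
      by (subst sum.atMost_Suc_shift) simp
    finally show ?thesis .
  qed
  also have "a (Suc n) 0 x + (\<Sum>k\<le>n. real (n choose Suc k) * a (n - k) (Suc k) x) + (\<Sum>k\<le>n. real (n choose k) * a (n - k) (Suc k) x)
      = (\<Sum>k\<le>Suc n. real (Suc n choose k) * a (Suc n - k) k x)"
    by (subst sum.atMost_Suc_shift) (simp add: sum.distrib distrib_right)
  finally show ?case by (simp add: a_def)
qed simp

text \<open>Ordered words replace multi-indices. Expansions then carry no multinomial coefficients,
  and each term is an iterated derivative in the form on which complete monotonicity gives a
  sign.\<close>

definition basis_words :: "nat \<Rightarrow> 'a::euclidean_space list set" where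
  "basis_words n = {ws. set ws \<subseteq> Basis \<and> length ws = n}"

lemma finite_basis_words: "finite (basis_words n)"
  unfolding basis_words_def by (rule finite_lists_length_eq[OF finite_Basis])

lemma sum_basis_words_Suc:
  fixes F :: "'a::euclidean_space list \<Rightarrow> 'b::comm_monoid_add"
  shows "(\<Sum>ws\<in>basis_words (Suc n). F ws) = (\<Sum>b\<in>Basis. \<Sum>ws\<in>basis_words n. F (b # ws))"
proof -
  have "(basis_words (Suc n) :: 'a list set) = (\<lambda>(b, ws). b # ws) ` (Basis \<times> basis_words n)"
    by (auto simp: basis_words_def length_Suc_conv image_iff)
  moreover have "inj_on (\<lambda>(b, ws). b # ws) ((Basis :: 'a set) \<times> basis_words n)" by (auto simp: inj_on_def)
  ultimately have "(\<Sum>ws\<in>basis_words (Suc n). F ws) = (\<Sum>(b, ws)\<in>Basis \<times> basis_words n. F (b # ws))"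
    by (simp add: sum.reindex case_prod_unfold)
  thus ?thesis by (simp add: sum.cartesian_product)
qed

text \<open>The derivative in direction c is the combination of coordinate derivatives with
  coefficients \<open>c \<bullet> b\<close>; multiplying out n copies without collecting equal terms
  gives one summand per word.\<close>

lemma dir_deriv_pow_words:
  fixes f :: "'a::euclidean_space \<Rightarrow> real"
  assumes sm: "smooth_on S f" and S: "open S" "x \<in> S"
  shows "(dir_deriv c ^^ n) f x = (\<Sum>ws\<in>basis_words n. prod_list (map ((\<bullet>) c) ws) * fold dir_deriv ws f x)"
  using sm
proof (induction n arbitrary: f)
  case 0
  have "basis_words 0 = {[] :: 'a list}" by (auto simp: basis_words_def)
  thus ?case by simp
next
  case (Suc n)
  have "dir_deriv c f y = (\<Sum>b\<in>Basis. (c \<bullet> b) * dir_deriv b f y)" if "y \<in> S" for y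
    using linear_sum[OF dir_deriv_linear[OF Suc.prems that], of "\<lambda>b. (c \<bullet> b) *\<^sub>R b" Basis]
      linear_scale[OF dir_deriv_linear[OF Suc.prems that]] by (simp add: euclidean_representation)
  hence "(dir_deriv c ^^ Suc n) f x = (dir_deriv c ^^ n) (\<lambda>y. \<Sum>b\<in>Basis. (c \<bullet> b) * dir_deriv b f y) x"
    unfolding funpow_Suc_right o_def by (intro dir_deriv_pow_cong[OF S(1) _ S(2)])
  also have "\<dots> = (\<Sum>b\<in>Basis. (c \<bullet> b) * (dir_deriv c ^^ n) (dir_deriv b f) x)"
    by (rule dir_deriv_pow_sum[OF S(1) _ S(2)]) (rule smooth_on_dir_deriv[OF Suc.prems])
  also have "\<dots> = (\<Sum>b\<in>Basis. \<Sum>ws\<in>basis_words n. prod_list (map ((\<bullet>) c) (b # ws)) * fold dir_deriv (b # ws) f x)"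
    by (simp add: Suc.IH[OF smooth_on_dir_deriv[OF Suc.prems]] sum_distrib_left mult.assoc)
  finally show ?case by (simp only: sum_basis_words_Suc)
qed

section \<open>Homogeneous functions and Euler's identity\<close>

lemma dir_deriv_homogeneous:
  fixes f :: "'a::euclidean_space \<Rightarrow> real"
  assumes sm: "smooth_on S f" and S: "open S" "\<And>x r. x \<in> S \<Longrightarrow> r > 0 \<Longrightarrow> r *\<^sub>R x \<in> S"
    and hom: "\<And>x r. x \<in> S \<Longrightarrow> r > 0 \<Longrightarrow> f (r *\<^sub>R x) = f x / r ^ m"
    and x: "x \<in> S" "r > 0"
  shows "dir_deriv v f (r *\<^sub>R x) = dir_deriv v f x / r ^ Suc m"
proof -
  have "((\<lambda>x. r *\<^sub>R x) has_derivative (\<lambda>v. r *\<^sub>R v)) (at x)" by (auto intro!: derivative_eq_intros)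
  from diff_chain_at[OF this smooth_on_has_derivative[OF sm S(2)[OF x]]]
  have "((\<lambda>x. f (r *\<^sub>R x)) has_derivative (\<lambda>v. dir_deriv (r *\<^sub>R v) f (r *\<^sub>R x))) (at x)"
    by (simp add: o_def)
  hence "dir_deriv v (\<lambda>x. f (r *\<^sub>R x)) x = dir_deriv (r *\<^sub>R v) f (r *\<^sub>R x)" by (rule dir_deriv_eqI)
  also have "\<dots> = r * dir_deriv v f (r *\<^sub>R x)"
    using linear_scale[OF dir_deriv_linear[OF sm S(2)[OF x]], of r v] by simp
  also have "dir_deriv v (\<lambda>x. f (r *\<^sub>R x)) x = dir_deriv v (\<lambda>x. f x / r ^ m) x"
    by (rule dir_deriv_cong[OF S(1) x(1)]) (simp add: hom x)
  also have "dir_deriv v (\<lambda>x. f x / r ^ m) x = dir_deriv v f x / r ^ m"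
  proof -
    have "((\<lambda>x. f x / r ^ m) has_derivative (\<lambda>v. dir_deriv v f x / r ^ m)) (at x)"
      using bounded_linear.has_derivative[OF bounded_linear_divide smooth_on_has_derivative[OF sm x(1)]] .
    thus ?thesis by (rule dir_deriv_eqI)
  qed
  finally show ?thesis using x by (simp add: field_simps)
qed

lemma dir_deriv_pow_homogeneous:
  fixes f :: "'a::euclidean_space \<Rightarrow> real"
  assumes sm: "smooth_on S f" and S: "open S" "\<And>x r. x \<in> S \<Longrightarrow> r > 0 \<Longrightarrow> r *\<^sub>R x \<in> S"
    and hom: "\<And>x r. x \<in> S \<Longrightarrow> r > 0 \<Longrightarrow> f (r *\<^sub>R x) = f x / r ^ m"
    and x: "x \<in> S" "r > 0"
  shows "(dir_deriv v ^^ n) f (r *\<^sub>R x) = (dir_deriv v ^^ n) f x / r ^ (m + n)"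
  using x
proof (induction n arbitrary: x r)
  case (Suc n)
  show ?case using dir_deriv_homogeneous[OF smooth_on_dir_deriv_pow[OF sm] S Suc.IH Suc.prems] by simp
qed (simp add: hom)

text \<open>The radial derivative of a function homogeneous of degree -(m + n) multiplies its value
  at x by -(m + n). The n-th derivative in the fixed direction x has exactly this degree, so the
  factors build up a rising factorial.\<close>

lemma dir_deriv_pow_Euler:
  fixes f :: "'a::euclidean_space \<Rightarrow> real"
  assumes sm: "smooth_on S f" and S: "open S" "\<And>x r. x \<in> S \<Longrightarrow> r > 0 \<Longrightarrow> r *\<^sub>R x \<in> S"
    and hom: "\<And>x r. x \<in> S \<Longrightarrow> r > 0 \<Longrightarrow> f (r *\<^sub>R x) = f x / r ^ m"
    and x: "x \<in> S"
  shows "(dir_deriv x ^^ n) f x = (-1) ^ n * pochhammer (real m) n * f x"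
proof (induction n)
  case (Suc n)
  let ?g = "(dir_deriv x ^^ n) f"
  have 1: "((\<lambda>r. ?g (0 + r *\<^sub>R x)) has_field_derivative dir_deriv x ?g (0 + 1 *\<^sub>R x)) (at 1)"
    by (rule smooth_on_line_derivative[OF smooth_on_dir_deriv_pow[OF sm]]) (use x in simp)
  have "((\<lambda>r. ?g x / r ^ (m + n)) has_field_derivative - (real (m + n) * ?g x)) (at 1)"
    by (auto intro!: derivative_eq_intros)
  moreover have "\<forall>\<^sub>F r in nhds 1. ?g x / r ^ (m + n) = ?g (0 + r *\<^sub>R x)"
    using dir_deriv_pow_homogeneous[OF sm S hom x]
    by (intro eventually_nhds_in_open[of "{0<..}", THEN eventually_mono]) auto
  ultimately have 2: "((\<lambda>r. ?g (0 + r *\<^sub>R x)) has_field_derivative - (real (m + n) * ?g x)) (at 1)"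
    by (subst DERIV_cong_ev[OF refl _ refl, symmetric]) auto
  have "dir_deriv x ?g x = - (real (m + n) * ?g x)" using DERIV_unique[OF 1 2] by simp
  thus ?case by (simp add: Suc pochhammer_rec' algebra_simps)
qed simp

section \<open>Resolvent integrals over the orthant\<close>

lemma mem_interior_nonneg_orthant:
  "x \<in> interior nonneg_orthant \<longleftrightarrow> (\<forall>b\<in>Basis. 0 < x \<bullet> b)" (is "?l \<longleftrightarrow> ?r")
proof
  assume ?l
  then obtain e where e: "e > 0" "ball x e \<subseteq> nonneg_orthant"
    unfolding mem_interior by blast
  show ?r
  proof
    fix b :: 'a assume b: "b \<in> Basis"
    have "x - (e / 2) *\<^sub>R b \<in> ball x e" using e(1) b by (simp add: dist_norm)
    hence "0 \<le> (x - (e / 2) *\<^sub>R b) \<bullet> b" using e(2) b unfolding nonneg_orthant_def by blast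
    thus "0 < x \<bullet> b" using e(1) b by (simp add: inner_diff_left)
  qed
next
  assume ?r
  have "open {x :: 'a. \<forall>b\<in>Basis. 0 < x \<bullet> b}"
  proof -
    have "{x :: 'a. \<forall>b\<in>Basis. 0 < x \<bullet> b} = (\<Inter>b\<in>Basis. {x. 0 < x \<bullet> b})" by auto
    moreover have "open (\<Inter>b\<in>Basis. {x :: 'a. 0 < x \<bullet> b})"
      by (intro open_INT ballI open_Collect_less continuous_intros) auto
    ultimately show ?thesis by simp
  qed
  moreover have "{x :: 'a. \<forall>b\<in>Basis. 0 < x \<bullet> b} \<subseteq> nonneg_orthant"
    unfolding nonneg_orthant_def by (auto intro: less_imp_le)
  ultimately show ?l using \<open>?r\<close> unfolding interior_def by blast
qed

lemma inner_nonneg_orthant: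
  assumes "a \<in> nonneg_orthant" "x \<in> nonneg_orthant" shows "0 \<le> a \<bullet> x"
  using assms unfolding nonneg_orthant_def by (subst euclidean_inner) (auto intro!: sum_nonneg)

lemma interior_nonneg_orthant_subset: "a \<in> interior nonneg_orthant \<Longrightarrow> a \<in> nonneg_orthant"
  using interior_subset by blast

lemma One_in_interior: "One \<in> interior nonneg_orthant"
  by (simp add: mem_interior_nonneg_orthant)

lemma nonneg_orthant_real: "nonneg_orthant = {0::real..}"
  by (auto simp: nonneg_orthant_def)

lemma closed_nonneg_orthant: "closed (nonneg_orthant :: 'a::euclidean_space set)"
proof -
  have "nonneg_orthant = (\<Inter>b\<in>Basis. {x :: 'a. 0 \<le> x \<bullet> b})" by (auto simp: nonneg_orthant_def)
  moreover have "closed \<dots>" by (intro closed_INT ballI closed_Collect_le continuous_intros)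
  ultimately show ?thesis by simp
qed

lemma norm_le_One_inner: "x \<in> nonneg_orthant \<Longrightarrow> norm x \<le> One \<bullet> x"
  using norm_le_l1[of x] unfolding nonneg_orthant_def
  by (subst euclidean_inner) (auto cong: sum.cong_simp)

lemma open_transform_domain: "open transform_domain"
  unfolding transform_domain_def
  by (intro open_Times open_interior) (use closed_nonneg_Reals_complex in \<open>simp add: open_Compl\<close>)

lemma inner_power_words:
  fixes c x :: "'a::euclidean_space"
  shows "(c \<bullet> x) ^ n = (\<Sum>ws\<in>basis_words n. prod_list (map ((\<bullet>) c) ws) * prod_list (map ((\<bullet>) x) ws))"
proof (induction n)
  case 0
  have "basis_words 0 = {[] :: 'a list}" by (auto simp: basis_words_def)
  thus ?case by simp
next
  case (Suc n)
  have "(c \<bullet> x) ^ Suc n = (\<Sum>b\<in>Basis. (c \<bullet> b) * (x \<bullet> b)) * (c \<bullet> x) ^ n"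
    by (simp add: euclidean_inner[of c x])
  also have "\<dots> = (\<Sum>b\<in>Basis. \<Sum>ws\<in>basis_words n. prod_list (map ((\<bullet>) c) (b # ws)) * prod_list (map ((\<bullet>) x) (b # ws)))"
    unfolding Suc by (simp add: sum_product mult_ac)
  finally show ?case by (simp only: sum_basis_words_Suc)
qed

lemma prod_list_basis_word:
  assumes "set ws \<subseteq> Basis"
  shows "prod_list (map ((\<bullet>) x) ws) = monomial (count_list ws) x"
  using assms
proof (induction ws)
  case (Cons b ws)
  have "monomial (count_list (b # ws)) x = (\<Prod>c\<in>Basis. (if c = b then x \<bullet> c else 1) * (x \<bullet> c) ^ count_list ws c)"
    unfolding monomial_def by (intro prod.cong) auto
  also have "\<dots> = (x \<bullet> b) * monomial (count_list ws) x"
    using Cons.prems unfolding monomial_def by (simp add: prod.distrib)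
  finally show ?case using Cons by (simp del: count_list.simps)
qed (simp add: monomial_def)

text \<open>A family closed under directional derivatives consists of smooth functions. Closure is
  asked only up to equality on S, so the members may behave arbitrarily outside.\<close>

lemma smooth_on_class:
  assumes "open S"
    and cl: "\<And>f. f \<in> Cl \<Longrightarrow> \<exists>D. (\<forall>x\<in>S. (f has_derivative D x) (at x)) \<and> (\<forall>v. \<exists>g\<in>Cl. \<forall>x\<in>S. D x v = g x)"
    and f: "f \<in> Cl"
  shows "smooth_on S f"
proof -
  have "\<forall>f g. f \<in> Cl \<longrightarrow> (\<forall>x\<in>S. g x = f x) \<longrightarrow> Ck_on k S g" for k
  proof (induction k)
    case 0
    show ?case
    proof (intro allI impI)
      fix f g assume f: "f \<in> Cl" and g: "\<forall>x\<in>S. g x = f x"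
      have "continuous_on S f" using cl[OF f] assms(1)
        by (meson continuous_at_imp_continuous_on has_derivative_continuous)
      thus "Ck_on 0 S g" using g by (simp cong: continuous_on_cong)
    qed
  next
    case (Suc k)
    show ?case
    proof (intro allI impI)
      fix f g assume f: "f \<in> Cl" and g: "\<forall>x\<in>S. g x = f x"
      obtain D where D: "\<And>x. x \<in> S \<Longrightarrow> (f has_derivative D x) (at x)" "\<And>v. \<exists>g\<in>Cl. \<forall>x\<in>S. D x v = g x"
        using cl[OF f] by blast
      have gD: "(g has_derivative D x) (at x)" if "x \<in> S" for x
        by (rule has_derivative_transform_within_open[OF D(1)[OF that] assms(1) that]) (use g in simp)
      have "Ck_on k S (dir_deriv v g)" for v
      proof -
        obtain h where h: "h \<in> Cl" "\<forall>x\<in>S. D x v = h x" using D(2) by blast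
        have "dir_deriv v g x = h x" if "x \<in> S" for x using dir_deriv_eqI[OF gD[OF that]] h(2) that by simp
        thus ?thesis using Suc h(1) by blast
      qed
      thus "Ck_on (Suc k) S g" using gD by (auto simp: differentiable_def)
    qed
  qed
  thus ?thesis using f unfolding smooth_on_def by blast
qed

text \<open>With u = 1 / w, v = 1 / w' and d = w' - w this bounds the second order Taylor remainder
  of w \<mapsto> 1 / w^n, uniformly while u and v stay bounded. Encoding the inverses by
  \<open>v - u = - (d * u * v)\<close> turns the induction into polynomial algebra.\<close>

lemma inverse_power_remainder:
  fixes M :: real
  assumes "M \<ge> 0"
  shows "\<exists>B\<ge>0. \<forall>u v d :: complex. norm u \<le> M \<longrightarrow> norm v \<le> M \<longrightarrow> v - u = - (d * u * v) \<longrightarrow>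
    norm (v ^ n - u ^ n + of_nat n * d * u ^ Suc n) \<le> B * (norm d)\<^sup>2"
proof (induction n)
  case 0 show ?case by (intro exI[of _ 0]) simp
next
  case (Suc n)
  then obtain B where B: "B \<ge> 0" "\<And>u v d :: complex. norm u \<le> M \<Longrightarrow> norm v \<le> M \<Longrightarrow> v - u = - (d * u * v) \<Longrightarrow>
    norm (v ^ n - u ^ n + of_nat n * d * u ^ Suc n) \<le> B * (norm d)\<^sup>2" by blast
  show ?case
  proof (intro exI[of _ "M * B + real (Suc n) * M ^ (n + 3)"] conjI allI impI)
    show "0 \<le> M * B + real (Suc n) * M ^ (n + 3)" using assms B(1) by simp
    fix u v d :: complex assume a: "norm u \<le> M" "norm v \<le> M" "v - u = - (d * u * v)"
    let ?e = "v ^ n - u ^ n + of_nat n * d * u ^ Suc n"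
    have v: "v = u - d * u * v" using a(3) by (simp add: algebra_simps)
    have uv: "u - v = d * u * v" using a(3) by (simp add: algebra_simps)
    have vu: "u ^ n * (v - u) + d * u ^ Suc n * u = d * u ^ Suc n * (u - v)"
      unfolding a(3) by (simp add: algebra_simps)
    have "v ^ Suc n - u ^ Suc n + of_nat (Suc n) * d * u ^ Suc (Suc n)
        = v * ?e + (u ^ n * (v - u) + d * u ^ Suc n * u) + of_nat n * (d * u ^ Suc n * (u - v))"
      by (simp add: algebra_simps)
    also have "\<dots> = v * ?e + of_nat (Suc n) * (d * u ^ Suc n * (u - v))"
      unfolding vu by (simp add: algebra_simps)
    also have "\<dots> = v * ?e + of_nat (Suc n) * d\<^sup>2 * (u ^ (n + 2) * v)"
      by (subst uv) (simp add: power2_eq_square mult_ac)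
    finally have eq: "v ^ Suc n - u ^ Suc n + of_nat (Suc n) * d * u ^ Suc (Suc n)
      = v * ?e + of_nat (Suc n) * d\<^sup>2 * (u ^ (n + 2) * v)" .
    have "norm (v * ?e) \<le> M * (B * (norm d)\<^sup>2)" unfolding norm_mult
      using a B assms by (intro mult_mono) auto
    moreover have "norm (of_nat (Suc n) * d\<^sup>2 * (u ^ (n + 2) * v)) \<le> (real (Suc n) * (norm d)\<^sup>2) * (M ^ (n + 2) * M)"
      unfolding norm_mult norm_power norm_of_nat using a assms by (intro mult_mono power_mono order_refl) auto
    ultimately show "norm (v ^ Suc n - u ^ Suc n + of_nat (Suc n) * d * u ^ Suc (Suc n)) \<le> (M * B + real (Suc n) * M ^ (n + 3)) * (norm d)\<^sup>2"
      unfolding eq by (intro order_trans[OF norm_triangle_ineq]) (simp add: algebra_simps power_add numeral_3_eq_3)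
  qed
qed

text \<open>Each derivative of a resolvent integral multiplies the numerator by an affine function
  of x. Polynomial growth is stable under this, and finite moments make such numerators integrable
  against bounded kernels.\<close>

definition poly_bounded :: "('a::real_normed_vector \<Rightarrow> complex) \<Rightarrow> bool" where
  "poly_bounded q \<longleftrightarrow> q \<in> borel_measurable borel \<and> (\<exists>C m. \<forall>x. norm (q x) \<le> C * (1 + norm x) ^ m)"

lemma poly_bounded_const [simp]: "poly_bounded (\<lambda>_. c)"
  unfolding poly_bounded_def
proof (intro conjI exI allI)
  show "norm c \<le> norm c * (1 + norm x) ^ 0" for x :: 'a by simp
qed simp

lemma poly_bounded_mult:
  assumes "poly_bounded p" "poly_bounded q" shows "poly_bounded (\<lambda>x. p x * q x)"
proof -
  obtain C m D n where C: "\<And>x. norm (p x) \<le> C * (1 + norm x) ^ m" and D: "\<And>x. norm (q x) \<le> D * (1 + norm x) ^ n"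
    using assms unfolding poly_bounded_def by blast
  have "norm (p x * q x) \<le> (C * D) * (1 + norm x) ^ (m + n)" for x
  proof -
    have "norm (p x * q x) \<le> (C * (1 + norm x) ^ m) * (D * (1 + norm x) ^ n)" unfolding norm_mult
      by (intro mult_mono C D) (auto intro: order_trans[OF norm_ge_zero C])
    thus ?thesis by (simp add: power_add mult_ac)
  qed
  thus ?thesis using assms unfolding poly_bounded_def by auto
qed

lemma poly_bounded_linear:
  fixes v :: "'a::euclidean_space"
  shows "poly_bounded (\<lambda>x. complex_of_real (v \<bullet> x) - \<zeta>)"
  unfolding poly_bounded_def
proof (intro conjI exI allI)
  show "(\<lambda>x. complex_of_real (v \<bullet> x) - \<zeta>) \<in> borel_measurable borel" by measurable
  fix x :: 'a
  have "norm (complex_of_real (v \<bullet> x) - \<zeta>) \<le> \<bar>v \<bullet> x\<bar> + norm \<zeta>" by (rule order_trans[OF norm_triangle_ineq4]) simp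
  also have "\<dots> \<le> norm v * norm x + norm \<zeta>" using Cauchy_Schwarz_ineq2[of v x] by simp
  also have "\<dots> \<le> (norm v + norm \<zeta>) * (1 + norm x) ^ 1"
    using mult_nonneg_nonneg[OF norm_ge_zero[of \<zeta>] norm_ge_zero[of x]] by (simp add: algebra_simps)
  finally show "norm (complex_of_real (v \<bullet> x) - \<zeta>) \<le> (norm v + norm \<zeta>) * (1 + norm x) ^ 1" .
qed

section \<open>Differentiation of resolvent integrals under the integral sign\<close>

locale orthant_measure =
  fixes \<nu> :: "'a::euclidean_space measure"
  assumes mm: "\<nu> \<in> moment_measures nonneg_orthant"
begin

lemma sets_eq [measurable_cong]: "sets \<nu> = sets borel"
  and integrable_monomial: "integrable \<nu> (monomial \<alpha>)"
  using mm unfolding moment_measures_def by auto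

lemma measurable_eq: "borel_measurable \<nu> = borel_measurable borel"
  by (intro measurable_cong_sets sets_eq refl)

lemma AE_orthant: "AE x in \<nu>. x \<in> nonneg_orthant"
proof (rule AE_I)
  show "emeasure \<nu> (- nonneg_orthant) = 0" using mm unfolding moment_measures_def by auto
  show "- nonneg_orthant \<in> sets \<nu>" unfolding sets_eq by (intro borel_comp borel_closed closed_nonneg_orthant)
qed auto

sublocale finite_measure \<nu>
proof
  have "monomial (\<lambda>_. 0) = (\<lambda>_ :: 'a. 1 :: real)" by (simp add: monomial_def fun_eq_iff)
  thus "emeasure \<nu> (space \<nu>) \<noteq> \<infinity>" using integrable_monomial[of "\<lambda>_. 0"] by (simp add: integrable_iff_bounded)
qed

lemma integrable_inner_power: "integrable \<nu> (\<lambda>x. (c \<bullet> x) ^ n)"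
proof -
  have "(\<lambda>x. (c \<bullet> x) ^ n) = (\<lambda>x. \<Sum>ws\<in>basis_words n. prod_list (map ((\<bullet>) c) ws) * monomial (count_list ws) x)"
    by (auto simp: inner_power_words basis_words_def prod_list_basis_word intro!: sum.cong)
  thus ?thesis using integrable_monomial by simp
qed

lemma integrable_one_plus_norm_power: "integrable \<nu> (\<lambda>x. (1 + norm x) ^ m)"
proof (rule Bochner_Integration.integrable_bound)
  show "integrable \<nu> (\<lambda>x. \<Sum>k\<le>m. real (m choose k) * (One \<bullet> x) ^ k)"
    using integrable_inner_power by simp
  show "(\<lambda>x. (1 + norm x) ^ m) \<in> borel_measurable \<nu>" by measurable
  show "AE x in \<nu>. norm ((1 + norm x) ^ m) \<le> norm (\<Sum>k\<le>m. real (m choose k) * (One \<bullet> x) ^ k)"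
    using AE_orthant
  proof eventually_elim
    case (elim x)
    have "(\<Sum>k\<le>m. real (m choose k) * (One \<bullet> x) ^ k) = (1 + One \<bullet> x) ^ m"
      using binomial_ring[of "One \<bullet> x" 1 m] by (simp add: add.commute)
    moreover have "(1 + norm x) ^ m \<le> (1 + One \<bullet> x) ^ m"
      using norm_le_One_inner[OF elim] by (intro power_mono) auto
    ultimately show ?case by simp
  qed
qed

lemma integrable_poly_bounded:
  assumes "poly_bounded q" "g \<in> borel_measurable borel" "AE x in \<nu>. norm (g x :: complex) \<le> B"
  shows "integrable \<nu> (\<lambda>x. q x * g x)"
proof -
  obtain C m where C: "\<And>x. norm (q x) \<le> C * (1 + norm x) ^ m" and q: "q \<in> borel_measurable borel"
    using assms(1) unfolding poly_bounded_def by blast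
  show ?thesis
  proof (rule Bochner_Integration.integrable_bound)
    show "integrable \<nu> (\<lambda>x. (C * B) * (1 + norm x) ^ m)" using integrable_one_plus_norm_power by simp
    show "(\<lambda>x. q x * g x) \<in> borel_measurable \<nu>" unfolding measurable_eq using q assms(2) by measurable
    show "AE x in \<nu>. norm (q x * g x) \<le> norm ((C * B) * (1 + norm x) ^ m)" using assms(3)
    proof eventually_elim
      case (elim x)
      have "norm (q x * g x) \<le> (C * (1 + norm x) ^ m) * B" unfolding norm_mult
        using elim C by (intro mult_mono) (auto intro: order_trans[OF norm_ge_zero C])
      thus ?case by (simp add: mult_ac)
    qed
  qed
qed

definition K :: "('a \<Rightarrow> complex) \<Rightarrow> nat \<Rightarrow> 'a \<times> complex \<Rightarrow> complex" where
  "K q n = (\<lambda>(a, z). \<integral>x. q x * (1 / (complex_of_real (a \<bullet> x) - z)) ^ n \<partial>\<nu>)"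

text \<open>If \<open>a \<bullet> x\<close> came too close to z, then (a, a \<bullet> x) itself
  would lie in the open domain; but \<open>a \<bullet> x\<close> is nonnegative and hence on the
  excluded ray. This makes the bound uniform in x although the orthant is unbounded.\<close>

lemma kernel_lower_bound:
  assumes "p \<in> transform_domain"
  obtains r c where "r > 0" "c > 0" "ball p r \<subseteq> transform_domain"
    "\<And>a z x. (a, z) \<in> ball p r \<Longrightarrow> x \<in> nonneg_orthant \<Longrightarrow> c \<le> norm (complex_of_real (a \<bullet> x) - z)"
proof -
  obtain e where e: "e > 0" "ball p e \<subseteq> transform_domain"
    using assms open_transform_domain open_contains_ball by blast
  have "e / 2 \<le> norm (complex_of_real (a \<bullet> x) - z)" if az: "(a, z) \<in> ball p (e / 2)" and x: "x \<in> nonneg_orthant" for a x z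
  proof (rule ccontr)
    assume "\<not> ?thesis"
    hence "dist (a, complex_of_real (a \<bullet> x)) (a, z) < e / 2" by (simp add: dist_norm dist_Pair_Pair)
    hence "(a, complex_of_real (a \<bullet> x)) \<in> ball p e"
      using az dist_triangle[of p "(a, complex_of_real (a \<bullet> x))" "(a, z)"] by (simp add: dist_commute)
    hence t: "(a, complex_of_real (a \<bullet> x)) \<in> transform_domain" using e(2) by blast
    hence "a \<in> nonneg_orthant" using interior_nonneg_orthant_subset by (auto simp: transform_domain_def)
    thus False using t inner_nonneg_orthant[OF _ x] by (auto simp: transform_domain_def)
  qed
  moreover have "ball p (e / 2) \<subseteq> transform_domain" using e by (auto simp: subset_iff)
  ultimately show ?thesis using that[of "e / 2" "e / 2"] e(1) by auto
qed

lemma K_integrable: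
  assumes "poly_bounded q" "(a, z) \<in> transform_domain"
  shows "integrable \<nu> (\<lambda>x. q x * (1 / (complex_of_real (a \<bullet> x) - z)) ^ n)"
proof -
  obtain r c where rc: "r > 0" "c > 0"
    "\<And>a' z' x. (a', z') \<in> ball (a, z) r \<Longrightarrow> x \<in> nonneg_orthant \<Longrightarrow> c \<le> norm (complex_of_real (a' \<bullet> x) - z')"
    using kernel_lower_bound[OF assms(2)] by metis
  have c: "c \<le> norm (complex_of_real (a \<bullet> x) - z)" if "x \<in> nonneg_orthant" for x
    using rc(3)[of a z] rc(1) that by simp
  show ?thesis
  proof (rule integrable_poly_bounded[OF assms(1)])
    show "(\<lambda>x. (1 / (complex_of_real (a \<bullet> x) - z)) ^ n) \<in> borel_measurable borel" by measurable
    show "AE x in \<nu>. norm ((1 / (complex_of_real (a \<bullet> x) - z)) ^ n) \<le> (1 / c) ^ n"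
      using AE_orthant by eventually_elim (use c rc(2) in \<open>auto simp: norm_power norm_divide intro!: power_mono frac_le\<close>)
  qed
qed

text \<open>For an increment h the kernel remainder is of order |h|^2 (1 + |x|)^2, since v \<bullet>
  x - \<zeta> enters squared. The moments of \<nu> bound the integrated remainder by
  \<open>E\<close> times |h|^2.\<close>

lemma K_has_derivative:
  assumes q: "poly_bounded q" and p: "p \<in> transform_domain"
  shows "(K q n has_derivative (\<lambda>(v, \<zeta>). K (\<lambda>x. - of_nat n * (complex_of_real (v \<bullet> x) - \<zeta>) * q x) (Suc n) p)) (at p)"
proof -
  obtain a z where az: "p = (a, z)" by (cases p)
  define D where "D = (\<lambda>(v, \<zeta>). K (\<lambda>x. - of_nat n * (complex_of_real (v \<bullet> x) - \<zeta>) * q x) (Suc n) p)"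
  have pbl: "poly_bounded (\<lambda>x. - of_nat n * (complex_of_real (v \<bullet> x) - \<zeta>) * q x)" for v \<zeta>
    by (intro poly_bounded_mult poly_bounded_linear q poly_bounded_const)
  note int = K_integrable[OF _ p[unfolded az]]
  obtain r c where rc: "r > 0" "c > 0" "ball p r \<subseteq> transform_domain"
    "\<And>a z x. (a, z) \<in> ball p r \<Longrightarrow> x \<in> nonneg_orthant \<Longrightarrow> c \<le> norm (complex_of_real (a \<bullet> x) - z)"
    using kernel_lower_bound[OF p] by metis
  obtain B where B: "B \<ge> 0" "\<And>u v d :: complex. norm u \<le> 1 / c \<Longrightarrow> norm v \<le> 1 / c \<Longrightarrow> v - u = - (d * u * v) \<Longrightarrow>
    norm (v ^ n - u ^ n + of_nat n * d * u ^ Suc n) \<le> B * (norm d)\<^sup>2"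
    using inverse_power_remainder[of "1 / c" n] rc(2) by auto
  obtain C m where C: "\<And>x. norm (q x) \<le> C * (1 + norm x) ^ m" and qm: "q \<in> borel_measurable borel"
    using q unfolding poly_bounded_def by blast
  have "C \<ge> 0" using order_trans[OF norm_ge_zero C[of 0]] by simp
  define E where "E = (\<integral>x. C * B * (1 + norm x) ^ (m + 2) \<partial>\<nu>)"
  have "linear D" unfolding D_def
  proof (rule linearI)
    show "(\<lambda>(v, \<zeta>). K (\<lambda>x. - of_nat n * (complex_of_real (v \<bullet> x) - \<zeta>) * q x) (Suc n) p) (h + k)
      = (\<lambda>(v, \<zeta>). K (\<lambda>x. - of_nat n * (complex_of_real (v \<bullet> x) - \<zeta>) * q x) (Suc n) p) h
        + (\<lambda>(v, \<zeta>). K (\<lambda>x. - of_nat n * (complex_of_real (v \<bullet> x) - \<zeta>) * q x) (Suc n) p) k" for h k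
      unfolding K_def az case_prod_unfold fst_conv snd_conv
      by (subst Bochner_Integration.integral_add[symmetric, OF int int], rule pbl, rule pbl)
        (intro Bochner_Integration.integral_cong refl, simp add: inner_add_left algebra_simps add_divide_distrib)
    show "(\<lambda>(v, \<zeta>). K (\<lambda>x. - of_nat n * (complex_of_real (v \<bullet> x) - \<zeta>) * q x) (Suc n) p) (s *\<^sub>R h)
      = s *\<^sub>R (\<lambda>(v, \<zeta>). K (\<lambda>x. - of_nat n * (complex_of_real (v \<bullet> x) - \<zeta>) * q x) (Suc n) p) h" for s h
      unfolding K_def az case_prod_unfold fst_conv snd_conv
      by (subst integral_scaleR_right[symmetric])
        (intro Bochner_Integration.integral_cong refl, simp add: scaleR_conv_of_real algebra_simps)
  qed
  hence bl: "bounded_linear D" by (simp add: linear_conv_bounded_linear)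
  have "(K q n has_derivative D) (at p)"
  proof (rule has_derivativeI_sandwich[of r])
    show "r > 0" by (rule rc(1))
    show "bounded_linear D" by (rule bl)
    show "((\<lambda>y. E * norm (y - p)) \<longlongrightarrow> 0) (at p)" by (auto intro!: tendsto_eq_intros)
    fix y assume y: "y \<in> UNIV" "y \<noteq> p" "dist y p < r"
    obtain a' z' where y': "y = (a', z')" by (cases y)
    define v where "v = a' - a" define \<zeta> where "\<zeta> = z' - z"
    have yp: "y - p = (v, \<zeta>)" by (simp add: y' az v_def \<zeta>_def)
    have yin: "y \<in> ball p r" using y(3) by (simp add: dist_commute)
    have yd: "y \<in> transform_domain" using yin rc(3) by blast
    note inty = K_integrable[OF q yd[unfolded y']]
    let ?d = "\<lambda>x. complex_of_real (v \<bullet> x) - \<zeta>"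
    have Dy: "D (y - p) = (\<integral>x. (- of_nat n * ?d x * q x) * (1 / (complex_of_real (a \<bullet> x) - z)) ^ Suc n \<partial>\<nu>)"
      unfolding yp by (simp add: D_def K_def az)
    have "K q n y - K q n p - D (y - p) = (\<integral>x. q x * ((1 / (complex_of_real (a' \<bullet> x) - z')) ^ n - (1 / (complex_of_real (a \<bullet> x) - z)) ^ n
       + of_nat n * ?d x * (1 / (complex_of_real (a \<bullet> x) - z)) ^ Suc n) \<partial>\<nu>)"
      unfolding Dy unfolding K_def y' az prod.case
      by (subst Bochner_Integration.integral_diff[symmetric, OF inty int[OF q]],
          subst Bochner_Integration.integral_diff[symmetric, OF Bochner_Integration.integrable_diff[OF inty int[OF q]] int[OF pbl]])
        (intro Bochner_Integration.integral_cong refl, simp add: algebra_simps add_divide_distrib diff_divide_distrib)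
    also have "norm \<dots> \<le> (\<integral>x. C * B * (1 + norm x) ^ (m + 2) * (norm (y - p))\<^sup>2 \<partial>\<nu>)"
    proof (rule order_trans[OF integral_norm_bound integral_mono_AE[OF integrable_norm]])
      have "integrable \<nu> (\<lambda>x. q x * (1 / (complex_of_real (a' \<bullet> x) - z')) ^ n - q x * (1 / (complex_of_real (a \<bullet> x) - z)) ^ n
         - (- of_nat n * ?d x * q x) * (1 / (complex_of_real (a \<bullet> x) - z)) ^ Suc n)"
        by (intro Bochner_Integration.integrable_diff inty int q pbl)
      thus "integrable \<nu> (\<lambda>x. q x * ((1 / (complex_of_real (a' \<bullet> x) - z')) ^ n - (1 / (complex_of_real (a \<bullet> x) - z)) ^ n
         + of_nat n * ?d x * (1 / (complex_of_real (a \<bullet> x) - z)) ^ Suc n))"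
        by (simp add: algebra_simps add_divide_distrib diff_divide_distrib)
      show "integrable \<nu> (\<lambda>x. C * B * (1 + norm x) ^ (m + 2) * (norm (y - p))\<^sup>2)"
        using integrable_one_plus_norm_power[of "m + 2"] by simp
      show "AE x in \<nu>. norm (q x * ((1 / (complex_of_real (a' \<bullet> x) - z')) ^ n - (1 / (complex_of_real (a \<bullet> x) - z)) ^ n
         + of_nat n * ?d x * (1 / (complex_of_real (a \<bullet> x) - z)) ^ Suc n)) \<le> C * B * (1 + norm x) ^ (m + 2) * (norm (y - p))\<^sup>2"
        using AE_orthant
      proof eventually_elim
        case (elim x)
        let ?w = "complex_of_real (a \<bullet> x) - z" and ?w' = "complex_of_real (a' \<bullet> x) - z'"
        have w: "c \<le> norm ?w" "c \<le> norm ?w'" using rc(4)[of a z x] rc(4)[of a' z' x] elim yin rc(1) by (auto simp: y' az)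
        hence nz: "?w \<noteq> 0" "?w' \<noteq> 0" using rc(2) by auto
        have "?w' - ?w = ?d x" by (simp add: v_def \<zeta>_def inner_diff_left)
        moreover have "1 / w' - 1 / w = - ((w' - w) * (1 / w) * (1 / w'))" if "w \<noteq> 0" "w' \<noteq> 0" for w w' :: complex
          using that by (simp add: field_simps)
        ultimately have e: "1 / ?w' - 1 / ?w = - (?d x * (1 / ?w) * (1 / ?w'))" using nz by metis
        have 1: "norm ((1 / ?w') ^ n - (1 / ?w) ^ n + of_nat n * ?d x * (1 / ?w) ^ Suc n) \<le> B * (norm (?d x))\<^sup>2"
          using w rc(2) e by (intro B(2)) (auto simp: norm_divide intro!: frac_le)
        have "norm (?d x) \<le> norm v * norm x + norm \<zeta>"
          using Cauchy_Schwarz_ineq2[of v x] norm_triangle_ineq4[of "complex_of_real (v \<bullet> x)" \<zeta>] by simp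
        also have "\<dots> \<le> norm (y - p) * norm x + norm (y - p)"
          unfolding yp using norm_fst_le[of v \<zeta>] norm_snd_le[of \<zeta> v] by (intro add_mono mult_right_mono) auto
        finally have "norm (?d x) \<le> norm (y - p) * (1 + norm x)" by (simp add: algebra_simps)
        hence "(norm (?d x))\<^sup>2 \<le> (norm (y - p) * (1 + norm x))\<^sup>2" by (intro power_mono) auto
        hence 2: "B * (norm (?d x))\<^sup>2 \<le> B * (norm (y - p) * (1 + norm x))\<^sup>2" using B(1) by (rule mult_left_mono)
        have "norm (q x * ((1 / ?w') ^ n - (1 / ?w) ^ n + of_nat n * ?d x * (1 / ?w) ^ Suc n))
          \<le> (C * (1 + norm x) ^ m) * (B * (norm (y - p) * (1 + norm x))\<^sup>2)"
          unfolding norm_mult[of "q x"] by (rule mult_mono[OF C order_trans[OF 1 2]]) (use \<open>C \<ge> 0\<close> in auto)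
        moreover have "(C * (1 + norm x) ^ m) * (B * (norm (y - p) * (1 + norm x))\<^sup>2)
          = C * B * (1 + norm x) ^ (m + 2) * (norm (y - p))\<^sup>2"
          by (simp add: power_add power_mult_distrib power2_eq_square mult_ac)
        ultimately show ?case by (simp only:)
      qed
    qed
    also have "\<dots> = E * (norm (y - p))\<^sup>2" by (simp add: E_def)
    finally show "norm (K q n y - K q n p - D (y - p)) / norm (y - p) \<le> E * norm (y - p)"
      using y(2) by (simp add: field_simps power2_eq_square)
  qed
  thus ?thesis unfolding D_def .
qed

end


context orthant_measure
begin

lemma K_smooth: "poly_bounded q \<Longrightarrow> smooth_on transform_domain (K q n)"
proof (rule smooth_on_class[OF open_transform_domain, where Cl = "{f. \<exists>q n. poly_bounded q \<and> f = K q n}"])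
  fix f assume "f \<in> {f. \<exists>q n. poly_bounded q \<and> f = K q n}"
  then obtain q n where q: "poly_bounded q" "f = K q n" by blast
  let ?D = "\<lambda>p (v, \<zeta>). K (\<lambda>x. - of_nat n * (complex_of_real (v \<bullet> x) - \<zeta>) * q x) (Suc n) p"
  show "\<exists>D. (\<forall>p\<in>transform_domain. (f has_derivative D p) (at p)) \<and>
      (\<forall>v. \<exists>g\<in>{f. \<exists>q n. poly_bounded q \<and> f = K q n}. \<forall>p\<in>transform_domain. D p v = g p)"
  proof (intro exI[of _ ?D] conjI ballI allI)
    fix v :: "'a \<times> complex"
    have "poly_bounded (\<lambda>x. - of_nat n * (complex_of_real (fst v \<bullet> x) - snd v) * q x)"
      by (intro poly_bounded_mult poly_bounded_linear q poly_bounded_const)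
    thus "\<exists>g\<in>{f. \<exists>q n. poly_bounded q \<and> f = K q n}. \<forall>p\<in>transform_domain. ?D p v = g p"
      by (auto simp: case_prod_unfold)
  qed (use q K_has_derivative in auto)
qed auto

section \<open>The transform on the negative axis and its complete monotonicity\<close>

definition KR :: "('a \<Rightarrow> real) \<Rightarrow> nat \<Rightarrow> 'a \<times> real \<Rightarrow> real" where
  "KR q n = (\<lambda>(a, t). \<integral>x. q x * (1 / (a \<bullet> x + t)) ^ n \<partial>\<nu>)"

lemma KR_eq: "K (\<lambda>x. complex_of_real (q x)) n (a, - complex_of_real t) = complex_of_real (KR q n (a, t))"
proof -
  have "K (\<lambda>x. complex_of_real (q x)) n (a, - complex_of_real t)
      = (\<integral>x. complex_of_real (q x * (1 / (a \<bullet> x + t)) ^ n) \<partial>\<nu>)" by (simp add: K_def)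
  thus ?thesis by (simp only: integral_complex_of_real KR_def prod.case)
qed

lemma negative_in_domain:
  "a \<in> interior nonneg_orthant \<Longrightarrow> 0 < t \<Longrightarrow> (a, - complex_of_real t) \<in> transform_domain"
  by (auto simp: transform_domain_def complex_nonneg_Reals_iff)

lemma KR_has_derivative:
  assumes q: "poly_bounded (\<lambda>x. complex_of_real (q x))"
    and p: "p \<in> interior nonneg_orthant \<times> {0<..}"
  shows "(KR q n has_derivative (\<lambda>(v, s). KR (\<lambda>x. - (real n * (v \<bullet> x + s) * q x)) (Suc n) p)) (at p)"
proof -
  obtain a t where at: "p = (a, t)" by (cases p)
  define \<phi> where "\<phi> = (\<lambda>(a :: 'a, t). (a, - complex_of_real t))"
  have \<phi>: "(\<phi> has_derivative \<phi>) (at p)" unfolding \<phi>_def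
    by (intro bounded_linear_imp_has_derivative linear_conv_bounded_linear[THEN iffD1] linearI)
      (auto simp: scaleR_conv_of_real)
  have in_dom: "\<phi> p \<in> transform_domain" using p negative_in_domain by (auto simp: \<phi>_def at)
  have eq: "KR q n = (\<lambda>p. Re (K (\<lambda>x. complex_of_real (q x)) n (\<phi> p)))"
    by (auto simp: \<phi>_def KR_eq fun_eq_iff)
  have "((\<lambda>p. Re (K (\<lambda>x. complex_of_real (q x)) n (\<phi> p))) has_derivative
      (\<lambda>h. Re ((\<lambda>(v, \<zeta>). K (\<lambda>x. - of_nat n * (complex_of_real (v \<bullet> x) - \<zeta>) * complex_of_real (q x)) (Suc n) (\<phi> p)) (\<phi> h)))) (at p)"
    by (intro bounded_linear.has_derivative[OF bounded_linear_Re]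
        diff_chain_at[OF \<phi> K_has_derivative[OF q in_dom], unfolded o_def])
  moreover have "Re ((\<lambda>(v, \<zeta>). K (\<lambda>x. - of_nat n * (complex_of_real (v \<bullet> x) - \<zeta>) * complex_of_real (q x)) (Suc n) (\<phi> p)) (\<phi> h))
     = (\<lambda>(v, s). KR (\<lambda>x. - (real n * (v \<bullet> x + s) * q x)) (Suc n) p) h" for h
  proof -
    obtain v s where h: "h = (v, s)" by (cases h)
    have "(\<lambda>x. - of_nat n * (complex_of_real (v \<bullet> x) - - complex_of_real s) * complex_of_real (q x))
      = (\<lambda>x. complex_of_real (- (real n * (v \<bullet> x + s) * q x)))" by (simp add: fun_eq_iff)
    thus ?thesis unfolding h at \<phi>_def prod.case by (simp only: KR_eq Re_complex_of_real)
  qed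
  ultimately show ?thesis unfolding eq by (simp only:)
qed

lemma poly_bounded_real_step:
  fixes q :: "'a \<Rightarrow> real"
  assumes q: "poly_bounded (\<lambda>x. complex_of_real (q x))"
  shows "poly_bounded (\<lambda>x. complex_of_real (c * (v \<bullet> x + s) * q x))"
proof -
  have "poly_bounded (\<lambda>x. complex_of_real c * (complex_of_real (v \<bullet> x) - complex_of_real (- s)) * complex_of_real (q x))"
    by (intro poly_bounded_mult poly_bounded_linear q poly_bounded_const)
  thus ?thesis by simp
qed

lemma KR_smooth:
  assumes "poly_bounded (\<lambda>x. complex_of_real (q x))"
  shows "smooth_on (interior nonneg_orthant \<times> {0<..}) (KR q n)"
proof (rule smooth_on_class[where Cl = "{f. \<exists>q n. poly_bounded (\<lambda>x. complex_of_real (q x)) \<and> f = KR q n}"])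
  fix f assume "f \<in> {f. \<exists>q n. poly_bounded (\<lambda>x. complex_of_real (q x)) \<and> f = KR q n}"
  then obtain q n where q: "poly_bounded (\<lambda>x. complex_of_real (q x))" "f = KR q n" by blast
  let ?D = "\<lambda>p (v, s). KR (\<lambda>x. - (real n * (v \<bullet> x + s) * q x)) (Suc n) p"
  show "\<exists>D. (\<forall>p\<in>interior nonneg_orthant \<times> {0<..}. (f has_derivative D p) (at p)) \<and>
      (\<forall>v. \<exists>g\<in>{f. \<exists>q n. poly_bounded (\<lambda>x. complex_of_real (q x)) \<and> f = KR q n}. \<forall>p\<in>interior nonneg_orthant \<times> {0<..}. D p v = g p)"
  proof (intro exI[of _ ?D] conjI ballI allI)
    fix v :: "'a \<times> real"
    have "poly_bounded (\<lambda>x. complex_of_real (- (real n * (fst v \<bullet> x + snd v) * q x)))"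
      using poly_bounded_real_step[OF q(1), of "- real n" "fst v" "snd v"] by simp
    thus "\<exists>g\<in>{f. \<exists>q n. poly_bounded (\<lambda>x. complex_of_real (q x)) \<and> f = KR q n}. \<forall>p\<in>interior nonneg_orthant \<times> {0<..}. ?D p v = g p"
      unfolding case_prod_unfold
      by (intro bexI[of _ "KR (\<lambda>x. - (real n * (fst v \<bullet> x + snd v) * q x)) (Suc n)"] CollectI
          exI[of _ "\<lambda>x. - (real n * (fst v \<bullet> x + snd v) * q x)"] exI[of _ "Suc n"] conjI ballI refl)
  qed (use q KR_has_derivative in auto)
qed (use assms in \<open>auto intro!: open_Times\<close>)

lemma KR_nonneg:
  assumes "\<And>x. x \<in> nonneg_orthant \<Longrightarrow> 0 \<le> q x" "a \<in> interior nonneg_orthant" "t > 0"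
  shows "0 \<le> KR q n (a, t)"
  unfolding KR_def prod.case
proof (rule integral_nonneg_AE)
  show "AE x in \<nu>. 0 \<le> q x * (1 / (a \<bullet> x + t)) ^ n" using AE_orthant
  proof eventually_elim
    case (elim x)
    have "0 \<le> a \<bullet> x + t"
      using inner_nonneg_orthant[OF interior_nonneg_orthant_subset[OF assms(2)] elim] assms(3) by simp
    thus ?case using assms(1)[OF elim] by simp
  qed
qed

text \<open>The invariant behind complete monotonicity: up to the factor s the function is an
  integral with nonnegative numerator. A derivative in a direction of the orthant multiplies the
  numerator by a nonnegative affine function and flips the sign of s.\<close>

definition signed_KR :: "real \<Rightarrow> ('a \<times> real \<Rightarrow> real) \<Rightarrow> bool" where
  "signed_KR s f \<longleftrightarrow> (\<exists>q n. poly_bounded (\<lambda>x. complex_of_real (q x)) \<and> (\<forall>x\<in>nonneg_orthant. 0 \<le> q x) \<and>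
     (\<forall>p\<in>interior nonneg_orthant \<times> {0<..}. f p = s * KR q n p))"

lemma signed_KR_step:
  assumes f: "signed_KR s f" and v: "v \<in> nonneg_orthant" "r \<ge> 0"
  shows "signed_KR (- s) (dir_deriv (v, r) f)"
proof -
  let ?S = "interior nonneg_orthant \<times> {0<..} :: ('a \<times> real) set"
  obtain q n where q: "poly_bounded (\<lambda>x. complex_of_real (q x))" "\<And>x. x\<in>nonneg_orthant \<Longrightarrow> 0 \<le> q x"
     "\<And>p. p\<in>?S \<Longrightarrow> f p = s * KR q n p"
    using f unfolding signed_KR_def by blast
  have S: "open ?S" by (intro open_Times) auto
  show ?thesis unfolding signed_KR_def
  proof (intro exI[of _ "\<lambda>x. real n * (v \<bullet> x + r) * q x"] exI[of _ "Suc n"] conjI ballI)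
    show "poly_bounded (\<lambda>x. complex_of_real (real n * (v \<bullet> x + r) * q x))"
      by (rule poly_bounded_real_step[OF q(1)])
    show "0 \<le> real n * (v \<bullet> x + r) * q x" if "x \<in> nonneg_orthant" for x
      using that v q(2)[OF that] inner_nonneg_orthant[OF v(1) that] by simp
    fix p assume p: "p \<in> ?S"
    have "((\<lambda>p. s * KR q n p) has_derivative (\<lambda>h. s * (\<lambda>(v, r). KR (\<lambda>x. - (real n * (v \<bullet> x + r) * q x)) (Suc n) p) h)) (at p)"
      by (intro has_derivative_mult_right KR_has_derivative q p)
    from dir_deriv_eqI[OF this, of "(v, r)"]
    have "dir_deriv (v, r) (\<lambda>p. s * KR q n p) p = s * KR (\<lambda>x. - (real n * (v \<bullet> x + r) * q x)) (Suc n) p"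
      by simp
    moreover have "dir_deriv (v, r) f p = dir_deriv (v, r) (\<lambda>p. s * KR q n p) p"
      by (rule dir_deriv_cong[OF S p q(3)])
    ultimately show "dir_deriv (v, r) f p = - s * KR (\<lambda>x. real n * (v \<bullet> x + r) * q x) (Suc n) p"
      by (simp add: KR_def case_prod_unfold)
  qed
qed

lemma completely_monotonic_KR:
  assumes "\<And>p. p \<in> interior nonneg_orthant \<times> {0<..} \<Longrightarrow> G p = KR (\<lambda>_. 1) 1 p"
  shows "completely_monotonic G"
proof -
  let ?S = "interior nonneg_orthant \<times> {0<..} :: ('a \<times> real) set"
  have S: "open ?S" by (intro open_Times) auto
  have "smooth_on ?S (KR (\<lambda>_. 1) 1)" by (rule KR_smooth) simp
  hence smG: "smooth_on ?S G" 
    unfolding smooth_on_def using Ck_on_cong[OF S, of G "KR (\<lambda>_. 1) 1"] assms by simp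
  have base: "signed_KR 1 G" unfolding signed_KR_def
    by (intro exI[of _ "\<lambda>_. 1"] exI[of _ 1]) (simp add: assms)
  have j: "signed_KR ((- 1) ^ j) ((dir_deriv (0, 1) ^^ j) G)" for j
  proof (induction j)
    case (Suc j)
    thus ?case using signed_KR_step[of "(-1) ^ j" _ 0 1] by (simp add: nonneg_orthant_def)
  qed (simp add: base)
  have fold: "signed_KR ((- 1) ^ length bs * s) (fold (\<lambda>b. dir_deriv (b, 0)) bs f)"
    if "set bs \<subseteq> Basis" "signed_KR s f" for bs s f
    using that
  proof (induction bs arbitrary: s f)
    case (Cons b bs)
    have "b \<in> nonneg_orthant" using Cons.prems by (auto simp: nonneg_orthant_def inner_Basis)
    hence "signed_KR (- s) (dir_deriv (b, 0) f)" using signed_KR_step[OF Cons.prems(2)] by simp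
    thus ?case using Cons.IH[of "- s"] Cons.prems by simp
  qed simp
  show ?thesis unfolding completely_monotonic_def
  proof (intro conjI allI impI ballI smG)
    fix bs :: "'a list" and j and a :: 'a and t :: real
    assume bs: "set bs \<subseteq> Basis" and a: "a \<in> interior nonneg_orthant" and t: "t > 0"
    obtain q n where q: "\<And>x. x\<in>nonneg_orthant \<Longrightarrow> 0 \<le> q x"
     "\<And>p. p\<in>?S \<Longrightarrow> fold (\<lambda>b. dir_deriv (b, 0)) bs ((dir_deriv (0, 1) ^^ j) G) p = (- 1) ^ length bs * (- 1) ^ j * KR q n p"
      using fold[OF bs j] unfolding signed_KR_def by blast
    have "(- 1) ^ (length bs + j) * fold (\<lambda>b. dir_deriv (b, 0)) bs ((dir_deriv (0, 1) ^^ j) G) (a, t) = KR q n (a, t)"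
      using q(2)[of "(a, t)"] a t by (simp add: power_add mult_ac flip: power_mult_distrib)
    thus "0 \<le> (- 1) ^ (length bs + j) * fold (\<lambda>b. dir_deriv (b, 0)) bs ((dir_deriv (0, 1) ^^ j) G) (a, t)"
      using KR_nonneg[OF q(1) a t] by simp
  qed
qed

lemma stieltjes_transform_eq: "p \<in> transform_domain \<Longrightarrow> stieltjes_transform \<nu> p = K (\<lambda>_. 1) 1 p"
  by (auto simp: stieltjes_transform_def K_def)

lemma smooth_stieltjes_transform: "smooth_on transform_domain (stieltjes_transform \<nu>)"
  using K_smooth[of "\<lambda>_. 1" 1] stieltjes_transform_eq
    Ck_on_cong[OF open_transform_domain, of "stieltjes_transform \<nu>" "K (\<lambda>_. 1) 1"]
  unfolding smooth_on_def by simp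

lemma stieltjes_transform_negative:
  assumes "a \<in> interior nonneg_orthant" "t > 0"
  shows "stieltjes_transform \<nu> (a, - complex_of_real t) = complex_of_real (KR (\<lambda>_. 1) 1 (a, t))"
  using stieltjes_transform_eq[OF negative_in_domain[OF assms]] KR_eq[of "\<lambda>_. 1" 1 a t] by simp

text \<open>The total derivative, restricted to increments in z alone, is multiplication by a
  complex number.\<close>

lemma K_holomorphic:
  assumes "poly_bounded q" "a \<in> interior nonneg_orthant"
  shows "(\<lambda>z. K q n (a, z)) holomorphic_on (- \<real>\<^sub>\<ge>\<^sub>0)"
proof (rule holomorphic_onI)
  fix z :: complex assume "z \<in> - \<real>\<^sub>\<ge>\<^sub>0"
  hence p: "(a, z) \<in> transform_domain" using assms(2) by (simp add: transform_domain_def)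
  have "((\<lambda>z. (a, z)) has_derivative (\<lambda>\<zeta>. (0, \<zeta>))) (at z)" by (auto intro!: derivative_eq_intros)
  from diff_chain_at[OF this K_has_derivative[OF assms(1) p]]
  have "((\<lambda>z. K q n (a, z)) has_derivative (\<lambda>\<zeta>. K (\<lambda>x. - of_nat n * (0 - \<zeta>) * q x) (Suc n) (a, z))) (at z)"
    by (simp add: o_def)
  moreover have "K (\<lambda>x. - of_nat n * (0 - \<zeta>) * q x) (Suc n) (a, z) = K (\<lambda>x. of_nat n * q x) (Suc n) (a, z) * \<zeta>" for \<zeta>
    unfolding K_def prod.case by (subst integral_mult_left_zero[symmetric]) (intro Bochner_Integration.integral_cong refl, simp add: mult_ac)
  ultimately have "((\<lambda>z. K q n (a, z)) has_field_derivative K (\<lambda>x. of_nat n * q x) (Suc n) (a, z)) (at z)"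
    unfolding has_field_derivative_def by (simp only:)
  thus "(\<lambda>z. K q n (a, z)) field_differentiable at z within - \<real>\<^sub>\<ge>\<^sub>0"
    using field_differentiable_at_within field_differentiable_def by blast
qed

end

section \<open>Uniqueness of the resolvent transform\<close>

text \<open>Indicators of open sets are pointwise limits of bounded continuous functions, and the
  open sets are an intersection-stable generator of the Borel sets.\<close>

lemma finite_measure_eqI_continuous:
  fixes M N :: "'a::metric_space measure"
  assumes "finite_measure M" "finite_measure N" and sets: "sets M = sets borel" "sets N = sets borel"
    and eq: "\<And>f :: 'a \<Rightarrow> real. continuous_on UNIV f \<Longrightarrow> (\<And>x. 0 \<le> f x) \<Longrightarrow> (\<And>x. f x \<le> 1) \<Longrightarrow> (\<integral>x. f x \<partial>M) = (\<integral>x. f x \<partial>N)"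
  shows "M = N"
proof -
  interpret M: finite_measure M by fact
  interpret N: finite_measure N by fact
  have open_eq: "emeasure M U = emeasure N U" if U: "open U" for U
  proof -
    have conv: "(\<lambda>n. \<integral>x. (if U = UNIV then 1 else min 1 (real n * infdist x (- U))) \<partial>L) \<longlonglongrightarrow> measure L U"
      if "finite_measure L" and sL: "sets L = sets borel" for L :: "'a measure"
    proof -
      interpret L: finite_measure L by fact
      \<comment> \<open>The whole space is treated apart because its complement is empty and
        \<open>infdist\<close> to the empty set is 0.\<close>
      let ?f = "\<lambda>n x. (if U = UNIV then 1 else min 1 (real n * infdist x (- U))) :: real"
      have [measurable]: "?f n \<in> borel_measurable L" for n
        using sL by (cases "U = UNIV") (auto cong: measurable_cong_sets intro!: borel_measurable_continuous_onI continuous_intros)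
      have U': "U \<in> sets L" using sL U by simp
      have "(\<lambda>n. \<integral>x. ?f n x \<partial>L) \<longlonglongrightarrow> (\<integral>x. indicator U x \<partial>L)"
      proof (rule integral_dominated_convergence[where w="\<lambda>_. 1"])
        show "AE x in L. norm (?f n x) \<le> 1" for n
          by (auto simp: abs_le_iff intro!: always_eventually) (smt (verit) infdist_nonneg mult_nonneg_nonneg of_nat_0_le_iff)
        show "AE x in L. (\<lambda>n. ?f n x) \<longlonglongrightarrow> indicator U x"
        proof (intro always_eventually allI)
          fix x
          consider "U = UNIV" | "U \<noteq> UNIV" "x \<notin> U" | "U \<noteq> UNIV" "x \<in> U" by blast
          thus "(\<lambda>n. ?f n x) \<longlonglongrightarrow> indicator U x"
          proof cases
            case 3
            have "closed (- U)" using U by (simp add: closed_def)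
            hence "infdist x (- U) > 0" using 3 in_closed_iff_infdist_zero[of "- U" x] infdist_nonneg[of x "- U"]
              by (metis Compl_UNIV_eq Compl_iff double_compl le_less)
            then obtain m where m: "1 < real m * infdist x (- U)" using reals_Archimedean3 by blast
            have "?f n x = 1" if "n \<ge> m" for n
              using 3 m mult_right_mono[of "real m" "real n" "infdist x (- U)"] that infdist_nonneg[of x "- U"] by auto
            hence "\<forall>\<^sub>F n in sequentially. ?f n x = indicator U x"
              using 3 unfolding eventually_sequentially by (metis indicator_simps(1))
            thus ?thesis by (rule tendsto_eventually)
          qed auto
        qed
      qed (use U' in \<open>auto intro: borel_measurable_indicator\<close>)
      thus ?thesis using U' by simp
    qed
    have "(\<integral>x. (if U = UNIV then 1 else min 1 (real n * infdist x (- U))) \<partial>M)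
       = (\<integral>x. (if U = UNIV then 1 else min 1 (real n * infdist x (- U))) \<partial>N)" for n
      by (cases "U = UNIV"; rule eq) (auto intro!: continuous_intros simp: infdist_nonneg)
    hence "measure M U = measure N U"
      using conv[OF assms(1) sets(1)] conv[OF assms(2) sets(2)] LIMSEQ_unique by simp
    thus ?thesis by (simp add: M.emeasure_eq_measure N.emeasure_eq_measure)
  qed
  show ?thesis
  proof (rule measure_eqI_generator_eq[where E="{S. open S}" and A="\<lambda>_. UNIV" and \<Omega>=UNIV])
    show "Int_stable {S :: 'a set. open S}" by (auto simp: Int_stable_def)
    show "sets M = sigma_sets UNIV {S. open S}" "sets N = sigma_sets UNIV {S. open S}"
      using sets by (simp_all add: borel_def)
    show "emeasure M UNIV \<noteq> \<infinity>" for i :: nat by simp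
  qed (auto intro: open_eq)
qed

text \<open>The algebra spanned by exponentials of linear forms, prepared for Stone-Weierstrass:
  exponents add under products, h = 0 gives the constants, and points are separated.\<close>

inductive exp_sum :: "('a::euclidean_space \<Rightarrow> real) \<Rightarrow> bool" where
  exp: "exp_sum (\<lambda>x. c * exp (h \<bullet> x))"
| add: "exp_sum f \<Longrightarrow> exp_sum g \<Longrightarrow> exp_sum (\<lambda>x. f x + g x)"

lemma exp_sum_mult: assumes "exp_sum f" "exp_sum g" shows "exp_sum (\<lambda>x. f x * g x)"
proof -
  have 1: "exp_sum (\<lambda>x. (c * exp (h \<bullet> x)) * g x)" if "exp_sum g" for c h and g :: "'a \<Rightarrow> real"
    using that
  proof induction
    case (exp d k)
    have "exp_sum (\<lambda>x. (c * d) * exp ((h + k) \<bullet> x))" by (rule exp_sum.exp)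
    thus ?case by (simp add: inner_add_left exp_add mult_ac)
  next
    case (add f g)
    thus ?case using exp_sum.add[OF add.IH] by (simp add: distrib_left)
  qed
  show ?thesis using assms(1)
  proof induction
    case (exp c h) show ?case by (rule 1[OF assms(2)])
  next
    case (add f g) thus ?case using exp_sum.add[OF add.IH] by (simp add: distrib_right)
  qed
qed

lemma exp_sum_continuous: "exp_sum f \<Longrightarrow> continuous_on S f"
  by (induction rule: exp_sum.induct) (auto intro!: continuous_intros)

lemma finite_measure_eqI_exp:
  fixes M N :: "'a::euclidean_space measure"
  assumes "finite_measure M" "finite_measure N" and sets: "sets M = sets borel" "sets N = sets borel"
    and K: "compact K" "AE x in M. x \<in> K" "AE x in N. x \<in> K"
    and eq: "\<And>h. (\<integral>x. exp (h \<bullet> x) \<partial>M) = (\<integral>x. exp (h \<bullet> x) \<partial>N)"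
  shows "M = N"
proof (rule finite_measure_eqI_continuous[OF assms(1-4)])
  interpret M: finite_measure M by fact
  interpret N: finite_measure N by fact
  fix f :: "'a \<Rightarrow> real" assume f: "continuous_on UNIV f"
  have meas: "g \<in> borel_measurable M" "g \<in> borel_measurable N" if "continuous_on UNIV g" for g :: "'a \<Rightarrow> real"
    using borel_measurable_continuous_onI[OF that] sets by (simp_all cong: measurable_cong_sets)
  have int: "integrable M g" "integrable N g" if g: "continuous_on UNIV g" for g :: "'a \<Rightarrow> real"
  proof -
    have "bounded (g ` K)" using K(1) g by (intro compact_imp_bounded compact_continuous_image continuous_on_subset[OF g]) auto
    then obtain B where B: "\<And>x. x \<in> K \<Longrightarrow> norm (g x) \<le> B" unfolding bounded_iff by auto
    show "integrable M g" by (rule M.integrable_const_bound[of _ B]) (use K(2) B meas[OF g] in \<open>auto elim: eventually_mono\<close>)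
    show "integrable N g" by (rule N.integrable_const_bound[of _ B]) (use K(3) B meas[OF g] in \<open>auto elim: eventually_mono\<close>)
  qed
  have exp_eq: "(\<integral>x. g x \<partial>M) = (\<integral>x. g x \<partial>N)" if "exp_sum g" for g using that
  proof induction
    case (exp c h) thus ?case by (simp add: eq)
  next
    case (add g h)
    thus ?case by (simp add: int exp_sum_continuous)
  qed
  have close: "\<bar>(\<integral>x. f x \<partial>M) - (\<integral>x. f x \<partial>N)\<bar> \<le> e * (measure M (space M) + measure N (space N))" if e: "e > 0" for e
  proof -
    have "\<exists>g. exp_sum g \<and> (\<forall>x\<in>K. \<bar>f x - g x\<bar> < e)"
    proof (rule Stone_Weierstrass_HOL[OF K(1)])
      show "exp_sum (\<lambda>x :: 'a. c)" for c using exp_sum.exp[of c 0] by simp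
      fix x y :: 'a assume xy: "x \<in> K \<and> y \<in> K \<and> x \<noteq> y"
      \<comment> \<open>The exponent x - y separates x from y because the two inner products differ
        by the squared norm of x - y.\<close>
      have "(x - y) \<bullet> x \<noteq> (x - y) \<bullet> y" using xy by (metis eq_iff_diff_eq_0 inner_diff_right inner_eq_zero_iff)
      thus "\<exists>f. exp_sum f \<and> f x \<noteq> f y" using exp_sum.exp[of 1 "x - y"] by auto
    qed (use f e in \<open>auto intro: exp_sum_continuous exp_sum.add exp_sum_mult continuous_on_subset\<close>)
    then obtain g where g: "exp_sum g" "\<And>x. x \<in> K \<Longrightarrow> \<bar>f x - g x\<bar> < e" by blast
    have gc: "continuous_on UNIV g" by (rule exp_sum_continuous[OF g(1)])
    have "\<bar>(\<integral>x. f x \<partial>M) - (\<integral>x. g x \<partial>M)\<bar> \<le> (\<integral>x. e \<partial>M)"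
      unfolding Bochner_Integration.integral_diff[OF int(1)[OF f] int(1)[OF gc], symmetric]
      using K(2) by (intro order_trans[OF integral_abs_bound] integral_mono_AE integrable_abs Bochner_Integration.integrable_diff int f gc)
        (auto elim!: eventually_mono dest: g(2))
    moreover have "\<bar>(\<integral>x. f x \<partial>N) - (\<integral>x. g x \<partial>N)\<bar> \<le> (\<integral>x. e \<partial>N)"
      unfolding Bochner_Integration.integral_diff[OF int(2)[OF f] int(2)[OF gc], symmetric]
      using K(3) by (intro order_trans[OF integral_abs_bound] integral_mono_AE integrable_abs Bochner_Integration.integrable_diff int f gc)
        (auto elim!: eventually_mono dest: g(2))
    ultimately show ?thesis using exp_eq[OF g(1)] by (simp add: algebra_simps)
  qed
  show "(\<integral>x. f x \<partial>M) = (\<integral>x. f x \<partial>N)"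
  proof (rule ccontr)
    assume ne: "\<not> ?thesis"
    define m where "m = measure M (space M) + measure N (space N)"
    define d where "d = \<bar>(\<integral>x. f x \<partial>M) - (\<integral>x. f x \<partial>N)\<bar>"
    have d: "d > 0" using ne by (simp add: d_def)
    have m: "m \<ge> 0" by (simp add: m_def)
    have "d \<le> d / (2 * (m + 1)) * m"
      unfolding d_def m_def by (rule close, fold d_def m_def) (use d m in simp)
    also have "\<dots> < d" using d m by (simp add: pos_divide_less_eq)
    finally show False by simp
  qed
qed

lemma (in finite_measure) integral_sums:
  fixes g :: "nat \<Rightarrow> 'a \<Rightarrow> real"
  assumes [measurable]: "\<And>k. g k \<in> borel_measurable M" "f \<in> borel_measurable M"
    and s: "AE x in M. (\<lambda>k. g k x) sums f x"
    and b: "\<And>n. AE x in M. \<bar>\<Sum>k<n. g k x\<bar> \<le> B"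
  shows "(\<lambda>k. \<integral>x. g k x \<partial>M) sums (\<integral>x. f x \<partial>M)"
proof -
  have ig: "integrable M (g k)" for k
  proof (rule integrable_const_bound[of _ "2 * B"])
    show "AE x in M. norm (g k x) \<le> 2 * B" using b[of k] b[of "Suc k"] by eventually_elim auto
  qed simp
  have "(\<lambda>n. \<integral>x. (\<Sum>k<n. g k x) \<partial>M) \<longlonglongrightarrow> (\<integral>x. f x \<partial>M)"
    by (rule integral_dominated_convergence[where w="\<lambda>_. B"]) (use s b in \<open>auto simp: sums_def\<close>)
  thus ?thesis by (simp add: sums_def ig)
qed

text \<open>Zeros of a nonzero power series are isolated, so a one-sided interval is enough. Some
  applications move inside the orthant along a ray, where only nonnegative parameters are
  available.\<close>

lemma power_series_zeroI:
  fixes a :: "nat \<Rightarrow> real"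
  assumes d: "d > 0" and s: "\<And>x. 0 \<le> x \<Longrightarrow> x < d \<Longrightarrow> (\<lambda>n. a n * x ^ n) sums 0"
  shows "a n = 0"
proof (rule ccontr)
  assume n: "a n \<noteq> 0"
  have "a 0 = 0" by (rule sums_unique2[OF powser_sums_zero s[OF order_refl d]])
  hence "n > 0" using n by (cases n) auto
  define f where "f x = (\<Sum>n. a n * x ^ n)" for x
  have sm: "(\<lambda>n. a n * (x - 0) ^ n) sums f x" if "norm (x - 0) < d / 2" for x
  proof -
    have "summable (\<lambda>n. a n * (d / 2) ^ n)" using s[of "d / 2"] d by (auto simp: sums_iff)
    hence "summable (\<lambda>n. a n * x ^ n)" by (rule powser_inside) (use that d in auto)
    thus ?thesis by (simp add: f_def summable_sums)
  qed
  have f0: "f x = 0" if "0 \<le> x" "x < d" for x using s[OF that] by (simp add: f_def sums_iff)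
  obtain r where r: "r > 0" "\<And>z. z \<in> cball 0 r - {0} \<Longrightarrow> f z \<noteq> 0"
    using powser_0_nonzero[of "d / 2" 0 a f n] sm f0[of 0] n \<open>n > 0\<close> d by auto
  define x where "x = min r (d / 2)"
  have "x \<in> cball 0 r - {0}" using r(1) d by (auto simp: x_def)
  moreover have "f x = 0" using r(1) d by (intro f0) (auto simp: x_def)
  ultimately show False using r(2) by blast
qed

section \<open>Measures on the unit simplex\<close>

definition unit_simplex :: "'a::euclidean_space set" where
  "unit_simplex = {y \<in> nonneg_orthant. One \<bullet> y = 1}"

lemma compact_unit_simplex: "compact unit_simplex"
proof -
  have "closed (unit_simplex :: 'a set)"
  proof -
    have "unit_simplex = nonneg_orthant \<inter> {y :: 'a. One \<bullet> y = 1}" by (auto simp: unit_simplex_def)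
    moreover have "closed \<dots>"
      by (intro closed_Int closed_nonneg_orthant closed_Collect_eq continuous_intros)
    ultimately show ?thesis by simp
  qed
  moreover have "bounded (unit_simplex :: 'a set)"
    unfolding bounded_iff
  proof (intro exI[of _ 1] ballI)
    show "norm y \<le> 1" if "y \<in> unit_simplex" for y :: 'a
      using that norm_le_One_inner[of y] by (simp add: unit_simplex_def)
  qed
  ultimately show ?thesis by (simp add: compact_eq_bounded_closed)
qed

lemma abs_inner_unit_simplex: "y \<in> unit_simplex \<Longrightarrow> \<bar>h \<bullet> y\<bar> \<le> norm h"
  using Cauchy_Schwarz_ineq2[of h y] norm_le_One_inner[of y] mult_left_mono[of "norm y" 1 "norm h"]
  by (auto simp: unit_simplex_def)

lemma One_minus_interior:
  fixes h :: "'a::euclidean_space"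
  assumes "norm h < 1" shows "One - h \<in> interior nonneg_orthant"
  unfolding mem_interior_nonneg_orthant
proof
  fix b :: 'a assume "b \<in> Basis"
  thus "0 < (One - h) \<bullet> b" using Basis_le_norm[of b h] assms by (simp add: inner_diff_left)
qed

text \<open>On the simplex \<open>One \<bullet> y\<close> is 1, so (One - h) \<bullet> y = 1 - h
  \<bullet> y and the first series is geometric. Both series are built from the same moments, which
  carries information from the resolvent to the exponential.\<close>

lemma unit_simplex_power_series:
  fixes M :: "'a::euclidean_space measure"
  assumes "finite_measure M" and sets: "sets M = sets borel" and K: "AE y in M. y \<in> unit_simplex"
  shows "norm h \<le> 1 / 2 \<Longrightarrow> (\<lambda>k. \<integral>y. (h \<bullet> y) ^ k \<partial>M) sums (\<integral>y. 1 / ((One - h) \<bullet> y) \<partial>M)"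
    and "(\<lambda>k. \<integral>y. (h \<bullet> y) ^ k / fact k \<partial>M) sums (\<integral>y. exp (h \<bullet> y) \<partial>M)"
proof -
  interpret finite_measure M by fact
  note [measurable_cong] = sets
  show "(\<lambda>k. \<integral>y. (h \<bullet> y) ^ k / fact k \<partial>M) sums (\<integral>y. exp (h \<bullet> y) \<partial>M)"
  proof (rule integral_sums[where B="exp (norm h)"])
    show "AE y in M. (\<lambda>k. (h \<bullet> y) ^ k / fact k) sums exp (h \<bullet> y)"
      using exp_converges[of "h \<bullet> _"] by (simp add: field_simps)
    show "AE y in M. \<bar>\<Sum>k<n. (h \<bullet> y) ^ k / fact k\<bar> \<le> exp (norm h)" for n using K
    proof eventually_elim
      case (elim y)
      have "\<bar>\<Sum>k<n. (h \<bullet> y) ^ k / fact k\<bar> \<le> (\<Sum>k<n. norm h ^ k / fact k)"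
        by (intro order_trans[OF sum_abs] sum_mono) (auto simp: power_abs abs_inner_unit_simplex[OF elim] intro!: divide_right_mono power_mono)
      also have "\<dots> \<le> exp (norm h)"
        using sum_le_suminf[of "\<lambda>k. norm h ^ k / fact k" "{..<n}"] summable_exp[of "norm h"]
        by (simp add: exp_def field_simps)
      finally show ?case .
    qed
  qed simp_all
  assume h: "norm h \<le> 1 / 2"
  show "(\<lambda>k. \<integral>y. (h \<bullet> y) ^ k \<partial>M) sums (\<integral>y. 1 / ((One - h) \<bullet> y) \<partial>M)"
  proof (rule integral_sums[where B="2"])
    show "AE y in M. (\<lambda>k. (h \<bullet> y) ^ k) sums (1 / ((One - h) \<bullet> y))" using K
    proof eventually_elim
      case (elim y)
      have "\<bar>h \<bullet> y\<bar> < 1" using abs_inner_unit_simplex[OF elim, of h] h by simp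
      thus ?case using geometric_sums[of "h \<bullet> y"] elim by (simp add: unit_simplex_def inner_diff_left)
    qed
    show "AE y in M. \<bar>\<Sum>k<n. (h \<bullet> y) ^ k\<bar> \<le> 2" for n using K
    proof eventually_elim
      case (elim y)
      have "\<bar>\<Sum>k<n. (h \<bullet> y) ^ k\<bar> \<le> (\<Sum>k<n. (1 / 2) ^ k)"
        using abs_inner_unit_simplex[OF elim, of h] h
        by (intro order_trans[OF sum_abs] sum_mono) (auto simp: power_abs intro!: power_mono)
      also have "\<dots> \<le> (\<Sum>k. (1 / 2) ^ k)" by (intro sum_le_suminf) (auto intro: summable_geometric)
      also have "\<dots> = 2" by (subst suminf_geometric) auto
      finally show ?case .
    qed
  qed simp_all
qed

text \<open>Replacing h by r h turns the hypothesis into a power series in r that vanishes near 0;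
  its coefficients are the differences of the moments of \<open>h \<bullet> y\<close>. Equal moments
  give equal exponential integrals.\<close>

lemma unit_simplex_measure_eqI:
  fixes M N :: "'a::euclidean_space measure"
  assumes "finite_measure M" "finite_measure N" and sets: "sets M = sets borel" "sets N = sets borel"
    and K: "AE y in M. y \<in> unit_simplex" "AE y in N. y \<in> unit_simplex"
    and eq: "\<And>c. c \<in> interior nonneg_orthant \<Longrightarrow> (\<integral>y. 1 / (c \<bullet> y) \<partial>M) = (\<integral>y. 1 / (c \<bullet> y) \<partial>N)"
  shows "M = N"
proof (rule finite_measure_eqI_exp[OF assms(1-4) compact_unit_simplex K])
  note M = unit_simplex_power_series[OF assms(1) sets(1) K(1)] and N = unit_simplex_power_series[OF assms(2) sets(2) K(2)]
  fix h :: 'a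
  define a where "a k = (\<integral>y. (h \<bullet> y) ^ k \<partial>M) - (\<integral>y. (h \<bullet> y) ^ k \<partial>N)" for k
  have "a k = 0" for k
  proof (rule power_series_zeroI)
    have pos: "norm h + 1 > 0" by (smt (verit) norm_ge_zero)
    \<comment> \<open>This radius keeps the norm of r h at most 1 / 2, the range of the geometric
      series.\<close>
    show "0 < 1 / (2 * (norm h + 1))" using pos by simp
    fix r :: real assume r: "0 \<le> r" "r < 1 / (2 * (norm h + 1))"
    have "r * norm h \<le> 1 / (2 * (norm h + 1)) * norm h" using r by (intro mult_right_mono) auto
    also have "\<dots> \<le> 1 / 2" using pos by (simp add: divide_le_eq)
    finally have rh: "norm (r *\<^sub>R h) \<le> 1 / 2" using r by simp
    have "(\<integral>y. 1 / ((One - r *\<^sub>R h) \<bullet> y) \<partial>M) = (\<integral>y. 1 / ((One - r *\<^sub>R h) \<bullet> y) \<partial>N)"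
      using rh by (intro eq One_minus_interior) auto
    with sums_diff[OF M(1)[OF rh] N(1)[OF rh]] show "(\<lambda>n. a n * r ^ n) sums 0"
      by (simp add: a_def power_mult_distrib algebra_simps)
  qed
  hence "(\<integral>y. (h \<bullet> y) ^ k / fact k \<partial>M) = (\<integral>y. (h \<bullet> y) ^ k / fact k \<partial>N)" for k
    by (simp add: a_def)
  thus "(\<integral>x. exp (h \<bullet> x) \<partial>M) = (\<integral>x. exp (h \<bullet> x) \<partial>N)"
    using M(2)[of h] N(2)[of h] sums_unique2 by simp
qed

section \<open>Projective passage from the orthant to the simplex\<close>

lemma One_prod: "(One :: 'a::euclidean_space \<times> real) = (One, 1)"
proof (rule euclidean_eqI)
  fix b :: "'a \<times> real" assume b: "b \<in> Basis"
  have "One \<bullet> b = 1" using b by simp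
  moreover have "(One, 1) \<bullet> b = 1" using b by (auto simp: Basis_prod_def inner_Pair)
  ultimately show "One \<bullet> b = (One, 1) \<bullet> b" by simp
qed

lemma mem_interior_prod:
  "(a :: 'a::euclidean_space, t :: real) \<in> interior nonneg_orthant \<longleftrightarrow> a \<in> interior nonneg_orthant \<and> t > 0"
  unfolding mem_interior_nonneg_orthant by (auto simp: Basis_prod_def inner_Pair)

lemma mem_nonneg_orthant_prod:
  "(a :: 'a::euclidean_space, t :: real) \<in> nonneg_orthant \<longleftrightarrow> a \<in> nonneg_orthant \<and> t \<ge> 0"
  unfolding nonneg_orthant_def by (auto simp: Basis_prod_def inner_Pair)

text \<open>The point where the ray through (x, 1) meets the simplex. The orthant becomes the part
  of the simplex with positive last coordinate.\<close>

definition to_simplex :: "'a::euclidean_space \<Rightarrow> 'a \<times> real" where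
  "to_simplex x = (1 / (1 + One \<bullet> x)) *\<^sub>R (x, 1)"

text \<open>The density compensates the factor 1 + One \<bullet> x that 1 / (a \<bullet> x + t)
  acquires when (x, 1) is rescaled, so the transforms of the two measures agree.\<close>

definition simplex_measure :: "'a::euclidean_space measure \<Rightarrow> ('a \<times> real) measure" where
  "simplex_measure \<nu> = distr (density \<nu> (\<lambda>x. ennreal (1 / (1 + One \<bullet> x)))) borel to_simplex"

lemma to_simplex_measurable [measurable]: "to_simplex \<in> borel_measurable borel"
  unfolding to_simplex_def[abs_def] by measurable

lemma to_simplex_mem: assumes "x \<in> nonneg_orthant" shows "to_simplex x \<in> unit_simplex"
proof -
  have p: "1 + One \<bullet> x > 0" using norm_le_One_inner[OF assms] norm_ge_zero[of x] by linarith
  have "x /\<^sub>R (1 + One \<bullet> x) \<in> nonneg_orthant" using assms p by (auto simp: nonneg_orthant_def)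
  thus ?thesis using p by (simp add: unit_simplex_def to_simplex_def One_prod mem_nonneg_orthant_prod inverse_eq_divide add_divide_distrib[symmetric] add.commute)
qed

text \<open>The last claim undoes the construction: y \<mapsto> fst y / snd y inverts
  \<open>to_simplex\<close>, and 1 / snd y cancels the density. Hence \<open>simplex_measure\<close>
  loses no information about \<nu>.\<close>

lemma
  fixes \<nu> :: "'a::euclidean_space measure"
  assumes "finite_measure \<nu>" and sets: "sets \<nu> = sets borel" and AE: "AE x in \<nu>. x \<in> nonneg_orthant"
  shows finite_simplex_measure: "finite_measure (simplex_measure \<nu>)"
    and AE_simplex_measure: "AE y in simplex_measure \<nu>. y \<in> unit_simplex"
    and integral_simplex_measure: "a \<in> interior nonneg_orthant \<Longrightarrow> t > 0 \<Longrightarrow>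
      (\<integral>y. 1 / ((a, t) \<bullet> y) \<partial>simplex_measure \<nu>) = (\<integral>x. 1 / (a \<bullet> x + t) \<partial>\<nu>)"
    and emeasure_simplex_measure: "A \<in> sets borel \<Longrightarrow>
      (\<integral>\<^sup>+y. ennreal (1 / snd y) * indicator A (fst y /\<^sub>R snd y) \<partial>simplex_measure \<nu>) = emeasure \<nu> A"
proof -
  interpret finite_measure \<nu> by fact
  note [measurable_cong] = sets
  have p: "1 + One \<bullet> x > 0" if "x \<in> nonneg_orthant" for x :: 'a
    using norm_le_One_inner[OF that] norm_ge_zero[of x] by linarith
  have le1: "1 / (1 + One \<bullet> x) \<le> 1" if "x \<in> nonneg_orthant" for x :: 'a
    using p[OF that] norm_le_One_inner[OF that] norm_ge_zero[of x] by (simp add: divide_le_eq del: norm_ge_zero)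
  have [measurable]: "(\<lambda>x::'a. ennreal (1 / (1 + One \<bullet> x))) \<in> borel_measurable borel" by measurable
  show "finite_measure (simplex_measure \<nu>)"
  proof
    have "(\<integral>\<^sup>+x. ennreal (1 / (1 + One \<bullet> x)) \<partial>\<nu>) \<le> (\<integral>\<^sup>+x. 1 \<partial>\<nu>)"
      using AE by (intro nn_integral_mono_AE) (auto elim!: eventually_mono dest!: le1)
    also have "\<dots> < \<infinity>" by (simp add: less_top[symmetric])
    finally show "emeasure (simplex_measure \<nu>) (space (simplex_measure \<nu>)) \<noteq> \<infinity>"
      unfolding simplex_measure_def by (subst emeasure_distr) (auto simp: emeasure_density cong: nn_integral_cong)
  qed
  have [measurable]: "(fst :: 'a \<times> real \<Rightarrow> 'a) \<in> borel_measurable borel" "(snd :: 'a \<times> real \<Rightarrow> real) \<in> borel_measurable borel"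
    by (auto intro!: borel_measurable_continuous_onI continuous_intros)
  have closed: "unit_simplex \<in> sets borel" by (rule borel_closed[OF compact_imp_closed[OF compact_unit_simplex]])
  show "AE y in simplex_measure \<nu>. y \<in> unit_simplex"
    unfolding simplex_measure_def using AE closed
    by (subst AE_distr_iff) (auto simp: AE_density to_simplex_mem elim!: eventually_mono)
  show "(\<integral>y. 1 / ((a, t) \<bullet> y) \<partial>simplex_measure \<nu>) = (\<integral>x. 1 / (a \<bullet> x + t) \<partial>\<nu>)"
    if a: "a \<in> interior nonneg_orthant" "t > 0"
  proof -
    have "(\<integral>y. 1 / ((a, t) \<bullet> y) \<partial>simplex_measure \<nu>) = (\<integral>x. 1 / ((a, t) \<bullet> to_simplex x) \<partial>density \<nu> (\<lambda>x. ennreal (1 / (1 + One \<bullet> x))))"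
      unfolding simplex_measure_def by (rule integral_distr) measurable
    also have "\<dots> = (\<integral>x. (1 / (1 + One \<bullet> x)) * (1 / ((a, t) \<bullet> to_simplex x)) \<partial>\<nu>)"
      by (subst integral_density) (use AE in \<open>auto elim!: eventually_mono simp: less_imp_le[OF p]\<close>)
    also have "\<dots> = (\<integral>x. 1 / (a \<bullet> x + t) \<partial>\<nu>)"
    proof (rule integral_cong_AE)
      show "AE x in \<nu>. (1 / (1 + One \<bullet> x)) * (1 / ((a, t) \<bullet> to_simplex x)) = 1 / (a \<bullet> x + t)" using AE
      proof eventually_elim
        case (elim x)
        have "a \<bullet> x + t > 0" using inner_nonneg_orthant[OF interior_nonneg_orthant_subset[OF a(1)] elim] a(2) by simp
        moreover have "(a, t) \<bullet> to_simplex x = (a \<bullet> x + t) / (1 + One \<bullet> x)"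
          by (simp add: to_simplex_def add_divide_distrib)
        ultimately show ?case using p[OF elim] by simp
      qed
    qed measurable
    finally show ?thesis .
  qed
  show "(\<integral>\<^sup>+y. ennreal (1 / snd y) * indicator A (fst y /\<^sub>R snd y) \<partial>simplex_measure \<nu>) = emeasure \<nu> A"
    if A [measurable]: "A \<in> sets borel"
  proof -
    have "(\<integral>\<^sup>+y. ennreal (1 / snd y) * indicator A (fst y /\<^sub>R snd y) \<partial>simplex_measure \<nu>)
      = (\<integral>\<^sup>+x. ennreal (1 / snd (to_simplex x)) * indicator A (fst (to_simplex x) /\<^sub>R snd (to_simplex x)) \<partial>density \<nu> (\<lambda>x. ennreal (1 / (1 + One \<bullet> x))))"
      unfolding simplex_measure_def by (rule nn_integral_distr) measurable
    also have "\<dots> = (\<integral>\<^sup>+x. ennreal (1 / (1 + One \<bullet> x)) * (ennreal (1 / snd (to_simplex x)) * indicator A (fst (to_simplex x) /\<^sub>R snd (to_simplex x))) \<partial>\<nu>)"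
      by (rule nn_integral_density) measurable
    also have "\<dots> = (\<integral>\<^sup>+x. indicator A x \<partial>\<nu>)"
    proof (rule nn_integral_cong_AE)
      show "AE x in \<nu>. ennreal (1 / (1 + One \<bullet> x)) * (ennreal (1 / snd (to_simplex x)) * indicator A (fst (to_simplex x) /\<^sub>R snd (to_simplex x))) = indicator A x"
        using AE
      proof eventually_elim
        case (elim x)
        have "ennreal (1 / (1 + One \<bullet> x)) * ennreal (1 + One \<bullet> x) = 1"
          using p[OF elim] by (subst ennreal_mult[symmetric]) auto
        thus ?case using p[OF elim] by (simp add: to_simplex_def mult.assoc[symmetric])
      qed
    qed
    finally show ?thesis using A sets by simp
  qed
qed

theorem orthant_measure_eqI:
  fixes \<mu> \<nu> :: "'a::euclidean_space measure"
  assumes mu: "finite_measure \<mu>" "sets \<mu> = sets borel" "AE x in \<mu>. x \<in> nonneg_orthant"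
    and nu: "finite_measure \<nu>" "sets \<nu> = sets borel" "AE x in \<nu>. x \<in> nonneg_orthant"
    and eq: "\<And>a t. a \<in> interior nonneg_orthant \<Longrightarrow> t > 0 \<Longrightarrow> (\<integral>x. 1 / (a \<bullet> x + t) \<partial>\<mu>) = (\<integral>x. 1 / (a \<bullet> x + t) \<partial>\<nu>)"
  shows "\<mu> = \<nu>"
proof -
  have "simplex_measure \<mu> = simplex_measure \<nu>"
  proof (rule unit_simplex_measure_eqI[OF finite_simplex_measure[OF mu] finite_simplex_measure[OF nu] _ _ AE_simplex_measure[OF mu] AE_simplex_measure[OF nu]])
    fix c :: "'a \<times> real" assume "c \<in> interior nonneg_orthant"
    then obtain a t where "c = (a, t)" "a \<in> interior nonneg_orthant" "t > 0" by (cases c) (auto simp: mem_interior_prod)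
    thus "(\<integral>y. 1 / (c \<bullet> y) \<partial>simplex_measure \<mu>) = (\<integral>y. 1 / (c \<bullet> y) \<partial>simplex_measure \<nu>)"
      using integral_simplex_measure[OF mu, of a t] integral_simplex_measure[OF nu, of a t] eq by metis
  qed (simp_all add: simplex_measure_def)
  thus ?thesis using emeasure_simplex_measure[OF mu] emeasure_simplex_measure[OF nu] mu(2) nu(2)
    by (intro measure_eqI) simp_all
qed

section \<open>Orthogonal polynomials of an indeterminate Stieltjes measure\<close>

lemma poly_expansion_exists:
  fixes P :: "nat \<Rightarrow> 'a::field poly"
  assumes "\<And>k. k < n \<Longrightarrow> degree (P k) = k" "\<And>k. k < n \<Longrightarrow> P k \<noteq> 0" "degree q < n"
  shows "\<exists>c. q = (\<Sum>k<n. smult (c k) (P k))"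
  using assms
proof (induction n arbitrary: q)
  case (Suc n)
  define r where "r = q - smult (coeff q n / coeff (P n) n) (P n)"
  have dn: "degree (P n) = n" using Suc.prems(1) by simp
  have nz: "coeff (P n) n \<noteq> 0" using dn Suc.prems(2)[of n] leading_coeff_neq_0[of "P n"] by simp
  have "degree r \<le> n" using Suc.prems(3) dn unfolding r_def
    by (intro degree_diff_le order_trans[OF degree_smult_le]) auto
  moreover have "coeff r n = 0" using nz by (simp add: r_def)
  ultimately have r: "r = 0 \<or> degree r < n"
    by (metis le_neq_implies_less leading_coeff_0_iff)
  have "\<exists>c. r = (\<Sum>k<n. smult (c k) (P k))"
  proof (cases "r = 0")
    case True thus ?thesis by (intro exI[of _ "\<lambda>_. 0"]) simp
  next
    case False thus ?thesis using r Suc.IH Suc.prems(1,2) by simp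
  qed
  then obtain c where c: "r = (\<Sum>k<n. smult (c k) (P k))" by blast
  show ?case
    by (intro exI[of _ "c(n := coeff q n / coeff (P n) n)"]) (use c in \<open>simp add: r_def algebra_simps\<close>)
qed simp

text \<open>The functional L stands for integration. An arbitrary field lets one algebraic theory
  serve both the real polynomials, where signs matter, and their complexifications, from which the
  entire functions arise.\<close>

locale orthonormal_sequence =
  fixes L :: "'a::field poly \<Rightarrow> 'a" and P :: "nat \<Rightarrow> 'a poly"
  assumes L_add: "L (p + q) = L p + L q"
    and L_smult: "L (smult c p) = c * L p"
    and degree_P: "degree (P k) = k"
    and orthonormal: "L (P j * P k) = (if j = k then 1 else 0)"
begin

text \<open>\<open>synthetic_div p z\<close> is the difference quotient of p between z and the
  variable, diagonal included, so this is the polynomial of the second kind.\<close>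

definition Q :: "nat \<Rightarrow> 'a \<Rightarrow> 'a" where "Q n z = L (synthetic_div (P n) z)"

lemma L_0: "L 0 = 0" using L_smult[of 0 0] by simp

lemma L_sum: "L (\<Sum>i\<in>I. f i) = (\<Sum>i\<in>I. L (f i))"
  by (induction I rule: infinite_finite_induct) (auto simp: L_0 L_add)

lemma L_diff: "L (p - q) = L p - L q"
  using L_add[of "p - q" q] by simp

lemma P_nonzero: "P k \<noteq> 0" using orthonormal[of k k] by (auto simp: L_0)

lemma expansion:
  assumes "degree q < n" shows "q = (\<Sum>k<n. smult (L (q * P k)) (P k))"
proof -
  obtain c where c: "q = (\<Sum>k<n. smult (c k) (P k))" using poly_expansion_exists[OF _ _ assms, of P] degree_P P_nonzero by blast
  have "L (q * P j) = c j" if "j < n" for j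
    using that by (subst c) (simp add: sum_distrib_right L_sum L_smult orthonormal if_distrib if_distribR sum.delta' cong: if_cong)
  thus ?thesis by (subst c) (auto intro!: sum.cong)
qed

lemma orthogonal_lower: assumes "degree q < n" shows "L (q * P n) = 0"
proof -
  obtain c where c: "q = (\<Sum>k<n. smult (c k) (P k))" using poly_expansion_exists[OF _ _ assms, of P] degree_P P_nonzero by blast
  show ?thesis by (subst c) (simp add: sum_distrib_right L_sum L_smult orthonormal)
qed

lemma L_times_P_leading:
  assumes "degree q \<le> n" shows "L (q * P n) = coeff q n / coeff (P n) n"
proof -
  define r where "r = q - smult (coeff q n / coeff (P n) n) (P n)"
  have nz: "coeff (P n) n \<noteq> 0" using degree_P[of n] P_nonzero[of n] leading_coeff_neq_0 by metis
  have "degree r \<le> n" using assms degree_P[of n] unfolding r_def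
    by (intro degree_diff_le order_trans[OF degree_smult_le]) auto
  moreover have "coeff r n = 0" using nz by (simp add: r_def)
  ultimately have "r = 0 \<or> degree r < n" by (metis le_neq_implies_less leading_coeff_0_iff)
  hence "L (r * P n) = 0" using orthogonal_lower L_0 by auto
  thus ?thesis by (simp add: r_def left_diff_distrib L_diff L_smult orthonormal)
qed

lemma synthetic_div_orthogonal:
  assumes "k \<le> n" shows "L (P n * synthetic_div (P k) c) = 0"
proof (cases "k = 0")
  case True
  thus ?thesis using degree_P[of 0] by (simp add: synthetic_div_eq_0_iff[THEN iffD2] L_0)
next
  case False
  hence "degree (synthetic_div (P k) c) < n" using assms by (simp add: degree_synthetic_div degree_P)
  thus ?thesis using orthogonal_lower[of "synthetic_div (P k) c" n] by (simp add: mult.commute)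
qed

lemma P_decompose: "P n = [:- c, 1:] * synthetic_div (P n) c + [:poly (P n) c:]"
  using synthetic_div_correct'[of c "P n"] by simp

text \<open>With d_k the difference quotient of P_k at c, the product (x - c) d_n d_k is rewritten
  by (x - c) d_n = P_n - P_n(c). The term P_n d_k vanishes under L, since d_k is 0 or has degree
  below n.\<close>

lemma L_synthetic_div_P:
  assumes "k \<le> n"
  shows "L (synthetic_div (P n) c * P k) = Q n c * poly (P k) c - poly (P n) c * Q k c"
proof -
  let ?d = "\<lambda>n. synthetic_div (P n) c"
  have 1: "P k = [:- c, 1:] * ?d k + [:poly (P k) c:]" "[:- c, 1:] * ?d n = P n - [:poly (P n) c:]"
    using P_decompose[of k c] P_decompose[of n c] by (simp_all add: algebra_simps)
  have "?d n * P k = ([:- c, 1:] * ?d n) * ?d k + smult (poly (P k) c) (?d n)"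
    by (subst 1(1)) (simp add: algebra_simps)
  also have "\<dots> = P n * ?d k - smult (poly (P n) c) (?d k) + smult (poly (P k) c) (?d n)"
    by (subst 1(2)) (simp add: algebra_simps)
  finally have "?d n * P k = P n * ?d k - smult (poly (P n) c) (?d k) + smult (poly (P k) c) (?d n)" .
  thus ?thesis by (simp add: L_add L_diff L_smult synthetic_div_orthogonal[OF assms] Q_def mult.commute)
qed

lemma Q_0: "Q 0 z = 0"
  unfolding Q_def using degree_P[of 0] by (simp add: synthetic_div_eq_0_iff[THEN iffD2] L_0)

lemma synthetic_div_expansion:
  assumes "n > 0"
  shows "synthetic_div (P n) c = (\<Sum>k<n. smult (Q n c * poly (P k) c - poly (P n) c * Q k c) (P k))"
proof -
  have "degree (synthetic_div (P n) c) < n" using assms by (simp add: degree_synthetic_div degree_P)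
  from expansion[OF this] show ?thesis
    by (simp add: L_synthetic_div_P cong: sum.cong_simp)
qed

text \<open>A Christoffel-Darboux type identity that moves the base point from c to z: the
  difference quotient of P_n at c is expanded in P_0, ..., P_(n-1) and evaluated at z.\<close>

lemma P_shift:
  "poly (P n) z = poly (P n) c
    + (z - c) * (\<Sum>k<n. (Q n c * poly (P k) c - poly (P n) c * Q k c) * poly (P k) z)"
proof (cases "n = 0")
  case True
  thus ?thesis using degree_P[of 0] by (auto elim: degree_eq_zeroE)
next
  case False
  have "poly (P n) z = (z - c) * poly (synthetic_div (P n) c) z + poly (P n) c"
    by (subst P_decompose[of n c]) (simp add: algebra_simps)
  thus ?thesis using False by (simp add: synthetic_div_expansion poly_sum)
qed

lemma synthetic_div_shift:
  "synthetic_div ([:- c, 1:] * q) (z :: 'a) = q + smult (z - c) (synthetic_div q z)"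
proof -
  have "[:- c, 1:] * q + smult z (q + smult (z - c) (synthetic_div q z))
      = pCons 0 q + smult (z - c) (q + smult z (synthetic_div q z))"
    by (simp add: smult_add_right smult_diff_left smult_diff_right algebra_simps)
  also have "\<dots> = pCons ((z - c) * poly q z) (q + smult (z - c) (synthetic_div q z))"
    by (simp add: synthetic_div_correct)
  finally show ?thesis using synthetic_div_unique by metis
qed

lemma synthetic_div_add: "synthetic_div (p + q) (z :: 'a) = synthetic_div p z + synthetic_div q z"
proof -
  have "p + q + smult z (synthetic_div p z + synthetic_div q z)
      = (p + smult z (synthetic_div p z)) + (q + smult z (synthetic_div q z))"
    by (simp add: smult_add_right algebra_simps)
  also have "\<dots> = pCons (poly p z + poly q z) (synthetic_div p z + synthetic_div q z)"
    by (simp add: synthetic_div_correct)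
  finally show ?thesis using synthetic_div_unique by metis
qed

lemma synthetic_div_smult: "synthetic_div (smult a p) (z :: 'a) = smult a (synthetic_div p z)"
proof -
  have "smult a p + smult z (smult a (synthetic_div p z)) = smult a (p + smult z (synthetic_div p z))"
    by (simp add: smult_add_right mult.commute)
  also have "\<dots> = pCons (a * poly p z) (smult a (synthetic_div p z))"
    by (simp add: synthetic_div_correct)
  finally show ?thesis using synthetic_div_unique by metis
qed

lemma synthetic_div_sum:
  "synthetic_div (\<Sum>i\<in>I. f i) (z :: 'a) = (\<Sum>i\<in>I. synthetic_div (f i) z)"
  by (induction I rule: infinite_finite_induct) (auto simp: synthetic_div_add)

text \<open>The same expansion as for P_n; its difference quotient at z is taken termwise before L
  is applied, which turns P_k(z) into Q_k(z).\<close>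

lemma Q_shift:
  "Q n z = Q n c + (z - c) * (\<Sum>k<n. (Q n c * poly (P k) c - poly (P n) c * Q k c) * Q k z)"
proof (cases "n = 0")
  case True thus ?thesis by (simp add: Q_0)
next
  case False
  let ?d = "synthetic_div (P n) c" and ?c = "\<lambda>k. Q n c * poly (P k) c - poly (P n) c * Q k c"
  have "synthetic_div (P n) z = ?d + smult (z - c) (synthetic_div ?d z)"
    by (subst P_decompose[of n c]) (simp only: synthetic_div_add synthetic_div_shift, simp add: synthetic_div_eq_0_iff[THEN iffD2])
  hence "Q n z = Q n c + (z - c) * L (synthetic_div ?d z)"
    by (simp add: Q_def L_add L_smult)
  also have "L (synthetic_div ?d z) = (\<Sum>k<n. ?c k * Q k z)"
    using False by (subst synthetic_div_expansion) (simp_all add: synthetic_div_sum synthetic_div_smult L_sum L_smult Q_def)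
  finally show ?thesis .
qed

text \<open>The truncated Nevanlinna matrix with base point c, which is (0, -1, 1, 0) for n = 0. Its
  limits at c = 0 are A, B, C, D; a general base point is kept because square summability is first
  known at a negative point.\<close>

definition tA :: "'a \<Rightarrow> 'a \<Rightarrow> nat \<Rightarrow> 'a" where "tA c z n = (z - c) * (\<Sum>k<n. Q k c * Q k z)"
definition tB :: "'a \<Rightarrow> 'a \<Rightarrow> nat \<Rightarrow> 'a" where "tB c z n = - 1 + (z - c) * (\<Sum>k<n. Q k c * poly (P k) z)"
definition tC :: "'a \<Rightarrow> 'a \<Rightarrow> nat \<Rightarrow> 'a" where "tC c z n = 1 + (z - c) * (\<Sum>k<n. poly (P k) c * Q k z)"
definition tD :: "'a \<Rightarrow> 'a \<Rightarrow> nat \<Rightarrow> 'a" where "tD c z n = (z - c) * (\<Sum>k<n. poly (P k) c * poly (P k) z)"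

lemma P_transfer: "poly (P n) z = Q n c * tD c z n - poly (P n) c * tB c z n"
  by (subst P_shift[of n z c])
    (simp add: tD_def tB_def sum_distrib_left algebra_simps sum.distrib sum_subtractf)

lemma Q_transfer: "Q n z = Q n c * tC c z n - poly (P n) c * tA c z n"
  by (subst Q_shift[of n z c])
    (simp add: tC_def tA_def sum_distrib_left algebra_simps sum.distrib sum_subtractf)

text \<open>From n to n + 1 the determinant changes by z - c times an expression which the two
  transfer identities turn into Q_n(z) P_n(z) - P_n(z) Q_n(z).\<close>

lemma transfer_det: "tA c z n * tD c z n - tB c z n * tC c z n = 1"
proof (induction n)
  case (Suc n)
  have e: "tA c z (Suc n) = tA c z n + (z - c) * Q n c * Q n z"
    "tB c z (Suc n) = tB c z n + (z - c) * Q n c * poly (P n) z"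
    "tC c z (Suc n) = tC c z n + (z - c) * poly (P n) c * Q n z"
    "tD c z (Suc n) = tD c z n + (z - c) * poly (P n) c * poly (P n) z"
    by (simp_all add: tA_def tB_def tC_def tD_def algebra_simps)
  have "tA c z (Suc n) * tD c z (Suc n) - tB c z (Suc n) * tC c z (Suc n)
    = (tA c z n * tD c z n - tB c z n * tC c z n)
      + (z - c) * (Q n z * (Q n c * tD c z n - poly (P n) c * tB c z n)
         - poly (P n) z * (Q n c * tC c z n - poly (P n) c * tA c z n))"
    unfolding e by (simp add: algebra_simps)
  also have "\<dots> = 1" unfolding Suc P_transfer[of n z c, symmetric] Q_transfer[of n z c, symmetric] by simp
  finally show ?case .
qed (simp add: tA_def tB_def tC_def tD_def)

text \<open>The Liouville-Ostrogradsky formula. The left side is the top Fourier coefficient of the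
  difference quotient of P_(n+1), hence a quotient of leading coefficients. Its positivity later
  makes \<open>ratio\<close> monotone.\<close>

lemma Wronskian:
  "Q (Suc n) c * poly (P n) c - poly (P (Suc n)) c * Q n c = coeff (P (Suc n)) (Suc n) / coeff (P n) n"
proof -
  let ?d = "synthetic_div (P (Suc n)) c"
  have deg: "degree ?d \<le> n" by (simp add: degree_synthetic_div degree_P)
  have "coeff (P (Suc n)) (Suc n) = coeff ([:- c, 1:] * ?d + [:poly (P (Suc n)) c:]) (Suc n)"
    using P_decompose by metis
  also have "\<dots> = coeff ?d n" using coeff_eq_0[of ?d "Suc n"] deg by simp
  finally show ?thesis using L_times_P_leading[OF deg] L_synthetic_div_P[of n "Suc n" c] by simp
qed

text \<open>The reproducing (Christoffel-Darboux) kernel at c for polynomials of degree below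
  n.\<close>

definition kernel :: "'a \<Rightarrow> nat \<Rightarrow> 'a poly" where "kernel c n = (\<Sum>k<n. smult (poly (P k) c) (P k))"

lemma kernel_reproducing: "degree q < n \<Longrightarrow> L (q * kernel c n) = poly q c"
  unfolding kernel_def
  by (subst (2) expansion, assumption)
    (simp add: sum_distrib_left L_sum L_smult poly_sum mult.commute)

lemma degree_kernel: "n > 0 \<Longrightarrow> degree (kernel c n) < n"
  unfolding kernel_def
  using degree_sum_le[of "{..<n}" "\<lambda>k. smult (poly (P k) c) (P k)" "n - 1"]
  by (fastforce simp: degree_P intro: order_trans[OF degree_smult_le])

end

section \<open>Measures on the half-line and their real resolvents\<close>

lemma poly_map_of_real: "poly (map_poly of_real p) (of_real x :: complex) = of_real (poly p x)"
  by (induction p) (auto simp: map_poly_pCons)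

lemma synthetic_div_map_of_real:
  "synthetic_div (map_poly of_real p) (of_real x :: complex) = map_poly of_real (synthetic_div p x)"
  by (induction p) (auto simp: map_poly_pCons poly_map_of_real)

lemma monomial_real: "monomial \<alpha> (x :: real) = x ^ \<alpha> 1"
  by (simp add: monomial_def)

lemma moment_measures_real_iff:
  "\<sigma> \<in> moment_measures {0::real..} \<longleftrightarrow>
    sets \<sigma> = sets borel \<and> (AE x in \<sigma>. 0 \<le> x) \<and> (\<forall>n. integrable \<sigma> (\<lambda>x. x ^ n))"
proof -
  have "(AE x in \<sigma>. 0 \<le> x) \<longleftrightarrow> emeasure \<sigma> (- {0..}) = 0" if "sets \<sigma> = sets borel"
  proof -
    have "space \<sigma> = UNIV" using sets_eq_imp_space_eq[OF that] by simp
    moreover have "- {0::real..} = {x. \<not> 0 \<le> x}" by auto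
    ultimately show ?thesis using that by (subst AE_iff_measurable[of "- {0..}"]) auto
  qed
  moreover have "(\<forall>\<alpha>. integrable \<sigma> (monomial \<alpha>)) \<longleftrightarrow> (\<forall>n. integrable \<sigma> (\<lambda>x. x ^ n))"
    unfolding monomial_real[abs_def] by (auto dest: spec[of _ "\<lambda>_. _"])
  ultimately show ?thesis unfolding moment_measures_def by blast
qed

lemma moment_solutions_real_iff:
  "\<tau> \<in> moment_solutions \<sigma> {0::real..} \<longleftrightarrow>
    \<tau> \<in> moment_measures {0..} \<and> (\<forall>n. (\<integral>x. x ^ n \<partial>\<tau>) = (\<integral>x. x ^ n \<partial>\<sigma>))"
  unfolding moment_solutions_def monomial_real[abs_def] by (auto dest: spec[of _ "\<lambda>_. _"])

lemma borel_measurable_poly [measurable]: "(\<lambda>x::real. poly p x) \<in> borel_measurable borel"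
  by (intro borel_measurable_continuous_onI continuous_intros)

text \<open>As a functional on polynomials, \<open>mean\<close> turns equality of all moments into
  the single equation \<open>mean \<tau> = mean \<sigma>\<close>.\<close>

definition mean :: "real measure \<Rightarrow> real poly \<Rightarrow> real" where
  "mean \<sigma> p = (\<integral>x. poly p x \<partial>\<sigma>)"

definition cmean :: "real measure \<Rightarrow> complex poly \<Rightarrow> complex" where
  "cmean \<sigma> p = (\<integral>x. poly p (complex_of_real x) \<partial>\<sigma>)"

locale stieltjes_measure =
  fixes \<sigma> :: "real measure"
  assumes mm: "\<sigma> \<in> moment_measures {0..}"
begin

lemma sets_eq [measurable_cong]: "sets \<sigma> = sets borel" and AE_nonneg: "AE x in \<sigma>. 0 \<le> x"
  and integrable_power: "integrable \<sigma> (\<lambda>x. x ^ n)"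
  using mm unfolding moment_measures_real_iff by auto

lemma measurable_eq: "borel_measurable \<sigma> = borel_measurable borel"
  by (intro measurable_cong_sets sets_eq refl)

sublocale finite_measure \<sigma>
proof
  show "emeasure \<sigma> (space \<sigma>) \<noteq> \<infinity>" using integrable_power[of 0] by (simp add: integrable_iff_bounded)
qed

lemma integrable_poly: "integrable \<sigma> (\<lambda>x. poly p x)"
  unfolding poly_altdef by (intro Bochner_Integration.integrable_sum integrable_mult_right integrable_power)

lemma integrable_cpoly: "integrable \<sigma> (\<lambda>x. poly p (complex_of_real x))"
proof -
  have "integrable \<sigma> (\<lambda>x. coeff p i * complex_of_real (x ^ i))" for i
    by (intro integrable_mult_right integrable_of_real integrable_power)
  thus ?thesis unfolding poly_altdef by simp
qed

lemma cmean_of_real: "cmean \<sigma> (map_poly of_real p) = of_real (mean \<sigma> p)"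
  unfolding cmean_def mean_def by (simp add: poly_map_of_real)

lemma mean_add: "mean \<sigma> (p + q) = mean \<sigma> p + mean \<sigma> q"
  and mean_smult: "mean \<sigma> (smult c p) = c * mean \<sigma> p"
  by (simp_all add: mean_def integrable_poly)

lemma mean_diff: "mean \<sigma> (p - q) = mean \<sigma> p - mean \<sigma> q"
  by (simp add: mean_def integrable_poly)

lemma mean_sum: "mean \<sigma> (\<Sum>i\<in>I. f i) = (\<Sum>i\<in>I. mean \<sigma> (f i))"
  by (simp add: mean_def integrable_poly poly_sum)

lemma cmean_add: "cmean \<sigma> (p + q) = cmean \<sigma> p + cmean \<sigma> q"
  and cmean_smult: "cmean \<sigma> (smult d p) = d * cmean \<sigma> p"
  by (simp_all add: cmean_def integrable_cpoly)

lemma mean_unique: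
  assumes "\<tau> \<in> moment_solutions \<sigma> {0..}" shows "mean \<tau> = mean \<sigma>"
proof
  interpret t: stieltjes_measure \<tau> using assms by unfold_locales (simp add: moment_solutions_real_iff)
  show "mean \<tau> p = mean \<sigma> p" for p
    using assms unfolding mean_def poly_altdef moment_solutions_real_iff
    by (simp add: integrable_power t.integrable_power)
qed

lemma cmean_unique:
  assumes "\<tau> \<in> moment_solutions \<sigma> {0..}" shows "cmean \<tau> = cmean \<sigma>"
proof
  interpret t: stieltjes_measure \<tau> using assms by unfold_locales (simp add: moment_solutions_real_iff)
  have c: "(\<integral>x. complex_of_real x ^ n \<partial>\<tau>) = (\<integral>x. complex_of_real x ^ n \<partial>\<sigma>)" for n
    using assms unfolding moment_solutions_real_iff of_real_power[symmetric] integral_complex_of_real by metis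
  have "integrable \<tau> (\<lambda>x. complex_of_real x ^ n)" "integrable \<sigma> (\<lambda>x. complex_of_real x ^ n)" for n
    unfolding of_real_power[symmetric] by (intro integrable_of_real integrable_power t.integrable_power)+
  thus "cmean \<tau> p = cmean \<sigma> p" for p
    unfolding cmean_def poly_altdef by (simp add: c)
qed

lemma integrable_poly_resolvent: 
  assumes "x < 0" shows "integrable \<sigma> (\<lambda>t. poly p t / (t - x))"
proof (rule Bochner_Integration.integrable_bound[OF integrable_mult_left[OF integrable_poly[of p], of "1/(-x)"]])
  show "(\<lambda>t. poly p t / (t - x)) \<in> borel_measurable \<sigma>"
    unfolding measurable_eq by measurable
  show "AE t in \<sigma>. norm (poly p t / (t - x)) \<le> norm (poly p t * (1 / - x))"
    using AE_nonneg
  proof eventually_elim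
    case (elim t)
    have "1 / (t - x) \<le> 1 / (- x)" using elim assms by (intro divide_left_mono mult_pos_pos) auto
    from mult_left_mono[OF this, of "\<bar>poly p t\<bar>"] show ?case using elim assms
      by (simp add: abs_mult)
  qed
qed

definition res :: "real \<Rightarrow> real" where "res x = (\<integral>t. 1 / (t - x) \<partial>\<sigma>)"

text \<open>Division with remainder, p(t) = (t - x) d(t) + p(x). The mean of d depends on the
  moments only, so solutions differ just in the term with \<open>res x\<close>.\<close>

lemma resolvent_split:
  assumes "x < 0"
  shows "(\<integral>t. poly p t / (t - x) \<partial>\<sigma>) = mean \<sigma> (synthetic_div p x) + poly p x * res x"
proof -
  have "(\<integral>t. poly p t / (t - x) \<partial>\<sigma>) = (\<integral>t. poly (synthetic_div p x) t + poly p x * (1 / (t - x)) \<partial>\<sigma>)"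
  proof (rule integral_cong_AE)
    show "AE t in \<sigma>. poly p t / (t - x) = poly (synthetic_div p x) t + poly p x * (1 / (t - x))"
      using AE_nonneg
    proof eventually_elim
      case (elim t)
      have "poly p t = (t - x) * poly (synthetic_div p x) t + poly p x"
        by (subst synthetic_div_correct'[of x p, symmetric]) (simp add: algebra_simps)
      thus ?case using elim assms by (simp add: field_simps)
    qed
  qed (unfold measurable_eq, measurable)
  also have "\<dots> = mean \<sigma> (synthetic_div p x) + poly p x * res x"
    using integrable_poly_resolvent[OF assms, of 1]
    by (subst Bochner_Integration.integral_add) (auto simp: mean_def res_def integrable_poly intro!: integrable_mult_right simp del: times_divide_eq_right)
  finally show ?thesis .
qed

end

lemma moment_solutions_stieltjes: "\<tau> \<in> moment_solutions \<sigma> {0::real..} \<Longrightarrow> stieltjes_measure \<tau>"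
  by (simp add: stieltjes_measure_def moment_solutions_real_iff)

text \<open>The one-dimensional case of \<open>orthant_measure_eqI\<close>; scaling reduces 1 / (a x
  + t) to the resolvent at - t / a.\<close>

lemma stieltjes_measure_eqI:
  assumes "stieltjes_measure \<sigma>" "stieltjes_measure \<tau>"
    and "\<And>x. x < 0 \<Longrightarrow> stieltjes_measure.res \<sigma> x = stieltjes_measure.res \<tau> x"
  shows "\<sigma> = \<tau>"
proof -
  interpret s: stieltjes_measure \<sigma> by fact
  interpret t: stieltjes_measure \<tau> by fact
  have scale: "(\<integral>x. 1 / (a \<bullet> x + t) \<partial>\<theta>) = 1 / a * stieltjes_measure.res \<theta> (- (t / a))"
    if \<theta>: "stieltjes_measure \<theta>" and a: "a > 0" for \<theta> and a t :: real
  proof -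
    have "1 / (a \<bullet> x + t) = 1 / a * (1 / (x - - (t / a)))" for x
      using a by (simp add: distrib_left)
    thus ?thesis unfolding stieltjes_measure.res_def[OF \<theta>] by (simp only: integral_mult_right_zero)
  qed
  show ?thesis
  proof (rule orthant_measure_eqI)
    fix a t :: real assume "a \<in> interior nonneg_orthant" "t > 0"
    hence "a > 0" "- (t / a) < 0" by (auto simp: mem_interior_nonneg_orthant)
    thus "(\<integral>x. 1 / (a \<bullet> x + t) \<partial>\<sigma>) = (\<integral>x. 1 / (a \<bullet> x + t) \<partial>\<tau>)"
      using scale[OF assms(1)] scale[OF assms(2)] assms(3) by metis
  qed (use s.finite_measure_axioms t.finite_measure_axioms s.sets_eq t.sets_eq s.AE_nonneg t.AE_nonneg in \<open>simp_all add: nonneg_orthant_real\<close>)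
qed

section \<open>Consequences of indeterminacy; existence of the orthonormal polynomials\<close>

locale indeterminate_measure = stieltjes_measure +
  assumes indet: "\<not> determinate \<sigma> {0..}"
begin

lemma self_solution: "\<sigma> \<in> moment_solutions \<sigma> {0..}"
  using mm by (simp add: moment_solutions_real_iff)

lemma other_solution:
  obtains \<tau> x where "\<tau> \<in> moment_solutions \<sigma> {0..}" "x < 0" "stieltjes_measure.res \<tau> x \<noteq> res x"
proof -
  have "moment_solutions \<sigma> {0..} \<noteq> {\<sigma>}" using indet by (simp add: determinate_def)
  then obtain \<tau> where t: "\<tau> \<in> moment_solutions \<sigma> {0..}" "\<tau> \<noteq> \<sigma>" using self_solution by blast
  thus ?thesis using stieltjes_measure_eqI[OF moment_solutions_stieltjes[OF t(1)] stieltjes_measure_axioms] that by blast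
qed

lemma mean_square_nonneg: "0 \<le> mean \<sigma> (p * p)"
  unfolding mean_def by (intro integral_nonneg_AE) (auto simp: poly_mult)

text \<open>If the square of p has mean 0, every solution is concentrated on zeros of p, and hence
  on zeros of q, where p = (t - x)^m q and x < 0. The integral of q(t) / (t - x) is then 0 for
  \<sigma> and \<tau> alike, which fixes the resolvent at x because q(x) is not 0. This contradicts
  \<open>other_solution\<close>.\<close>

lemma mean_pos_def:
  assumes 0: "mean \<sigma> (p * p) = 0" shows "p = 0"
proof (rule ccontr)
  assume "p \<noteq> 0"
  obtain \<tau> x where tx: "\<tau> \<in> moment_solutions \<sigma> {0..}" "x < 0" "stieltjes_measure.res \<tau> x \<noteq> res x"
    using other_solution .
  interpret t: stieltjes_measure \<tau> by (rule moment_solutions_stieltjes[OF tx(1)])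
  obtain m q where q: "p = [:- x, 1:] ^ m * q" "\<not> [:- x, 1:] dvd q"
    using order_decomp[OF \<open>p \<noteq> 0\<close>] by blast
  have pt: "poly p t = (t - x) ^ m * poly q t" for t unfolding q(1) by (simp add: poly_power)
  have qx: "poly q x \<noteq> 0" using q(2) by (simp add: poly_eq_0_iff_dvd)
  have key: "mean \<theta> (synthetic_div q x) + poly q x * stieltjes_measure.res \<theta> x = 0"
    if \<theta>: "stieltjes_measure \<theta>" "mean \<theta> = mean \<sigma>" for \<theta>
  proof -
    interpret th: stieltjes_measure \<theta> by (rule \<theta>(1))
    have "(\<integral>t. poly p t * poly p t \<partial>\<theta>) = 0" using 0 unfolding \<theta>(2)[symmetric] mean_def poly_mult .
    hence "AE t in \<theta>. poly p t * poly p t = 0"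
      using th.integrable_poly[of "p * p"] by (subst (asm) integral_nonneg_eq_0_iff_AE) auto
    hence "AE t in \<theta>. poly q t = 0" using th.AE_nonneg
    proof eventually_elim
      case (elim t)
      thus ?case using \<open>x < 0\<close> by (simp add: pt)
    qed
    hence "AE t in \<theta>. poly q t / (t - x) = 0" by eventually_elim simp
    hence "(\<integral>t. poly q t / (t - x) \<partial>\<theta>) = 0" by (rule integral_eq_zero_AE)
    thus ?thesis by (simp add: th.resolvent_split[OF \<open>x < 0\<close>])
  qed
  have "poly q x * t.res x = poly q x * res x"
    using key[OF stieltjes_measure_axioms refl]
      key[OF t.stieltjes_measure_axioms mean_unique[OF tx(1)], unfolded mean_unique[OF tx(1)]] by linarith
  thus False using qx tx(3) by simp
qed

lemma mean_1_pos: "mean \<sigma> 1 > 0"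
  using mean_square_nonneg[of 1] mean_pos_def[of 1] by force

lemma orthonormal_poly_exists:
  "\<exists>p. degree p = n \<and> 0 < lead_coeff p \<and> mean \<sigma> (p * p) = 1 \<and> (\<forall>q. degree q < n \<longrightarrow> mean \<sigma> (q * p) = 0)"
proof (induction n rule: less_induct)
  case (less n)
  then obtain f where f: "\<And>k. k < n \<Longrightarrow> degree (f k) = k \<and> 0 < lead_coeff (f k) \<and> mean \<sigma> (f k * f k) = 1 \<and>
     (\<forall>q. degree q < k \<longrightarrow> mean \<sigma> (q * f k) = 0)" by metis
  have orth: "mean \<sigma> (f j * f k) = (if j = k then 1 else 0)" if "j < n" "k < n" for j k
    using f[OF that(1)] f[OF that(2)] by (cases j k rule: linorder_cases) (metis mult.commute less_irrefl)+
  define p where "p = monom 1 n - (\<Sum>k<n. smult (mean \<sigma> (monom 1 n * f k)) (f k))"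
  have degs: "n > 0 \<Longrightarrow> degree (\<Sum>k<n. smult (mean \<sigma> (monom 1 n * f k)) (f k)) < n"
  proof -
    assume n: "n > 0"
    have "degree (\<Sum>k<n. smult (mean \<sigma> (monom 1 n * f k)) (f k)) \<le> n - 1"
      using f by (intro degree_sum_le) (auto intro!: order_trans[OF degree_smult_le])
    thus ?thesis using n by simp
  qed
  have coeff_p: "coeff p n = 1"
    using degs coeff_eq_0 by (cases "n = 0") (auto simp: p_def)
  have "degree p \<le> n"
    unfolding p_def using degs by (cases "n = 0") (auto intro!: degree_diff_le simp: degree_monom_le)
  hence deg_p: "degree p = n" using coeff_p by (metis le_antisym le_degree zero_neq_one)
  have "mean \<sigma> (p * f j) = 0" if "j < n" for j
    using that unfolding p_def
    by (simp add: left_diff_distrib mean_diff sum_distrib_right mean_sum mean_smult orth if_distrib cong: if_cong)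
  hence orth_p: "mean \<sigma> (q * p) = 0" if q: "degree q < n" for q
  proof -
    obtain c where c: "q = (\<Sum>k<n. smult (c k) (f k))"
      using poly_expansion_exists[OF _ _ q, of f] f by force
    have "mean \<sigma> (p * q) = 0" using \<open>\<And>j. j < n \<Longrightarrow> mean \<sigma> (p * f j) = 0\<close>
      by (subst c) (simp add: sum_distrib_left mean_sum mean_smult)
    thus ?thesis by (simp only: mult.commute)
  qed
  have pos: "mean \<sigma> (p * p) > 0" using mean_square_nonneg[of p] mean_pos_def[of p] coeff_p by fastforce
  define r where "r = smult (1 / sqrt (mean \<sigma> (p * p))) p"
  have "degree r = n" "0 < lead_coeff r" using pos deg_p coeff_p by (auto simp: r_def)
  moreover have "mean \<sigma> (r * r) = 1" using pos by (simp add: r_def mean_smult)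
  moreover have "\<forall>q. degree q < n \<longrightarrow> mean \<sigma> (q * r) = 0" using orth_p by (simp add: r_def mean_smult)
  ultimately show ?case by blast
qed

text \<open>Gives the definite description of the polynomials its value. The difference of p_n and
  the multiple of p'_n with the same leading coefficient is 0 or of lower degree, so it is
  orthogonal to both and hence to itself; positive leading coefficients fix the sign.\<close>

lemma orthonormal_polys_unique:
  "\<exists>!p. (\<forall>k. degree (p k) = k \<and> 0 < lead_coeff (p k)) \<and>
     (\<forall>j k. (\<integral>x. poly (p j) x * poly (p k) x \<partial>\<sigma>) = (if j = k then 1 else 0))"
proof (rule ex_ex1I)
  obtain f where f: "\<And>k. degree (f k) = k \<and> 0 < lead_coeff (f k) \<and> mean \<sigma> (f k * f k) = 1 \<and>
     (\<forall>q. degree q < k \<longrightarrow> mean \<sigma> (q * f k) = 0)" using orthonormal_poly_exists by metis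
  have orth: "mean \<sigma> (f j * f k) = (if j = k then 1 else 0)" for j k
    using f[of j] f[of k] by (cases j k rule: linorder_cases) (metis mult.commute less_irrefl)+
  show "\<exists>p. (\<forall>k. degree (p k) = k \<and> 0 < lead_coeff (p k)) \<and>
     (\<forall>j k. (\<integral>x. poly (p j) x * poly (p k) x \<partial>\<sigma>) = (if j = k then 1 else 0))"
    using f orth unfolding mean_def poly_mult by (intro exI[of _ f]) blast
next
  fix p p'
  assume p: "(\<forall>k. degree (p k) = k \<and> 0 < lead_coeff (p k)) \<and>
     (\<forall>j k. (\<integral>x. poly (p j) x * poly (p k) x \<partial>\<sigma>) = (if j = k then 1 else 0))"
   and p': "(\<forall>k. degree (p' k) = k \<and> 0 < lead_coeff (p' k)) \<and>
     (\<forall>j k. (\<integral>x. poly (p' j) x * poly (p' k) x \<partial>\<sigma>) = (if j = k then 1 else 0))"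
  interpret o: orthonormal_sequence "mean \<sigma>" p
    by (unfold_locales, rule mean_add, rule mean_smult, use p in blast, unfold mean_def poly_mult, use p in blast)
  interpret o': orthonormal_sequence "mean \<sigma>" p'
    by (unfold_locales, rule mean_add, rule mean_smult, use p' in blast, unfold mean_def poly_mult, use p' in blast)
  show "p = p'"
  proof
    fix n
    have dp: "degree (p n) = n" "degree (p' n) = n" and lp: "0 < coeff (p n) n" "0 < coeff (p' n) n"
      using p p' by metis+
    define c where "c = coeff (p n) n / coeff (p' n) n"
    have c: "c > 0" using lp by (simp add: c_def)
    define d where "d = p n - smult c (p' n)"
    have "coeff d n = 0" using lp by (simp add: d_def c_def)
    moreover have "degree d \<le> n" unfolding d_def using dp
      by (intro degree_diff_le order_trans[OF degree_smult_le]) auto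
    ultimately have d: "d = 0 \<or> degree d < n" by (metis le_neq_implies_less leading_coeff_0_iff)
    have "mean \<sigma> (d * p n) = 0"
      using d o.orthogonal_lower[of d n] o.L_0 by auto
    moreover have "mean \<sigma> (d * p' n) = 0"
      using d o'.orthogonal_lower[of d n] o'.L_0 by auto
    ultimately have "mean \<sigma> (d * (p n - smult c (p' n))) = 0"
      by (simp add: right_diff_distrib mean_diff mean_smult)
    hence "mean \<sigma> (d * d) = 0" by (simp only: d_def)
    hence "p n = smult c (p' n)" using mean_pos_def[of d] by (simp add: d_def)
    moreover from this have "c * c = 1" using o.orthonormal[of n n] o'.orthonormal[of n n] by (simp add: mean_smult)
    ultimately show "p n = p' n" using c by (simp add: square_eq_1_iff)
  qed
qed

definition p :: "nat \<Rightarrow> real poly" where "p = orthonormal_polys \<sigma>"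

lemma degree_p: "degree (p k) = k" and lead_coeff_p: "0 < lead_coeff (p k)"
  and orthonormal_p: "mean \<sigma> (p j * p k) = (if j = k then 1 else 0)"
  unfolding mean_def poly_mult
  using theI'[OF orthonormal_polys_unique, folded orthonormal_polys_def p_def] by blast+

sublocale R: orthonormal_sequence "mean \<sigma>" p
  by unfold_locales (auto simp: mean_add mean_smult degree_p orthonormal_p)

sublocale C: orthonormal_sequence "cmean \<sigma>" "orthoP_poly \<sigma>"
proof
  show "degree (orthoP_poly \<sigma> k) = k" for k
    unfolding orthoP_poly_def p_def[symmetric] by (subst degree_map_poly) (auto simp: degree_p)
  have "cmean \<sigma> (orthoP_poly \<sigma> j * orthoP_poly \<sigma> k) = of_real (mean \<sigma> (p j * p k))" for j k
    unfolding orthoP_poly_def p_def[symmetric] cmean_def mean_def poly_mult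
    by (simp add: poly_map_of_real flip: of_real_mult)
  thus "cmean \<sigma> (orthoP_poly \<sigma> j * orthoP_poly \<sigma> k) = (if j = k then 1 else 0)" for j k
    by (simp add: orthonormal_p)
qed (auto simp: cmean_add cmean_smult)

lemma orthoQ_eq: "orthoQ \<sigma> k z = C.Q k z"
proof -
  have "diff_quotient q z u = poly (synthetic_div q z) u" for q u
  proof (cases "z = u")
    case True
    have "poly (pderiv ([:- z, 1:] * synthetic_div q z + [:poly q z:])) z = poly (synthetic_div q z) z"
      by (simp only: pderiv_add pderiv_mult) (simp add: pderiv_pCons)
    hence "poly (pderiv q) z = poly (synthetic_div q z) z"
      by (simp only: synthetic_div_correct')
    thus ?thesis using True by (simp add: diff_quotient_def)
  next
    case False
    have "poly q u = (u - z) * poly (synthetic_div q z) u + poly q z"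
      by (subst synthetic_div_correct'[of z q, symmetric]) (simp add: algebra_simps)
    thus ?thesis using False by (simp add: diff_quotient_def field_simps)
  qed
  thus ?thesis unfolding orthoQ_def C.Q_def cmean_def by simp
qed

lemma orthoP_of_real: "orthoP \<sigma> k (of_real x) = of_real (poly (p k) x)"
  by (simp add: orthoP_def orthoP_poly_def p_def poly_map_of_real)

lemma CQ_of_real: "C.Q k (of_real x) = of_real (R.Q k x)"
  unfolding C.Q_def R.Q_def orthoP_poly_def p_def[symmetric] synthetic_div_map_of_real
  by (rule cmean_of_real)

end

context orthonormal_sequence
begin

text \<open>The product rule for difference quotients; it evaluates the integrals of squares divided
  by t - x below.\<close>

lemma synthetic_div_mult:
  "synthetic_div (p * q) (x :: 'a) = synthetic_div p x * q + smult (poly p x) (synthetic_div q x)"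
proof -
  have "p * q + smult x (synthetic_div p x * q + smult (poly p x) (synthetic_div q x))
      = (p + smult x (synthetic_div p x)) * q + smult (poly p x) (smult x (synthetic_div q x))"
    by (simp add: algebra_simps smult_add_right mult.commute)
  also have "\<dots> = pCons 0 (synthetic_div p x * q) + smult (poly p x) (q + smult x (synthetic_div q x))"
    by (subst synthetic_div_correct[of p x]) (simp add: smult_add_right)
  also have "\<dots> = pCons (poly p x * poly q x) (synthetic_div p x * q + smult (poly p x) (synthetic_div q x))"
    by (simp only: synthetic_div_correct) simp
  finally show ?thesis using synthetic_div_unique by metis
qed

end

lemma slit_plane_lower_bound:
  assumes "z \<notin> \<real>\<^sub>\<ge>\<^sub>0"
  obtains d where "d > 0" "\<And>t. 0 \<le> t \<Longrightarrow> d \<le> cmod (complex_of_real t - z)"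
proof -
  have "open (- \<real>\<^sub>\<ge>\<^sub>0 :: complex set)" using closed_nonneg_Reals_complex by (simp add: open_Compl)
  then obtain d where d: "d > 0" "ball z d \<subseteq> - \<real>\<^sub>\<ge>\<^sub>0"
    using assms open_contains_ball by (metis ComplI)
  have "d \<le> cmod (complex_of_real t - z)" if "0 \<le> t" for t
  proof (rule ccontr)
    assume "\<not> ?thesis"
    hence "complex_of_real t \<in> ball z d" by (simp add: dist_norm norm_minus_commute)
    thus False using d(2) that by auto
  qed
  thus ?thesis using d(1) that by blast
qed

lemma norm_power2_le: "\<bar>x\<bar> \<le> B \<Longrightarrow> norm (x\<^sup>2 :: real) \<le> B\<^sup>2"
  using power_mono[of "\<bar>x\<bar>" B 2] by simp

lemma of_real_not_nonneg [simp]: "x < 0 \<Longrightarrow> complex_of_real x \<notin> \<real>\<^sub>\<ge>\<^sub>0"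
  by (simp add: complex_nonneg_Reals_iff)

lemma Im_pos_not_nonneg: "Im z > 0 \<Longrightarrow> z \<notin> \<real>\<^sub>\<ge>\<^sub>0"
  by (auto simp: complex_nonneg_Reals_iff)

section \<open>Complex resolvents off the half-line\<close>

context stieltjes_measure
begin

definition cres :: "complex \<Rightarrow> complex" where "cres z = (\<integral>t. 1 / (complex_of_real t - z) \<partial>\<sigma>)"

lemma cmod_resolvent_bound:
  assumes "z \<notin> \<real>\<^sub>\<ge>\<^sub>0"
  obtains B where "AE t in \<sigma>. cmod (1 / (complex_of_real t - z)) \<le> B"
proof -
  obtain d where d: "d > 0" "\<And>t. 0 \<le> t \<Longrightarrow> d \<le> cmod (complex_of_real t - z)"
    using slit_plane_lower_bound[OF assms] by blast
  have "AE t in \<sigma>. cmod (1 / (complex_of_real t - z)) \<le> 1 / d"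
    using AE_nonneg
  proof eventually_elim
    case (elim t)
    thus ?case using d(2)[of t] d(1) by (simp add: norm_divide frac_le)
  qed
  thus ?thesis using that by blast
qed

lemma integrable_bounded_times_poly:
  assumes [measurable]: "g \<in> borel_measurable borel" and B: "AE t in \<sigma>. \<bar>g t\<bar> \<le> B"
  shows "integrable \<sigma> (\<lambda>t. g t * poly q t)"
proof (rule Bochner_Integration.integrable_bound[OF integrable_mult_right[OF integrable_poly[of q], of B]])
  show "(\<lambda>t. g t * poly q t) \<in> borel_measurable \<sigma>" unfolding measurable_eq by measurable
  show "AE t in \<sigma>. norm (g t * poly q t) \<le> norm (B * poly q t)" using B
    by eventually_elim (auto simp: abs_mult intro!: mult_right_mono)
qed

lemma integrable_cpoly_resolvent:
  assumes "z \<notin> \<real>\<^sub>\<ge>\<^sub>0" shows "integrable \<sigma> (\<lambda>t. poly q (complex_of_real t) / (complex_of_real t - z))"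
proof -
  obtain B where B: "AE t in \<sigma>. cmod (1 / (complex_of_real t - z)) \<le> B" using cmod_resolvent_bound[OF assms] by blast
  show ?thesis
  proof (rule Bochner_Integration.integrable_bound[OF integrable_mult_right[OF integrable_cpoly[of q], of "of_real B"]])
    have [measurable]: "(\<lambda>t::real. poly q (complex_of_real t)) \<in> borel_measurable borel"
      by (intro borel_measurable_continuous_onI continuous_intros)
    show "(\<lambda>t. poly q (complex_of_real t) / (complex_of_real t - z)) \<in> borel_measurable \<sigma>" 
      unfolding measurable_eq by measurable
    show "AE t in \<sigma>. norm (poly q (complex_of_real t) / (complex_of_real t - z)) \<le> norm (of_real B * poly q (complex_of_real t))" using B
    proof eventually_elim
      case (elim t)
      have "norm (poly q (complex_of_real t) / (complex_of_real t - z)) = cmod (poly q (complex_of_real t)) * cmod (1 / (complex_of_real t - z))"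
        by (simp add: norm_divide)
      also have "\<dots> \<le> cmod (poly q (complex_of_real t)) * \<bar>B\<bar>" using elim by (intro mult_left_mono) auto
      finally show ?case by (simp add: norm_mult mult.commute)
    qed
  qed
qed

lemma integrable_resolvent:
  assumes "z \<notin> \<real>\<^sub>\<ge>\<^sub>0" shows "integrable \<sigma> (\<lambda>t. 1 / (complex_of_real t - z))"
  using integrable_cpoly_resolvent[OF assms, of 1] by simp

lemma cresolvent_split:
  assumes z: "z \<notin> \<real>\<^sub>\<ge>\<^sub>0"
  shows "(\<integral>t. poly q (complex_of_real t) / (complex_of_real t - z) \<partial>\<sigma>)
    = cmean \<sigma> (synthetic_div q z) + poly q z * cres z"
proof -
  have [measurable]: "(\<lambda>t::real. poly q (complex_of_real t)) \<in> borel_measurable borel" for q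
    by (intro borel_measurable_continuous_onI continuous_intros)
  have "(\<integral>t. poly q (complex_of_real t) / (complex_of_real t - z) \<partial>\<sigma>)
     = (\<integral>t. poly (synthetic_div q z) (complex_of_real t) + poly q z * (1 / (complex_of_real t - z)) \<partial>\<sigma>)"
  proof (rule integral_cong_AE)
    show "AE t in \<sigma>. poly q (complex_of_real t) / (complex_of_real t - z)
       = poly (synthetic_div q z) (complex_of_real t) + poly q z * (1 / (complex_of_real t - z))"
      using AE_nonneg
    proof eventually_elim
      case (elim t)
      have "complex_of_real t \<noteq> z" using elim z by auto
      moreover have "poly q (complex_of_real t) = (complex_of_real t - z) * poly (synthetic_div q z) (complex_of_real t) + poly q z"
        by (subst synthetic_div_correct'[of z q, symmetric]) (simp add: algebra_simps)
      ultimately show ?case by (simp add: field_simps)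
    qed
  qed (unfold measurable_eq, measurable)
  also have "\<dots> = cmean \<sigma> (synthetic_div q z) + poly q z * cres z"
    using integrable_resolvent[OF assms]
    by (subst Bochner_Integration.integral_add) (auto simp: cmean_def cres_def integrable_cpoly intro!: integrable_mult_right simp del: times_divide_eq_right)
  finally show ?thesis .
qed

lemma cres_of_real: "x < 0 \<Longrightarrow> cres (of_real x) = of_real (res x)"
proof -
  assume "x < 0"
  have "cres (of_real x) = (\<integral>t. complex_of_real (1 / (t - x)) \<partial>\<sigma>)" unfolding cres_def by simp
  thus ?thesis unfolding res_def integral_complex_of_real .
qed

lemma Im_cres:
  assumes "z \<notin> \<real>\<^sub>\<ge>\<^sub>0"
  shows "Im (cres z) = Im z * (\<integral>t. (cmod (1 / (complex_of_real t - z)))\<^sup>2 \<partial>\<sigma>)"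
proof -
  have "Im (1 / (complex_of_real t - z)) = Im z * (cmod (1 / (complex_of_real t - z)))\<^sup>2" for t
    by (simp add: Im_divide norm_divide power_divide cmod_power2)
  thus ?thesis unfolding cres_def using integrable_resolvent[OF assms]
    by (simp flip: integral_Im)
qed

end

section \<open>Bessel's inequality and square summability\<close>

context indeterminate_measure
begin

text \<open>Orthonormality depends on the moments only, so the polynomials of \<sigma> are
  orthonormal for \<tau> as well. The rest is the expansion of the nonnegative integral of the
  square of g - s.\<close>

lemma bessel_real:
  assumes [measurable]: "g \<in> borel_measurable borel" and tau: "\<tau> \<in> moment_solutions \<sigma> {0..}"
    and B: "AE t in \<tau>. \<bar>g t\<bar> \<le> B"
  shows "(\<Sum>k<n. (\<integral>t. g t * poly (p k) t \<partial>\<tau>)\<^sup>2) \<le> (\<integral>t. (g t)\<^sup>2 \<partial>\<tau>)"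
proof -
  interpret t: stieltjes_measure \<tau> by (rule moment_solutions_stieltjes[OF tau])
  define a where "a k = (\<integral>t. g t * poly (p k) t \<partial>\<tau>)" for k
  define s where "s = (\<Sum>k<n. smult (a k) (p k))"
  note ip = t.integrable_bounded_times_poly[OF assms(1) B]
  have ig: "integrable \<tau> (\<lambda>t. (g t)\<^sup>2)"
  proof (rule t.integrable_const_bound[of _ "B\<^sup>2"])
    show "AE t in \<tau>. norm ((g t)\<^sup>2) \<le> B\<^sup>2" using B
      by eventually_elim (rule norm_power2_le)
  qed (unfold t.measurable_eq, measurable)
  have gs: "(\<integral>t. g t * poly s t \<partial>\<tau>) = (\<Sum>k<n. (a k)\<^sup>2)"
  proof -
    have "(\<integral>t. g t * poly s t \<partial>\<tau>) = (\<integral>t. (\<Sum>k<n. a k * (g t * poly (p k) t)) \<partial>\<tau>)"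
      by (simp add: s_def poly_sum sum_distrib_left mult_ac)
    also have "\<dots> = (\<Sum>k<n. a k * a k)" using ip by (simp add: a_def)
    finally show ?thesis by (simp add: power2_eq_square)
  qed
  have "mean \<sigma> (s * p k) = a k" if "k < n" for k
    using that by (simp add: s_def sum_distrib_right mean_sum mean_smult orthonormal_p if_distrib cong: if_cong)
  hence "mean \<sigma> (s * s) = (\<Sum>k<n. (a k)\<^sup>2)"
    by (subst (2) s_def) (simp add: sum_distrib_left mean_sum mean_smult power2_eq_square)
  hence ss: "(\<integral>t. poly (s * s) t \<partial>\<tau>) = (\<Sum>k<n. (a k)\<^sup>2)"
    using mean_unique[OF tau] by (metis mean_def)
  have "0 \<le> (\<integral>t. (g t - poly s t)\<^sup>2 \<partial>\<tau>)" by simp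
  also have "\<dots> = (\<integral>t. (g t)\<^sup>2 - 2 * (g t * poly s t) + poly (s * s) t \<partial>\<tau>)"
    by (simp add: power2_eq_square algebra_simps)
  also have "\<dots> = (\<integral>t. (g t)\<^sup>2 \<partial>\<tau>) - 2 * (\<integral>t. g t * poly s t \<partial>\<tau>) + (\<integral>t. poly (s * s) t \<partial>\<tau>)"
    using ig ip t.integrable_poly[of "s * s"] by (subst Bochner_Integration.integral_add) (auto simp del: poly_mult)
  finally show ?thesis using gs ss by (simp add: a_def)
qed

text \<open>By division with remainder the Fourier coefficient of 1 / (t - z) at P_k is Q_k(z) + w
  P_k(z), with w the resolvent of \<tau>. Real and imaginary parts are estimated separately.\<close>

lemma bessel:
  assumes tau: "\<tau> \<in> moment_solutions \<sigma> {0..}" and z: "z \<notin> \<real>\<^sub>\<ge>\<^sub>0"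
  shows "(\<Sum>k<n. (cmod (C.Q k z + stieltjes_measure.cres \<tau> z * poly (orthoP_poly \<sigma> k) z))\<^sup>2)
    \<le> (\<integral>t. (cmod (1 / (complex_of_real t - z)))\<^sup>2 \<partial>\<tau>)"
proof -
  interpret t: stieltjes_measure \<tau> by (rule moment_solutions_stieltjes[OF tau])
  obtain B where B: "AE t in \<tau>. cmod (1 / (complex_of_real t - z)) \<le> B" using t.cmod_resolvent_bound[OF z] by blast
  define f where "f t = 1 / (complex_of_real t - z)" for t
  have [measurable]: "(\<lambda>t. Re (f t)) \<in> borel_measurable borel" "(\<lambda>t. Im (f t)) \<in> borel_measurable borel"
    unfolding f_def by measurable
  have BR: "AE t in \<tau>. \<bar>Re (f t)\<bar> \<le> B" and BI: "AE t in \<tau>. \<bar>Im (f t)\<bar> \<le> B"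
    using B by (auto simp: f_def elim!: eventually_mono intro: order_trans[OF abs_Re_le_cmod] order_trans[OF abs_Im_le_cmod])
  have eq: "C.Q k z + t.cres z * poly (orthoP_poly \<sigma> k) z = (\<integral>t. poly (orthoP_poly \<sigma> k) (complex_of_real t) / (complex_of_real t - z) \<partial>\<tau>)" for k
    by (simp add: t.cresolvent_split[OF z] C.Q_def cmean_unique[OF tau])
  have i: "integrable \<tau> (\<lambda>t. poly (orthoP_poly \<sigma> k) (complex_of_real t) / (complex_of_real t - z))" for k
    by (rule t.integrable_cpoly_resolvent[OF z])
  have pp: "poly (orthoP_poly \<sigma> k) (complex_of_real t) / (complex_of_real t - z) = f t * complex_of_real (poly (p k) t)" for k t
    by (simp add: f_def orthoP_poly_def p_def poly_map_of_real)
  have "(cmod (C.Q k z + t.cres z * poly (orthoP_poly \<sigma> k) z))\<^sup>2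
     = (\<integral>t. Re (f t) * poly (p k) t \<partial>\<tau>)\<^sup>2 + (\<integral>t. Im (f t) * poly (p k) t \<partial>\<tau>)\<^sup>2" for k
    using integral_Re[OF i] integral_Im[OF i] unfolding eq cmod_power2 pp by simp
  hence "(\<Sum>k<n. (cmod (C.Q k z + t.cres z * poly (orthoP_poly \<sigma> k) z))\<^sup>2)
    \<le> (\<integral>t. (Re (f t))\<^sup>2 \<partial>\<tau>) + (\<integral>t. (Im (f t))\<^sup>2 \<partial>\<tau>)"
    using bessel_real[OF _ tau BR] bessel_real[OF _ tau BI] by (simp add: sum.distrib add_mono)
  also have "\<dots> = (\<integral>t. (Re (f t))\<^sup>2 + (Im (f t))\<^sup>2 \<partial>\<tau>)"
  proof -
    have "AE t in \<tau>. norm ((Re (f t))\<^sup>2) \<le> B\<^sup>2" using BR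
      by eventually_elim (rule norm_power2_le)
    moreover have "AE t in \<tau>. norm ((Im (f t))\<^sup>2) \<le> B\<^sup>2" using BI
      by eventually_elim (rule norm_power2_le)
    ultimately have "integrable \<tau> (\<lambda>t. (Re (f t))\<^sup>2)" "integrable \<tau> (\<lambda>t. (Im (f t))\<^sup>2)"
      by (auto intro!: t.integrable_const_bound simp: t.measurable_eq)
    thus ?thesis by simp
  qed
  finally show ?thesis by (simp add: f_def cmod_power2)
qed

abbreviation (input) cP :: "nat \<Rightarrow> complex \<Rightarrow> complex" where "cP k z \<equiv> poly (orthoP_poly \<sigma> k) z"

text \<open>P_k(c) and Q_k(c) are bundled because the transfer estimate uses the sum of their
  absolute values as its only weight.\<close>

definition ell2 :: "complex \<Rightarrow> bool" where
  "ell2 c \<longleftrightarrow> summable (\<lambda>k. (cmod (cP k c) + cmod (C.Q k c))\<^sup>2)"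

lemma summable_R_square:
  assumes tau: "\<tau> \<in> moment_solutions \<sigma> {0..}" and z: "z \<notin> \<real>\<^sub>\<ge>\<^sub>0"
  shows "summable (\<lambda>k. (cmod (C.Q k z + stieltjes_measure.cres \<tau> z * cP k z))\<^sup>2)"
  by (rule bounded_imp_summable[OF _ bessel[OF assms, of "Suc _", unfolded lessThan_Suc_atMost]]) simp

lemma summable_square_add:
  fixes f g :: "nat \<Rightarrow> complex"
  assumes "summable (\<lambda>k. (cmod (f k))\<^sup>2)" "summable (\<lambda>k. (cmod (g k))\<^sup>2)"
  shows "summable (\<lambda>k. (cmod (f k) + cmod (g k))\<^sup>2)"
proof (rule summable_comparison_test'[of "\<lambda>k. 2 * (cmod (f k))\<^sup>2 + 2 * (cmod (g k))\<^sup>2"])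
  show "summable (\<lambda>k. 2 * (cmod (f k))\<^sup>2 + 2 * (cmod (g k))\<^sup>2)" by (intro summable_add summable_mult assms)
  show "norm ((cmod (f k) + cmod (g k))\<^sup>2) \<le> 2 * (cmod (f k))\<^sup>2 + 2 * (cmod (g k))\<^sup>2" for k
    using sum_squares_bound[of "cmod (f k)" "cmod (g k)"] by (simp add: power2_sum)
qed

text \<open>Two solutions with different resolvents w and w' at x make Q_k + w P_k and Q_k + w' P_k
  square summable. Their difference isolates P_k, and then Q_k.\<close>

lemma ell2_negative: "\<exists>x<0. ell2 (of_real x)"
proof -
  obtain \<tau> x where tx: "\<tau> \<in> moment_solutions \<sigma> {0..}" "x < 0" "stieltjes_measure.res \<tau> x \<noteq> res x"
    using other_solution .
  interpret t: stieltjes_measure \<tau> by (rule moment_solutions_stieltjes[OF tx(1)])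
  define z where "z = complex_of_real x"
  have z: "z \<notin> \<real>\<^sub>\<ge>\<^sub>0" using tx(2) by (simp add: z_def)
  define d where "d = t.cres z - cres z"
  have d: "d \<noteq> 0" using tx unfolding d_def z_def by (simp add: cres_of_real t.cres_of_real)
  let ?f = "\<lambda>k. C.Q k z + t.cres z * cP k z" and ?g = "\<lambda>k. - (C.Q k z + cres z * cP k z)"
  have 1: "summable (\<lambda>k. (cmod (?f k))\<^sup>2)" "summable (\<lambda>k. (cmod (?g k))\<^sup>2)"
    using summable_R_square[OF tx(1) z] summable_R_square[OF self_solution z] by (simp_all add: norm_minus_cancel del: minus_add_distrib)
  have sP: "summable (\<lambda>k. (cmod (cP k z))\<^sup>2)"
  proof (rule summable_comparison_test'[OF summable_mult[OF summable_square_add[OF 1], of "1 / (cmod d)\<^sup>2"]])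
    fix k
    have "cmod d * cmod (cP k z) = cmod (?f k + ?g k)" by (simp add: d_def algebra_simps flip: norm_mult)
    also have "\<dots> \<le> cmod (?f k) + cmod (?g k)" by (rule norm_triangle_ineq)
    finally have "(cmod d * cmod (cP k z))\<^sup>2 \<le> (cmod (?f k) + cmod (?g k))\<^sup>2" by (intro power_mono) auto
    thus "norm ((cmod (cP k z))\<^sup>2) \<le> 1 / (cmod d)\<^sup>2 * (cmod (?f k) + cmod (?g k))\<^sup>2"
      using d by (simp add: power_mult_distrib field_simps)
  qed
  let ?h = "\<lambda>k. t.cres z * cP k z"
  have 2: "summable (\<lambda>k. (cmod (?h k))\<^sup>2)"
    using summable_mult[OF sP, of "(cmod (t.cres z))\<^sup>2"] by (simp add: norm_mult power_mult_distrib)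
  have sQ: "summable (\<lambda>k. (cmod (C.Q k z))\<^sup>2)"
  proof (rule summable_comparison_test'[OF summable_square_add[OF 1(1) 2]])
    fix k
    have "cmod (C.Q k z) \<le> cmod (?f k) + cmod (?h k)" using norm_triangle_ineq4[of "?f k" "?h k"] by simp
    thus "norm ((cmod (C.Q k z))\<^sup>2) \<le> (cmod (?f k) + cmod (?h k))\<^sup>2" by (auto intro!: power_mono)
  qed
  have "ell2 z" unfolding ell2_def by (rule summable_square_add[OF sP sQ])
  thus ?thesis using tx(2) by (auto simp: z_def)
qed

definition growth :: "complex \<Rightarrow> real" where "growth c = (\<Sum>k. (cmod (cP k c) + cmod (C.Q k c))\<^sup>2)"

text \<open>A discrete Gronwall argument. The pair (u, v) of transfer coefficients grows in step k
  by a factor of at most 1 + |z - c| m_k^2, which is below exp (|z - c| m_k^2); the product is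
  bounded because the squares m_k^2 are summable.\<close>

lemma transfer_bound:
  fixes \<alpha> \<beta> c z :: complex
  assumes "ell2 c"
  shows "cmod (\<alpha> * C.Q n z + \<beta> * cP n z)
    \<le> (cmod (cP n c) + cmod (C.Q n c)) * ((cmod \<alpha> + cmod \<beta>) * exp (cmod (z - c) * growth c))"
proof -
  define m where "m k = cmod (cP k c) + cmod (C.Q k c)" for k
  define u where "u k = \<alpha> * C.tC c z k + \<beta> * C.tD c z k" for k
  define v where "v k = \<alpha> * C.tA c z k + \<beta> * C.tB c z k" for k
  define r where "r k = \<alpha> * C.Q k z + \<beta> * cP k z" for k
  have r: "r k = C.Q k c * u k - cP k c * v k" for k
    unfolding r_def u_def v_def by (subst C.Q_transfer[of k z c], subst C.P_transfer[of k z c]) (simp add: algebra_simps)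
  have rb: "cmod (r k) \<le> m k * (cmod (u k) + cmod (v k))" for k
  proof -
    have "cmod (r k) \<le> cmod (C.Q k c) * cmod (u k) + cmod (cP k c) * cmod (v k)"
      unfolding r using norm_triangle_ineq4[of "C.Q k c * u k" "cP k c * v k"] by (simp add: norm_mult)
    also have "\<dots> \<le> m k * cmod (u k) + m k * cmod (v k)" by (intro add_mono mult_right_mono) (auto simp: m_def)
    finally show ?thesis by (simp add: distrib_left)
  qed
  have uS: "u (Suc k) = u k + (z - c) * cP k c * r k" and vS: "v (Suc k) = v k + (z - c) * C.Q k c * r k" for k
    by (simp_all add: u_def v_def r_def C.tA_def C.tB_def C.tC_def C.tD_def algebra_simps)
  have s: "cmod (u n) + cmod (v n) \<le> (cmod \<alpha> + cmod \<beta>) * exp (cmod (z - c) * (\<Sum>k<n. (m k)\<^sup>2))" for n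
  proof (induction n)
    case 0
    thus ?case by (simp add: u_def v_def C.tA_def C.tB_def C.tC_def C.tD_def)
  next
    case (Suc n)
    have "cmod (u (Suc n)) + cmod (v (Suc n)) \<le> cmod (u n) + cmod (v n) + cmod (z - c) * m n * cmod (r n)"
    proof -
      have "cmod (u (Suc n)) \<le> cmod (u n) + cmod (z - c) * cmod (cP n c) * cmod (r n)"
        unfolding uS by (rule order_trans[OF norm_triangle_ineq]) (simp add: norm_mult)
      moreover have "cmod (v (Suc n)) \<le> cmod (v n) + cmod (z - c) * cmod (C.Q n c) * cmod (r n)"
        unfolding vS by (rule order_trans[OF norm_triangle_ineq]) (simp add: norm_mult)
      ultimately show ?thesis by (simp add: m_def distrib_left distrib_right)
    qed
    also have "\<dots> \<le> cmod (u n) + cmod (v n) + cmod (z - c) * m n * (m n * (cmod (u n) + cmod (v n)))"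
      using rb[of n] by (intro add_left_mono mult_left_mono) (auto simp: m_def)
    also have "\<dots> = (cmod (u n) + cmod (v n)) * (1 + cmod (z - c) * (m n)\<^sup>2)" by (simp add: power2_eq_square algebra_simps)
    also have "\<dots> \<le> ((cmod \<alpha> + cmod \<beta>) * exp (cmod (z - c) * (\<Sum>k<n. (m k)\<^sup>2))) * exp (cmod (z - c) * (m n)\<^sup>2)"
      using Suc by (intro mult_mono) auto
    also have "\<dots> = (cmod \<alpha> + cmod \<beta>) * exp (cmod (z - c) * (\<Sum>k<Suc n. (m k)\<^sup>2))"
      by (simp add: exp_add[symmetric] algebra_simps)
    finally show ?case .
  qed
  have "(\<Sum>k<n. (m k)\<^sup>2) \<le> growth c" unfolding growth_def m_def
    using assms by (intro sum_le_suminf) (auto simp: ell2_def)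
  hence "cmod (u n) + cmod (v n) \<le> (cmod \<alpha> + cmod \<beta>) * exp (cmod (z - c) * growth c)"
    by (intro order_trans[OF s[of n]] mult_left_mono) (auto intro!: mult_left_mono)
  hence "cmod (r n) \<le> m n * ((cmod \<alpha> + cmod \<beta>) * exp (cmod (z - c) * growth c))"
    by (intro order_trans[OF rb[of n]] mult_left_mono) (auto simp: m_def)
  thus ?thesis by (simp add: r_def m_def)
qed

lemma ell2_transfer: assumes "ell2 c" shows "ell2 z"
proof -
  define E where "E = exp (cmod (z - c) * growth c)"
  let ?m = "\<lambda>k. cmod (cP k c) + cmod (C.Q k c)"
  have b: "cmod (cP k z) \<le> ?m k * E" "cmod (C.Q k z) \<le> ?m k * E" for k
    using transfer_bound[OF assms, of 0 k z 1] transfer_bound[OF assms, of 1 k z 0] by (simp_all add: E_def)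
  show ?thesis unfolding ell2_def
  proof (rule summable_comparison_test'[OF summable_mult[OF assms[unfolded ell2_def], of "(2 * E)\<^sup>2"]])
    fix k
    have "cmod (cP k z) + cmod (C.Q k z) \<le> 2 * E * ?m k" using b[of k] by (simp add: algebra_simps)
    hence "(cmod (cP k z) + cmod (C.Q k z))\<^sup>2 \<le> (2 * E * ?m k)\<^sup>2" by (intro power_mono) auto
    thus "norm ((cmod (cP k z) + cmod (C.Q k z))\<^sup>2) \<le> (2 * E)\<^sup>2 * (?m k)\<^sup>2" by (simp add: power_mult_distrib)
  qed
qed

lemma ell2_0: "ell2 0" using ell2_negative ell2_transfer by blast

section \<open>The entire functions A, B, C, D as limits of the truncated matrix\<close>

lemma Q_holomorphic: "(\<lambda>z. C.Q n z) holomorphic_on S"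
proof (induction n rule: less_induct)
  case (less n)
  have "(\<lambda>z. C.Q n 0 + (z - 0) * (\<Sum>k<n. (C.Q n 0 * cP k 0 - cP n 0 * C.Q k 0) * C.Q k z)) holomorphic_on S"
    by (intro holomorphic_intros less) auto
  thus ?case by (subst C.Q_shift[of n _ 0])
qed

text \<open>Weierstrass M-test on discs around 0: both factors are dominated, up to a constant on
  the disc, by the square summable sequence at 0.\<close>

lemma series_holomorphic:
  assumes a: "\<And>k. cmod (a k) \<le> cmod (cP k 0) + cmod (C.Q k 0)"
    and b: "\<And>k z. cmod (b k z) \<le> (cmod (cP k 0) + cmod (C.Q k 0)) * exp (cmod z * growth 0)"
    and hol: "\<And>k. b k holomorphic_on UNIV"
  shows "(\<lambda>n. \<Sum>k<n. a k * b k z) \<longlonglongrightarrow> (\<Sum>k. a k * b k z)"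
    and "(\<lambda>z. \<Sum>k. a k * b k z) holomorphic_on UNIV"
proof -
  let ?m = "\<lambda>k. (cmod (cP k 0) + cmod (C.Q k 0))\<^sup>2"
  have sm: "summable ?m" using ell2_0 by (simp add: ell2_def)
  have g: "growth 0 \<ge> 0" unfolding growth_def by (rule suminf_nonneg[OF sm]) simp
  have bd: "cmod (a k * b k z) \<le> exp (r * growth 0) * ?m k" if "cmod z \<le> r" for k z r
  proof -
    have "cmod (a k * b k z) \<le> (cmod (cP k 0) + cmod (C.Q k 0)) * ((cmod (cP k 0) + cmod (C.Q k 0)) * exp (cmod z * growth 0))"
      unfolding norm_mult using a b by (intro mult_mono) auto
    also have "\<dots> \<le> (cmod (cP k 0) + cmod (C.Q k 0)) * ((cmod (cP k 0) + cmod (C.Q k 0)) * exp (r * growth 0))"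
      using that g by (intro mult_left_mono) (auto intro: mult_right_mono)
    finally show ?thesis by (simp add: power2_eq_square mult_ac)
  qed
  have u: "uniform_limit (cball 0 r) (\<lambda>n z. \<Sum>k<n. a k * b k z) (\<lambda>z. \<Sum>k. a k * b k z) sequentially" for r
    by (rule Weierstrass_m_test[where M="\<lambda>k. exp (r * growth 0) * ?m k"]) (use bd sm in \<open>auto intro: summable_mult\<close>)
  show "(\<lambda>n. \<Sum>k<n. a k * b k z) \<longlonglongrightarrow> (\<Sum>k. a k * b k z)"
    by (rule tendsto_uniform_limitI[OF u[of "cmod z"]]) simp
  show "(\<lambda>z. \<Sum>k. a k * b k z) holomorphic_on UNIV"
  proof (rule holomorphic_uniform_sequence[where f="\<lambda>n z. \<Sum>k<n. a k * b k z"])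
    show "(\<lambda>z. \<Sum>k<n. a k * b k z) holomorphic_on UNIV" for n
      by (intro holomorphic_intros hol)
    show "\<exists>d>0. cball x d \<subseteq> UNIV \<and> uniform_limit (cball x d) (\<lambda>n z. \<Sum>k<n. a k * b k z) (\<lambda>z. \<Sum>k. a k * b k z) sequentially" for x
    proof (intro exI[of _ 1] conjI)
      have "cball x 1 \<subseteq> cball 0 (cmod x + 1)"
        by (auto simp: dist_norm) (metis norm_triangle_sub norm_minus_commute add.commute add_left_mono order_trans)
      thus "uniform_limit (cball x 1) (\<lambda>n z. \<Sum>k<n. a k * b k z) (\<lambda>z. \<Sum>k. a k * b k z) sequentially"
        using u uniform_limit_on_subset by blast
    qed auto
  qed auto
qed

lemma bounds_0:
  "cmod (cP k 0) \<le> cmod (cP k 0) + cmod (C.Q k 0)" "cmod (C.Q k 0) \<le> cmod (cP k 0) + cmod (C.Q k 0)"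
  "cmod (cP k z) \<le> (cmod (cP k 0) + cmod (C.Q k 0)) * exp (cmod z * growth 0)"
  "cmod (C.Q k z) \<le> (cmod (cP k 0) + cmod (C.Q k 0)) * exp (cmod z * growth 0)"
  using transfer_bound[OF ell2_0, of 0 k z 1] transfer_bound[OF ell2_0, of 1 k z 0] by auto

lemma P_holomorphic: "(\<lambda>z. cP n z) holomorphic_on S" by (intro holomorphic_intros)

lemma nev_holomorphic:
  "nevA \<sigma> holomorphic_on S" "nevB \<sigma> holomorphic_on S" "nevC \<sigma> holomorphic_on S" "nevD \<sigma> holomorphic_on S"
  unfolding nevA_def[abs_def] nevB_def[abs_def] nevC_def[abs_def] nevD_def[abs_def] orthoQ_eq orthoP_def
  by (rule holomorphic_on_subset[OF _ subset_UNIV], intro holomorphic_intros series_holomorphic bounds_0 Q_holomorphic P_holomorphic)+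

lemma nev_limits:
  "C.tA 0 z \<longlonglongrightarrow> nevA \<sigma> z" "C.tB 0 z \<longlonglongrightarrow> nevB \<sigma> z" "C.tC 0 z \<longlonglongrightarrow> nevC \<sigma> z" "C.tD 0 z \<longlonglongrightarrow> nevD \<sigma> z"
  unfolding nevA_def nevB_def nevC_def nevD_def orthoQ_eq orthoP_def
    C.tA_def[abs_def] C.tB_def[abs_def] C.tC_def[abs_def] C.tD_def[abs_def] diff_zero
  by (intro tendsto_intros series_holomorphic bounds_0 Q_holomorphic P_holomorphic)+

lemma nev_det: "nevA \<sigma> z * nevD \<sigma> z - nevB \<sigma> z * nevC \<sigma> z = 1"
proof -
  have "(\<lambda>n. C.tA 0 z n * C.tD 0 z n - C.tB 0 z n * C.tC 0 z n) \<longlonglongrightarrow> nevA \<sigma> z * nevD \<sigma> z - nevB \<sigma> z * nevC \<sigma> z"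
    by (intro tendsto_intros nev_limits)
  thus ?thesis unfolding C.transfer_det by (simp add: LIMSEQ_const_iff)
qed

text \<open>For the truncated u and v, Im (v cnj u) telescopes to - Im w plus Im z times a partial
  Bessel sum. As Im w is Im z times the integral of the squared norm of 1 / (t - z), Bessel's
  inequality makes this nonpositive for every n. In the limit - v / u has nonnegative imaginary part
  wherever u is nonzero.\<close>

lemma Im_fraction_nonpos:
  assumes tau: "\<tau> \<in> moment_solutions \<sigma> {0..}" and z: "Im z > 0"
  defines "w \<equiv> stieltjes_measure.cres \<tau> z"
  shows "Im ((nevA \<sigma> z + w * nevB \<sigma> z) * cnj (nevC \<sigma> z + w * nevD \<sigma> z)) \<le> 0"
proof -
  interpret t: stieltjes_measure \<tau> by (rule moment_solutions_stieltjes[OF tau])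
  have z': "z \<notin> \<real>\<^sub>\<ge>\<^sub>0" using z by (rule Im_pos_not_nonneg)
  define u where "u k = C.tC 0 z k + w * C.tD 0 z k" for k
  define v where "v k = C.tA 0 z k + w * C.tB 0 z k" for k
  define r where "r k = C.Q k z + w * cP k z" for k
  have r: "r k = C.Q k 0 * u k - cP k 0 * v k" for k
    unfolding r_def u_def v_def by (subst C.Q_transfer[of k z 0], subst C.P_transfer[of k z 0]) (simp add: algebra_simps)
  have uS: "u (Suc k) = u k + z * cP k 0 * r k" and vS: "v (Suc k) = v k + z * C.Q k 0 * r k" for k
    by (simp_all add: u_def v_def r_def C.tA_def C.tB_def C.tC_def C.tD_def algebra_simps)
  have real: "cnj (cP k 0) = cP k 0" "cnj (C.Q k 0) = C.Q k 0" for k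
    using orthoP_of_real[of k 0] CQ_of_real[of k 0] by (simp_all add: orthoP_def)
  have Im: "Im (v n * cnj (u n)) = - Im w + Im z * (\<Sum>k<n. (cmod (r k))\<^sup>2)" for n
  proof (induction n)
    case 0 thus ?case by (simp add: u_def v_def C.tA_def C.tB_def C.tC_def C.tD_def)
  next
    case (Suc n)
    have "v (Suc n) * cnj (u (Suc n)) = v n * cnj (u n) + z * C.Q n 0 * r n * cnj (u n)
        + v n * cnj (z * cP n 0 * r n) + z * cnj z * (C.Q n 0 * cP n 0) * (r n * cnj (r n))"
      unfolding uS vS by (simp add: algebra_simps real)
    moreover have "Im (z * cnj z * (C.Q n 0 * cP n 0) * (r n * cnj (r n))) = 0"
    proof -
      have "cnj (z * cnj z * (C.Q n 0 * cP n 0) * (r n * cnj (r n))) = z * cnj z * (C.Q n 0 * cP n 0) * (r n * cnj (r n))"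
        by (simp add: real mult_ac)
      thus ?thesis by (metis Reals_cnj_iff complex_is_Real_iff)
    qed
    moreover have "Im (v n * cnj (z * cP n 0 * r n)) = - Im (z * cP n 0 * r n * cnj (v n))"
      by (metis complex_cnj_cnj complex_cnj_mult cnj.simps(2) mult.commute)
    moreover have "Im (z * C.Q n 0 * r n * cnj (u n)) - Im (z * cP n 0 * r n * cnj (v n)) = Im (z * r n * cnj (r n))"
    proof -
      have "cnj (r n) = C.Q n 0 * cnj (u n) - cP n 0 * cnj (v n)" unfolding r[of n] by (simp add: real)
      hence "z * C.Q n 0 * r n * cnj (u n) - z * cP n 0 * r n * cnj (v n) = z * r n * cnj (r n)"
        by (subst \<open>cnj (r n) = _\<close>) (simp add: algebra_simps)
      thus ?thesis by (simp only: minus_complex.sel[symmetric])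
    qed
    moreover have "Im (z * r n * cnj (r n)) = Im z * (cmod (r n))\<^sup>2"
      by (simp add: mult.assoc complex_norm_square[symmetric])
    ultimately show ?case using Suc by (simp add: algebra_simps)
  qed
  have "Im z * (\<Sum>k<n. (cmod (r k))\<^sup>2) \<le> Im z * (\<integral>t. (cmod (1 / (complex_of_real t - z)))\<^sup>2 \<partial>\<tau>)" for n
    using bessel[OF tau z', of n] z unfolding r_def w_def by (intro mult_left_mono) auto
  hence le: "Im (v n * cnj (u n)) \<le> 0" for n
    unfolding Im using t.Im_cres[OF z'] by (simp add: w_def)
  have "(\<lambda>n. Im (v n * cnj (u n))) \<longlonglongrightarrow> Im ((nevA \<sigma> z + w * nevB \<sigma> z) * cnj (nevC \<sigma> z + w * nevD \<sigma> z))"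
    unfolding u_def v_def by (intro tendsto_intros nev_limits)
  thus ?thesis using le by (intro LIMSEQ_le_const2) auto
qed

end

section \<open>The Nevanlinna parametrisation\<close>

text \<open>Otherwise the image would be open and contain points just below the real number
  \<open>g z\<close>.\<close>

lemma holomorphic_Im_nonneg_constant:
  assumes hol: "g holomorphic_on B" and B: "open B" "connected B"
    and Im: "\<And>z. z \<in> B \<Longrightarrow> 0 \<le> Im (g z)" and z: "z \<in> B" "Im (g z) = 0"
  shows "g constant_on B"
proof (rule ccontr)
  assume "\<not> g constant_on B"
  hence "open (g ` B)" using open_mapping_thm[OF hol B B(1)] by blast
  then obtain e where e: "e > 0" "ball (g z) e \<subseteq> g ` B" using z(1) open_contains_ball by (metis imageI)
  have "g z - \<i> * of_real (e / 2) \<in> ball (g z) e" using e(1) by (simp add: dist_norm norm_mult)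
  then obtain y where "y \<in> B" "g y = g z - \<i> * of_real (e / 2)" using e(2) by (metis (no_types, lifting) imageE subsetD)
  thus False using Im[of y] z(2) e(1) by simp
qed

lemma stieltjes_cres_holomorphic:
  assumes "stieltjes_measure \<sigma>" shows "stieltjes_measure.cres \<sigma> holomorphic_on (- \<real>\<^sub>\<ge>\<^sub>0)"
proof -
  interpret s: stieltjes_measure \<sigma> by fact
  interpret o: orthant_measure \<sigma> by unfold_locales (simp add: nonneg_orthant_real s.mm)
  have "(\<lambda>z. o.K (\<lambda>_. 1) 1 (1, z)) = s.cres" by (simp add: o.K_def s.cres_def fun_eq_iff)
  thus ?thesis using o.K_holomorphic[of "\<lambda>_. 1" 1 1] by (simp add: mem_interior_nonneg_orthant)
qed

lemma (in stieltjes_measure) cres_cnj: "cres (cnj z) = cnj (cres z)"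
  unfolding cres_def by (subst Bochner_Integration.integral_cnj[symmetric]) simp

lemma slit_plane_open_connected: "open (- \<real>\<^sub>\<ge>\<^sub>0 :: complex set)" "connected (- \<real>\<^sub>\<ge>\<^sub>0 :: complex set)"
proof -
  show "open (- \<real>\<^sub>\<ge>\<^sub>0 :: complex set)" using closed_nonneg_Reals_complex by (simp add: open_Compl)
  have "starlike (- \<real>\<^sub>\<ge>\<^sub>0 :: complex set)" unfolding starlike_def
  proof (intro bexI[of _ "-1"] ballI subsetI)
    fix x y :: complex assume x: "x \<in> - \<real>\<^sub>\<ge>\<^sub>0" and y: "y \<in> closed_segment (- 1) x"
    then obtain s where s: "0 \<le> s" "s \<le> 1" "y = (1 - s) *\<^sub>R (- 1) + s *\<^sub>R x" by (auto simp: closed_segment_def)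
    have Re: "Re y = s - 1 + s * Re x" and Im: "Im y = s * Im x" using s by auto
    show "y \<in> - \<real>\<^sub>\<ge>\<^sub>0"
    proof
      assume "y \<in> \<real>\<^sub>\<ge>\<^sub>0"
      hence y': "0 \<le> Re y" "Im y = 0" by (auto simp: complex_nonneg_Reals_iff)
      hence "s \<noteq> 0" using Re by auto
      hence "Im x = 0" "s > 0" using Im y' s by auto
      moreover from this have "Re x < 0" using x by (auto simp: complex_nonneg_Reals_iff)
      ultimately have "s * Re x < 0" by (simp add: mult_pos_neg)
      thus False using Re y' s by linarith
    qed
  qed (auto simp: complex_nonneg_Reals_iff)
  thus "connected (- \<real>\<^sub>\<ge>\<^sub>0 :: complex set)" by (rule starlike_imp_connected)
qed

section \<open>Sign relations on the negative axis\<close>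

context indeterminate_measure
begin

text \<open>A zero x \<le> 0 gives p_k = (t - x) q with q of degree below k. By orthogonality the
  integral of (t - x) q^2 vanishes while its integrand is nonnegative, so p_k is 0 almost
  everywhere, against its norm 1.\<close>

lemma p_nonzero: assumes "x \<le> 0" shows "poly (p k) x \<noteq> 0"
proof
  assume 0: "poly (p k) x = 0"
  then obtain q where q: "p k = [:- x, 1:] * q" using poly_eq_0_iff_dvd by (metis dvdE)
  have nz: "p k \<noteq> 0" by (rule R.P_nonzero)
  hence "q \<noteq> 0" using q by auto
  hence "degree ([:- x, 1:] * q) = degree [:- x, 1:] + degree q" by (intro degree_mult_eq) auto
  hence "degree (p k) = Suc (degree q)" by (subst q) simp
  hence "mean \<sigma> (q * p k) = 0" by (intro R.orthogonal_lower) (simp add: degree_p)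
  hence "(\<integral>t. poly (q * p k) t \<partial>\<sigma>) = 0" by (simp add: mean_def)
  moreover have pos: "AE t in \<sigma>. 0 \<le> poly (q * p k) t" using AE_nonneg
  proof eventually_elim
    case (elim t)
    have "poly (q * p k) t = (t - x) * (poly q t)\<^sup>2" by (subst q) (simp add: power2_eq_square algebra_simps)
    thus ?case using elim assms by simp
  qed
  ultimately have "AE t in \<sigma>. poly (q * p k) t = 0"
    using integral_nonneg_eq_0_iff_AE[OF integrable_poly pos] by blast
  hence "AE t in \<sigma>. poly (p k * p k) t = 0"
    by eventually_elim (use q in auto)
  hence "mean \<sigma> (p k * p k) = 0" unfolding mean_def by (rule integral_eq_zero_AE)
  thus False by (simp add: orthonormal_p)
qed

text \<open>Without zeros on the nonpositive axis the sign there is the sign near minus infinity,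
  which the positive leading coefficient and the parity of k determine.\<close>

lemma p_sign: assumes "x \<le> 0" shows "0 < (- 1) ^ k * poly (p k) x"
proof (rule ccontr)
  assume neg: "\<not> 0 < (- 1) ^ k * poly (p k) x"
  define q where "q = smult ((- 1) ^ k) (p k)"
  have x: "poly q x < 0" using neg p_nonzero[OF assms, of k] unfolding q_def
    by (metis linorder_neqE_linordered_idom mult_eq_0_iff poly_smult power_eq_0_iff zero_neq_neg_one)
  define r where "r = smult ((- 1) ^ k) (pcompose (p k) [:0, - 1:])"
  have "lead_coeff r = (- 1) ^ k * (lead_coeff (p k) * (- 1) ^ k)"
    unfolding r_def lead_coeff_smult by (subst lead_coeff_comp) (auto simp: degree_p)
  also have "\<dots> = lead_coeff (p k)" by (simp flip: power_mult_distrib)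
  finally have "0 < lead_coeff r" using lead_coeff_p by simp
  then obtain n where n: "\<And>y. y \<ge> n \<Longrightarrow> lead_coeff r \<le> poly r y" using poly_pinfty_gt_lc by blast
  define y where "y = max n (1 - x)"
  have "poly r y > 0" using n[of y] \<open>0 < lead_coeff r\<close> by (simp add: y_def)
  hence y: "poly q (- y) > 0" by (simp add: r_def q_def poly_pcompose)
  have "- y < x" by (auto simp: y_def)
  then obtain s where "s < x" "poly q s = 0" using poly_IVT_neg[OF _ y x] by blast
  thus False using p_nonzero[of s k] assms by (simp add: q_def)
qed

lemma p_same_sign: assumes "x \<le> 0" shows "0 < poly (p k) 0 * poly (p k) x"
  using mult_pos_pos[OF p_sign[of 0 k] p_sign[OF assms, of k]]
  by (simp add: mult_ac power_mult_distrib[symmetric])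

lemma kernel_eq: "poly (R.kernel 0 n) x = (\<Sum>k<n. poly (p k) 0 * poly (p k) x)"
  by (simp add: R.kernel_def poly_sum)

lemma kernel_pos: "n > 0 \<Longrightarrow> x \<le> 0 \<Longrightarrow> 0 < poly (R.kernel 0 n) x"
  unfolding kernel_eq by (intro sum_pos) (auto simp: p_same_sign)

text \<open>The integral of p_n^2 / (t - x) is nonnegative for every solution; the product rule and
  orthogonality evaluate it.\<close>

lemma solution_ineq_P:
  assumes tau: "\<tau> \<in> moment_solutions \<sigma> {0..}" and x: "x < 0"
  shows "0 \<le> poly (p n) x * (R.Q n x + stieltjes_measure.res \<tau> x * poly (p n) x)"
proof -
  interpret t: stieltjes_measure \<tau> by (rule moment_solutions_stieltjes[OF tau])
  have "0 \<le> (\<integral>t. poly (p n * p n) t / (t - x) \<partial>\<tau>)"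
    by (rule integral_nonneg_AE) (use t.AE_nonneg x in \<open>auto elim!: eventually_mono\<close>)
  also have "\<dots> = poly (p n) x * (R.Q n x + t.res x * poly (p n) x)"
    unfolding t.resolvent_split[OF x] mean_unique[OF tau] R.synthetic_div_mult R.Q_def
    using R.synthetic_div_orthogonal[of n n x]
    by (simp add: mean_add mean_smult algebra_simps)
  finally show ?thesis .
qed

text \<open>The test function is t K(t)^2 / (t - x) with the reproducing kernel K at 0, nonnegative
  because solutions live on the half-line. The factor t makes the reproducing property return 0 for
  the term with the difference quotient of K, and the positive K(x) is divided out.\<close>

lemma solution_ineq_kernel:
  assumes tau: "\<tau> \<in> moment_solutions \<sigma> {0..}" and x: "x < 0" and n: "n > 0"
  shows "0 \<le> R.tC 0 x n + stieltjes_measure.res \<tau> x * R.tD 0 x n"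
proof -
  interpret t: stieltjes_measure \<tau> by (rule moment_solutions_stieltjes[OF tau])
  let ?K = "R.kernel 0 n" and ?X = "[:- 0, 1:] :: real poly"
  define Y where "Y = ?X * ?K"
  have "0 \<le> (\<integral>t. poly (?K * Y) t / (t - x) \<partial>\<tau>)"
  proof (rule integral_nonneg_AE)
    show "AE t in \<tau>. 0 \<le> poly (?K * Y) t / (t - x)" using t.AE_nonneg
    proof eventually_elim
      case (elim t)
      have "poly (?K * Y) t = t * (poly ?K t)\<^sup>2" by (simp add: Y_def power2_eq_square)
      thus ?case using elim x by simp
    qed
  qed
  also have "\<dots> = mean \<sigma> (synthetic_div ?K x * Y) + poly ?K x * (mean \<sigma> (synthetic_div Y x) + x * poly ?K x * t.res x)"
    unfolding t.resolvent_split[OF x] mean_unique[OF tau] R.synthetic_div_mult[of ?K Y]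
    by (simp add: mean_add mean_smult algebra_simps) (simp add: Y_def)
  also have "mean \<sigma> (synthetic_div ?K x * Y) = 0"
  proof (cases "n = 1")
    case True
    hence "degree ?K = 0" using R.degree_kernel[OF n, of 0] by simp
    hence "synthetic_div ?K x = 0" by (simp add: synthetic_div_eq_0_iff)
    thus ?thesis by (simp add: R.L_0)
  next
    case False
    have "degree (?X * synthetic_div ?K x) < n"
      using R.degree_kernel[OF n, of 0] False n
      by (intro le_less_trans[OF degree_mult_le]) (auto simp: degree_synthetic_div)
    hence "mean \<sigma> ((?X * synthetic_div ?K x) * ?K) = poly (?X * synthetic_div ?K x) 0"
      by (rule R.kernel_reproducing)
    thus ?thesis by (simp add: Y_def mult_ac)
  qed
  also have "mean \<sigma> (synthetic_div Y x) = R.tC 0 x n"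
  proof -
    have "mean \<sigma> ?K = 1" using R.kernel_reproducing[of 1 n 0] n by simp
    moreover have "mean \<sigma> (synthetic_div ?K x) = (\<Sum>k<n. poly (p k) 0 * R.Q k x)"
      unfolding R.kernel_def by (simp add: R.synthetic_div_sum R.synthetic_div_smult mean_sum mean_smult R.Q_def)
    ultimately show ?thesis unfolding Y_def R.synthetic_div_shift by (simp add: mean_add mean_smult R.tC_def)
  qed
  also have "x * poly ?K x * t.res x = t.res x * R.tD 0 x n" by (simp add: kernel_eq R.tD_def)
  finally show ?thesis using kernel_pos[OF n, of x] x by (simp add: zero_le_mult_iff)
qed

lemma transfer_of_real:
  "C.tA 0 (of_real x) n = of_real (R.tA 0 x n)" "C.tB 0 (of_real x) n = of_real (R.tB 0 x n)"
  "C.tC 0 (of_real x) n = of_real (R.tC 0 x n)" "C.tD 0 (of_real x) n = of_real (R.tD 0 x n)"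
  using CQ_of_real[of _ 0] orthoP_of_real[of _ 0] 
  by (simp_all add: R.tA_def R.tB_def R.tC_def R.tD_def C.tA_def C.tB_def C.tC_def C.tD_def CQ_of_real orthoP_of_real flip: orthoP_def)

definition rA :: "real \<Rightarrow> real" where "rA x = Re (nevA \<sigma> (of_real x))"
definition rB :: "real \<Rightarrow> real" where "rB x = Re (nevB \<sigma> (of_real x))"
definition rC :: "real \<Rightarrow> real" where "rC x = Re (nevC \<sigma> (of_real x))"
definition rD :: "real \<Rightarrow> real" where "rD x = Re (nevD \<sigma> (of_real x))"

lemma real_limitD:
  fixes f :: "nat \<Rightarrow> real"
  assumes "(\<lambda>n. complex_of_real (f n)) \<longlonglongrightarrow> l"
  shows "l = of_real (Re l)" "f \<longlonglongrightarrow> Re l"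
proof -
  have "(\<lambda>n. 0) \<longlonglongrightarrow> Im l" using tendsto_Im[OF assms] by simp
  thus "l = of_real (Re l)" by (simp add: LIMSEQ_const_iff complex_eq_iff)
  show "f \<longlonglongrightarrow> Re l" using tendsto_Re[OF assms] by simp
qed

lemma real_limits:
  "R.tA 0 x \<longlonglongrightarrow> rA x" "R.tB 0 x \<longlonglongrightarrow> rB x" "R.tC 0 x \<longlonglongrightarrow> rC x" "R.tD 0 x \<longlonglongrightarrow> rD x"
  "nevA \<sigma> (of_real x) = of_real (rA x)" "nevB \<sigma> (of_real x) = of_real (rB x)"
  "nevC \<sigma> (of_real x) = of_real (rC x)" "nevD \<sigma> (of_real x) = of_real (rD x)"
  using nev_limits[of "of_real x"] unfolding transfer_of_real[abs_def] rA_def rB_def rC_def rD_def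
  by (blast dest: real_limitD)+

lemma rD_neg: assumes "x < 0" shows "rD x < 0"
proof -
  have "R.tD 0 x n \<le> R.tD 0 x 1" if "n \<ge> 1" for n
  proof -
    have "(\<Sum>k<1. poly (p k) 0 * poly (p k) x) \<le> (\<Sum>k<n. poly (p k) 0 * poly (p k) x)"
      using that assms p_same_sign[of x] by (intro sum_mono2) (auto simp: less_imp_le)
    thus ?thesis using assms by (simp add: R.tD_def mult_left_mono_neg)
  qed
  hence "rD x \<le> R.tD 0 x 1" by (intro LIMSEQ_le_const2[OF real_limits(4)]) auto
  moreover have "R.tD 0 x 1 < 0" using assms p_same_sign[of x 0] by (simp add: R.tD_def mult_neg_pos)
  ultimately show ?thesis by simp
qed

lemma denominator_nonneg:
  assumes "\<tau> \<in> moment_solutions \<sigma> {0..}" "x < 0"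
  shows "0 \<le> rC x + stieltjes_measure.res \<tau> x * rD x"
proof (rule LIMSEQ_le_const)
  show "(\<lambda>n. R.tC 0 x n + stieltjes_measure.res \<tau> x * R.tD 0 x n) \<longlonglongrightarrow> rC x + stieltjes_measure.res \<tau> x * rD x"
    by (intro tendsto_intros real_limits)
  show "\<exists>N. \<forall>n\<ge>N. 0 \<le> R.tC 0 x n + stieltjes_measure.res \<tau> x * R.tD 0 x n"
    using solution_ineq_kernel[OF assms] by (intro exI[of _ 1]) auto
qed

definition ratio :: "nat \<Rightarrow> real" where "ratio n = R.Q n 0 / poly (p n) 0"

text \<open>The numerator of the difference is the positive Wronskian, while consecutive values
  P_n(0) have opposite signs.\<close>

lemma ratio_decreasing: "ratio (Suc n) < ratio n"
proof -
  have "poly (p (Suc n)) 0 * poly (p n) 0 < 0"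
    using mult_pos_pos[OF p_sign[of 0 n] p_sign[of 0 "Suc n"]] by (simp add: mult_ac power_mult_distrib[symmetric])
  moreover have "0 < R.Q (Suc n) 0 * poly (p n) 0 - poly (p (Suc n)) 0 * R.Q n 0"
    unfolding R.Wronskian using lead_coeff_p[of n] lead_coeff_p[of "Suc n"] by (simp add: degree_p)
  ultimately have "(R.Q (Suc n) 0 * poly (p n) 0 - poly (p (Suc n)) 0 * R.Q n 0) / (poly (p (Suc n)) 0 * poly (p n) 0) < 0"
    by (simp add: divide_pos_neg)
  moreover have "ratio (Suc n) - ratio n = (R.Q (Suc n) 0 * poly (p n) 0 - poly (p (Suc n)) 0 * R.Q n 0) / (poly (p (Suc n)) 0 * poly (p n) 0)"
    using p_nonzero[of 0 n] p_nonzero[of 0 "Suc n"] by (simp add: ratio_def field_simps)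
  ultimately show ?thesis by linarith
qed

lemma decseq_ratio: "decseq ratio"
  by (intro decseq_SucI less_imp_le ratio_decreasing)

text \<open>The left side of the difference is P_n(x) / P_n(0) by the transfer identity. In the sum
  x and \<open>ratio n - ratio k\<close> are both nonpositive, because \<open>ratio\<close>
  decreases.\<close>

lemma P_ratio_ge_1: assumes "x < 0" shows "1 \<le> ratio n * R.tD 0 x n - R.tB 0 x n"
proof -
  have "ratio n * R.tD 0 x n - R.tB 0 x n = 1 + (\<Sum>k<n. x * (ratio n - ratio k) * (poly (p k) 0 * poly (p k) x))"
  proof -
    have rk: "R.Q k 0 = ratio k * poly (p k) 0" for k using p_nonzero[of 0 k] by (simp add: ratio_def)
    show ?thesis by (simp add: R.tD_def R.tB_def rk sum_distrib_left sum_subtractf algebra_simps)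
  qed
  moreover have "0 \<le> x * (ratio n - ratio k) * (poly (p k) 0 * poly (p k) x)" if "k < n" for k
    using assms p_same_sign[of x k] decseqD[OF decseq_ratio, of k n] that
    by (intro mult_nonneg_nonneg[OF mult_nonpos_nonpos]) (auto simp: less_imp_le)
  ultimately show ?thesis by (auto intro!: sum_nonneg)
qed

text \<open>This is \<open>solution_ineq_P\<close> with P_n(0)^2 divided out: the factor P_n(x) /
  P_n(0) is positive by \<open>P_ratio_ge_1\<close>, so the other factor inherits the sign.\<close>

lemma solution_ineq_ratio:
  assumes tau: "\<tau> \<in> moment_solutions \<sigma> {0..}" and x: "x < 0"
  shows "0 \<le> ratio n * (R.tC 0 x n + stieltjes_measure.res \<tau> x * R.tD 0 x n)
     - (R.tA 0 x n + stieltjes_measure.res \<tau> x * R.tB 0 x n)"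
proof -
  let ?w = "stieltjes_measure.res \<tau> x" and ?p = "poly (p n) 0"
  let ?a = "ratio n * R.tD 0 x n - R.tB 0 x n"
  let ?b = "ratio n * (R.tC 0 x n + ?w * R.tD 0 x n) - (R.tA 0 x n + ?w * R.tB 0 x n)"
  have Q0: "R.Q n 0 = ratio n * ?p" using p_nonzero[of 0 n] by (simp add: ratio_def)
  have Px: "poly (p n) x = ?p * ?a" and Qx: "R.Q n x = ?p * (ratio n * R.tC 0 x n - R.tA 0 x n)"
    by (subst R.P_transfer[of n x 0], simp add: Q0 algebra_simps)
      (subst R.Q_transfer[of n x 0], simp add: Q0 algebra_simps)
  have "R.Q n x + ?w * poly (p n) x = ?p * ?b"
    unfolding Px Qx by (simp add: algebra_simps)
  with Px have "0 \<le> (?p * ?p) * (?a * ?b)" using solution_ineq_P[OF assms, of n] by (simp add: mult_ac)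
  moreover have "0 < ?p * ?p" using p_nonzero[of 0 n] by (auto simp: zero_less_mult_iff linorder_neq_iff)
  ultimately have "0 \<le> ?a * ?b" using mult_pos_neg[of "?p * ?p" "?a * ?b"] by (meson not_less)
  moreover have "0 < ?a" using P_ratio_ge_1[OF x, of n] by linarith
  ultimately show ?thesis using mult_pos_neg[of ?a ?b] by (meson not_less)
qed

text \<open>If the ratios tended to minus infinity, dividing \<open>solution_ineq_ratio\<close> by
  them would give C + w D \<le> 0 in the limit, hence equality by \<open>denominator_nonneg\<close>.
  Every solution would then have the resolvent - C / D at every x < 0, against
  indeterminacy.\<close>

lemma ratio_bounded_below: "\<exists>l. \<forall>n. l \<le> ratio n"
proof (rule ccontr)
  assume nb: "\<nexists>l. \<forall>n. l \<le> ratio n"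
  have lim: "filterlim ratio at_bot sequentially" unfolding filterlim_at_bot
  proof
    fix b
    obtain n where "ratio n < b" using nb by (meson not_le)
    hence "\<forall>m\<ge>n. ratio m \<le> b" using decseqD[OF decseq_ratio] by (meson less_imp_le order_trans)
    thus "\<forall>\<^sub>F n in sequentially. ratio n \<le> b" unfolding eventually_sequentially by blast
  qed
  have inv: "(\<lambda>n. inverse (ratio n)) \<longlonglongrightarrow> 0"
    using lim filterlim_at_bot_imp_at_infinity tendsto_inverse_0 filterlim_compose by blast
  have neg: "\<forall>\<^sub>F n in sequentially. ratio n < 0" using lim by (simp add: filterlim_at_bot_dense)
  have key: "stieltjes_measure.res \<tau> x = - rC x / rD x" if tau: "\<tau> \<in> moment_solutions \<sigma> {0..}" and x: "x < 0" for \<tau> x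
  proof -
    let ?w = "stieltjes_measure.res \<tau> x"
    let ?u = "\<lambda>n. R.tC 0 x n + ?w * R.tD 0 x n" and ?v = "\<lambda>n. R.tA 0 x n + ?w * R.tB 0 x n"
    have "(\<lambda>n. ?u n - inverse (ratio n) * ?v n) \<longlonglongrightarrow> (rC x + ?w * rD x) - 0 * (rA x + ?w * rB x)"
      by (intro tendsto_intros real_limits inv)
    moreover have "\<forall>\<^sub>F n in sequentially. ?u n - inverse (ratio n) * ?v n \<le> 0" using neg
    proof eventually_elim
      case (elim n)
      have "?u n - inverse (ratio n) * ?v n = inverse (ratio n) * (ratio n * ?u n - ?v n)" using elim by (simp add: field_simps)
      also have "\<dots> \<le> 0" using elim solution_ineq_ratio[OF tau x, of n] by (intro mult_nonpos_nonneg) auto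
      finally show ?case .
    qed
    ultimately have "rC x + ?w * rD x \<le> 0" using tendsto_upperbound by fastforce
    hence "rC x + ?w * rD x = 0" using denominator_nonneg[OF that] by simp
    thus ?thesis using rD_neg[OF x] by (simp add: field_simps add_eq_0_iff)
  qed
  show False using other_solution key[OF self_solution] key by metis
qed

text \<open>The operator \<open>lim\<close> is meaningful only for convergent sequences;
  monotonicity and the lower bound supply the convergence.\<close>

lemma ratio_limit: "ratio \<longlonglongrightarrow> - nev_d0 \<sigma>"
proof -
  obtain l where "\<forall>n. l \<le> ratio n" using ratio_bounded_below by blast
  then obtain L where "ratio \<longlonglongrightarrow> L" using decseq_convergent[OF decseq_ratio] by blast
  moreover have "Re (orthoQ \<sigma> k 0 / orthoP \<sigma> k 0) = ratio k" for k
    using CQ_of_real[of k 0] orthoP_of_real[of k 0] by (simp add: orthoQ_eq ratio_def Re_divide_of_real)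
  ultimately show ?thesis unfolding nev_d0_def by (simp add: limI)
qed

lemma solution_ineq_d0:
  assumes tau: "\<tau> \<in> moment_solutions \<sigma> {0..}" and x: "x < 0"
  defines "w \<equiv> stieltjes_measure.res \<tau> x"
  shows "nev_d0 \<sigma> * (rC x + w * rD x) \<le> - (rA x + w * rB x)"
proof -
  have "0 \<le> - nev_d0 \<sigma> * (rC x + w * rD x) - (rA x + w * rB x)"
  proof (rule LIMSEQ_le_const)
    show "(\<lambda>n. ratio n * (R.tC 0 x n + w * R.tD 0 x n) - (R.tA 0 x n + w * R.tB 0 x n)) \<longlonglongrightarrow>
       - nev_d0 \<sigma> * (rC x + w * rD x) - (rA x + w * rB x)"
      by (intro tendsto_intros real_limits ratio_limit)
  qed (use solution_ineq_ratio[OF tau x] in \<open>auto simp: w_def\<close>)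
  thus ?thesis by simp
qed

section \<open>Conjugation symmetry and the fraction for a given solution\<close>

lemma cP_cnj: "cP k (cnj z) = cnj (cP k z)"
  by (subst poly_cnj_real) (auto simp: orthoP_poly_def coeff_map_poly)

lemma CQ_cnj: "C.Q n (cnj z) = cnj (C.Q n z)"
proof (induction n rule: less_induct)
  case (less n)
  have real: "cnj (cP k 0) = cP k 0" "cnj (C.Q k 0) = C.Q k 0" for k
    using orthoP_of_real[of k 0] CQ_of_real[of k 0] by (simp_all add: orthoP_def)
  show ?case by (subst (1 2) C.Q_shift[of n _ 0]) (simp add: real less)
qed

lemma nev_cnj:
  "nevA \<sigma> (cnj z) = cnj (nevA \<sigma> z)" "nevB \<sigma> (cnj z) = cnj (nevB \<sigma> z)"
  "nevC \<sigma> (cnj z) = cnj (nevC \<sigma> z)" "nevD \<sigma> (cnj z) = cnj (nevD \<sigma> z)"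
proof -
  have real: "cnj (cP k 0) = cP k 0" "cnj (C.Q k 0) = C.Q k 0" for k
    using orthoP_of_real[of k 0] CQ_of_real[of k 0] by (simp_all add: orthoP_def)
  have e: "C.tA 0 (cnj z) n = cnj (C.tA 0 z n)" "C.tB 0 (cnj z) n = cnj (C.tB 0 z n)"
    "C.tC 0 (cnj z) n = cnj (C.tC 0 z n)" "C.tD 0 (cnj z) n = cnj (C.tD 0 z n)" for n
    by (simp_all add: C.tA_def C.tB_def C.tC_def C.tD_def real CQ_cnj cP_cnj)
  show "nevA \<sigma> (cnj z) = cnj (nevA \<sigma> z)" "nevB \<sigma> (cnj z) = cnj (nevB \<sigma> z)"
    "nevC \<sigma> (cnj z) = cnj (nevC \<sigma> z)" "nevD \<sigma> (cnj z) = cnj (nevD \<sigma> z)"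
    using nev_limits[of "cnj z", unfolded e[abs_def]] nev_limits[of z]
    by (blast intro: LIMSEQ_unique tendsto_cnj)+
qed

text \<open>Solving the fraction for \<Psi> gives - v / u with u = C + w D and v = A + w B, where w
  is the resolvent of \<tau>. The determinant relation becomes v D - u B = 1, so u and v have no
  common zero. What remains is that u vanishes identically, giving the constant \<infinity>, or
  nowhere.\<close>

theorem nevanlinna_parametrization:
  assumes tau: "\<tau> \<in> moment_solutions \<sigma> {0..}"
  obtains \<Psi> where "nevanlinna \<Psi>" "analytic_off_nonneg_ge (nev_d0 \<sigma>) \<Psi>"
    "\<And>z. z \<in> - \<real>\<^sub>\<ge>\<^sub>0 \<Longrightarrow> (\<integral>t. 1 / (complex_of_real t - z) \<partial>\<tau>) = nevanlinna_fraction \<sigma> \<Psi> z"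
proof -
  interpret t: stieltjes_measure \<tau> by (rule moment_solutions_stieltjes[OF tau])
  let ?S = "- \<real>\<^sub>\<ge>\<^sub>0 :: complex set"
  note S = slit_plane_open_connected
  define u where "u z = nevC \<sigma> z + t.cres z * nevD \<sigma> z" for z
  define v where "v z = nevA \<sigma> z + t.cres z * nevB \<sigma> z" for z
  have hol: "u holomorphic_on ?S" "v holomorphic_on ?S"
    unfolding u_def[abs_def] v_def[abs_def]
    by (intro holomorphic_intros nev_holomorphic stieltjes_cres_holomorphic t.stieltjes_measure_axioms)+
  have vu: "v z * nevD \<sigma> z - u z * nevB \<sigma> z = 1" for z
    using nev_det[of z] by (simp add: u_def v_def algebra_simps)
  have uv0: "v z \<noteq> 0" if "u z = 0" for z using vu[of z] that by auto
  have fr: "t.cres z * (v z * nevD \<sigma> z - u z * nevB \<sigma> z) = u z * nevA \<sigma> z - v z * nevC \<sigma> z" for z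
  proof -
    have "u z * nevA \<sigma> z - v z * nevC \<sigma> z = t.cres z * (nevA \<sigma> z * nevD \<sigma> z - nevB \<sigma> z * nevC \<sigma> z)"
      by (simp add: u_def v_def algebra_simps)
    thus ?thesis unfolding vu nev_det by simp
  qed
  have cnj: "u (cnj z) = cnj (u z)" "v (cnj z) = cnj (v z)" for z
    by (simp_all add: u_def v_def nev_cnj t.cres_cnj)
  have real: "u (of_real x) = of_real (rC x + t.res x * rD x)" "v (of_real x) = of_real (rA x + t.res x * rB x)" if "x < 0" for x
    using that by (simp_all add: u_def v_def real_limits t.cres_of_real)
  have Im: "Im (u z * cnj (v z)) \<ge> 0" if "Im z > 0" for z
  proof -
    have "Im (u z * cnj (v z)) = - Im (v z * cnj (u z))"
      by (metis complex_cnj_cnj complex_cnj_mult cnj.simps(2) mult.commute)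
    thus ?thesis using Im_fraction_nonpos[OF tau that] by (simp add: u_def v_def)
  qed
  have Imdiv: "Im (u z / v z) \<ge> 0" if "Im z > 0" for z
    using Im[OF that] by (simp add: complex_div_cnj[of "u z"] Im_divide_of_real flip: of_real_power)
  show ?thesis
  proof (cases "\<forall>z\<in>?S. u z = 0")
    case True
    have "t.cres z = nevanlinna_fraction \<sigma> None z" if "z \<in> ?S" for z
    proof -
      have "nevD \<sigma> z \<noteq> 0" using vu[of z] True that by auto
      moreover have "nevC \<sigma> z + t.cres z * nevD \<sigma> z = 0" using True that by (simp add: u_def)
      ultimately show ?thesis by (simp add: nevanlinna_fraction_def field_simps add_eq_0_iff)
    qed
    thus ?thesis using that[of None] by (auto simp: nevanlinna_def analytic_off_nonneg_ge_def t.cres_def)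
  next
    case False
    have zero_ball: "\<forall>z\<in>?S. u z = 0" if "open N" "z0 \<in> N" "N \<subseteq> ?S" "\<And>z. z \<in> N \<Longrightarrow> u z = 0" for N z0
    proof
      fix z assume "z \<in> ?S"
      show "u z = 0"
        using analytic_continuation_open[OF that(1) S(1) _ S(2) that(3) hol(1), of "\<lambda>_. 0" z] that \<open>z \<in> ?S\<close> by auto
    qed
    have nbhd: "\<exists>r>0. ball z0 r \<subseteq> ?S \<and> (\<forall>z\<in>ball z0 r. cmod (v z - v z0) < cmod (v z0))"
      if n: "z0 \<in> ?S" "v z0 \<noteq> 0" for z0
    proof -
      have "continuous_on ?S v" using hol(2) by (rule holomorphic_on_imp_continuous_on)
      hence "isCont v z0" using S(1) n(1) by (simp add: continuous_on_eq_continuous_at)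
      then obtain d where d: "d > 0" "\<And>z. dist z z0 < d \<Longrightarrow> dist (v z) (v z0) < cmod (v z0)"
        using n(2) unfolding continuous_at_eps_delta by (meson zero_less_norm_iff)
      obtain e where e: "e > 0" "ball z0 e \<subseteq> ?S" using S(1) n(1) open_contains_ball by blast
      show ?thesis using d e by (intro exI[of _ "min d e"]) (auto simp: dist_norm norm_minus_commute subset_iff)
    qed
    have vnz: "v z \<noteq> 0" if "cmod (v z - v z0) < cmod (v z0)" for z z0 using that by auto
    \<comment> \<open>A constant u / v near a zero of u is 0, and then u vanishes on the whole slit
      plane by continuation.\<close>
    have const: "\<forall>z\<in>?S. u z = 0" if "ball z0 r \<subseteq> ?S" "r > 0" "\<And>z. z \<in> ball z0 r \<Longrightarrow> v z \<noteq> 0"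
      "(\<lambda>z. u z / v z) constant_on ball z0 r" "u z0 = 0" for z0 r
    proof (rule zero_ball[of "ball z0 r" z0])
      fix z assume "z \<in> ball z0 r"
      moreover have "z0 \<in> ball z0 r" using that(2) by simp
      ultimately have "u z / v z = u z0 / v z0" using that(4) unfolding constant_on_def by metis
      thus "u z = 0" using that(3)[OF \<open>z \<in> ball z0 r\<close>] that(5) by simp
    qed (use that in auto)
    \<comment> \<open>In the upper half-plane u / v has nonnegative imaginary part, and at a zero of
      u it is real, so the open mapping theorem makes it constant.\<close>
    have upper: "u z0 \<noteq> 0" if "Im z0 > 0" for z0
    proof
      assume 0: "u z0 = 0"
      have z0: "z0 \<in> ?S" using that Im_pos_not_nonneg by blast
      obtain r where r: "r > 0" "ball z0 r \<subseteq> ?S" "\<forall>z\<in>ball z0 r. cmod (v z - v z0) < cmod (v z0)"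
        using nbhd[OF z0 uv0[OF 0]] by blast
      define B where "B = ball z0 (min r (Im z0))"
      have B: "B \<subseteq> ball z0 r" by (auto simp: B_def)
      have BIm: "Im z > 0" if "z \<in> B" for z
        using that abs_Im_le_cmod[of "z0 - z"] by (auto simp: B_def dist_norm)
      have "(\<lambda>z. u z / v z) holomorphic_on B"
        by (intro holomorphic_intros holomorphic_on_subset[OF hol(1)] holomorphic_on_subset[OF hol(2)]) (use B r vnz in blast)+
      moreover have "z0 \<in> B" using r(1) that by (simp add: B_def)
      ultimately have "(\<lambda>z. u z / v z) constant_on B"
        using BIm Imdiv 0 by (intro holomorphic_Im_nonneg_constant[where z=z0]) (auto simp: B_def)
      hence "\<forall>z\<in>?S. u z = 0" using const[of z0 "min r (Im z0)"] B r vnz that 0 unfolding B_def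
        by (metis (no_types, lifting) min_less_iff_conj subsetD subsetI)
      thus False using False by blast
    qed
    have lower: "u z0 \<noteq> 0" if "Im z0 < 0" for z0
      using upper[of "cnj z0"] that by (simp add: cnj)
    \<comment> \<open>On the axis u / v takes both signs of the imaginary part nearby, so the
      half-plane argument does not apply directly. As an open map, u / v would attain a small real
      value of a prescribed sign, at a real point, and make u negative there, against
      \<open>denominator_nonneg\<close>.\<close>
    have negative: "u (of_real x) \<noteq> 0" if x: "x < 0" for x
    proof
      assume 0: "u (of_real x) = 0"
      let ?x = "complex_of_real x"
      have z0: "?x \<in> ?S" using x by simp
      obtain r where r: "r > 0" "ball ?x r \<subseteq> ?S" "\<forall>z\<in>ball ?x r. cmod (v z - v ?x) < cmod (v ?x)"
        using nbhd[OF z0 uv0[OF 0]] by blast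
      have vN: "v z \<noteq> 0" if "z \<in> ball ?x r" for z using r(3) vnz that by blast
      define g where "g z = u z / v z" for z
      have ghol: "g holomorphic_on ball ?x r" unfolding g_def[abs_def]
        by (intro holomorphic_intros holomorphic_on_subset[OF hol(1)] holomorphic_on_subset[OF hol(2)]) (use r vN in auto)
      have "\<not> g constant_on ball ?x r"
        using const[OF r(2,1) vN _ 0] False unfolding g_def[abs_def] by blast
      hence "open (g ` ball ?x r)" using open_mapping_thm[OF ghol _ _ open_ball] by simp
      moreover have "0 \<in> g ` ball ?x r" using 0 r(1) by (auto simp: g_def image_iff intro!: bexI[of _ ?x])
      ultimately obtain e where e: "e > 0" "ball 0 e \<subseteq> g ` ball ?x r" using open_contains_ball by blast
      \<comment> \<open>The sign of v at x, and by the choice of r also at real points of the ball;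
        it tells which small value of u / v makes u negative.\<close>
      define s where "s = sgn (rA x + t.res x * rB x)"
      have vx: "v ?x = of_real (rA x + t.res x * rB x)" using real(2)[OF x] .
      have vne: "rA x + t.res x * rB x \<noteq> 0" using uv0[OF 0] vx by (metis of_real_0)
      have s: "s * s = 1" "s * (rA x + t.res x * rB x) = \<bar>rA x + t.res x * rB x\<bar>"
        using vne unfolding s_def by (auto simp: sgn_if)
      have "of_real (- s * (e / 2)) \<in> ball (0 :: complex) e"
        using e(1) s(1) by (auto simp: norm_mult abs_mult s_def sgn_if)
      then obtain z where z: "z \<in> ball ?x r" "g z = of_real (- s * (e / 2))" using e(2) by (metis (no_types, lifting) imageE subsetD)
      \<comment> \<open>A real value of g above the axis forces g to be constant, near y and then on
        the whole ball. By conjugation the same holds below the axis, so the preimage z is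
        real.\<close>
      have upper': False if y: "y \<in> ball ?x r" "g y = of_real (- s * (e / 2))" "Im y > 0" for y
      proof -
        obtain d where d: "d > 0" "ball y d \<subseteq> ball ?x r" using y(1) open_contains_ball[THEN iffD1, OF open_ball, of ?x r] by blast
        define B where "B = ball y (min d (Im y))"
        have B: "B \<subseteq> ball ?x r" using d(2) by (auto simp: B_def)
        have BIm: "Im z > 0" if "z \<in> B" for z
          using that abs_Im_le_cmod[of "y - z"] by (auto simp: B_def dist_norm)
        have "g constant_on B"
          by (rule holomorphic_Im_nonneg_constant[where z=y, OF holomorphic_on_subset[OF ghol B]])
            (use BIm Imdiv y d in \<open>auto simp: B_def g_def\<close>)
        hence const_B: "g z = g y" if "z \<in> B" for z
          using that y d unfolding constant_on_def by (metis B_def centre_in_ball min_less_iff_conj)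
        have "g z = g y" if "z \<in> ball ?x r" for z
          using analytic_continuation_open[of B "ball ?x r" g "\<lambda>_. g y" z] B const_B ghol that y d
          by (auto simp: B_def)
        hence "g constant_on ball ?x r" unfolding constant_on_def by blast
        thus False using \<open>\<not> g constant_on ball ?x r\<close> by blast
      qed
      have "Im z \<le> 0" using upper'[OF z] by force
      moreover have "Im z \<ge> 0"
      proof (rule ccontr)
        assume "\<not> ?thesis"
        moreover have "cnj z \<in> ball ?x r"
        proof -
          have "cmod (?x - cnj z) = cmod (cnj (?x - z))" by simp
          also have "\<dots> = cmod (?x - z)" by (rule complex_mod_cnj)
          finally show ?thesis using z(1) by (simp add: dist_norm)
        qed
        moreover have "g (cnj z) = of_real (- s * (e / 2))" using z(2) unfolding g_def cnj
          by (metis complex_cnj_complex_of_real complex_cnj_divide)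
        ultimately show False using upper'[of "cnj z"] by simp
      qed
      ultimately have zr: "z = of_real (Re z)" by (simp add: complex_eq_iff)
      define y where "y = Re z"
      have y: "y < 0" using z(1) r(2) zr unfolding y_def
        by (metis ComplD Re_complex_of_real not_le_imp_less nonneg_Reals_of_real_iff subsetD)
      define vy where "vy = rA y + t.res y * rB y"
      have vy: "v z = of_real vy" using real(2)[OF y] zr by (simp add: y_def vy_def)
      have "\<bar>vy - (rA x + t.res x * rB x)\<bar> < \<bar>rA x + t.res x * rB x\<bar>"
        using r(3)[rule_format, OF z(1)] unfolding vy vx of_real_diff[symmetric] norm_of_real .
      moreover have "sgn R * vy > 0" if "\<bar>vy - R\<bar> < \<bar>R\<bar>" for R
        using that by (auto simp: sgn_if abs_if split: if_splits)
      ultimately have "s * vy > 0" unfolding s_def by blast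
      have "complex_of_real ((rC y + t.res y * rD y) / vy) = of_real (- s * (e / 2))"
        using z(2) real(1)[OF y] zr unfolding g_def vy by (simp add: y_def)
      hence "(rC y + t.res y * rD y) / vy = - s * (e / 2)" by (simp only: of_real_eq_iff)
      hence "rC y + t.res y * rD y = - ((e / 2) * (s * vy))"
        using \<open>s * vy > 0\<close> by (cases "vy = 0") (simp_all add: field_simps)
      moreover have "(e / 2) * (s * vy) > 0" by (rule mult_pos_pos[OF half_gt_zero[OF e(1)] \<open>s * vy > 0\<close>])
      ultimately show False using denominator_nonneg[OF tau y] by linarith
    qed
    have unz: "u z \<noteq> 0" if "z \<in> ?S" for z
    proof (cases "Im z" "0 :: real" rule: linorder_cases)
      case equal
      hence z: "z = of_real (Re z)" by (simp add: complex_eq_iff)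
      have "Re z < 0" using that equal by (auto simp: complex_nonneg_Reals_iff)
      thus ?thesis using negative z by metis
    qed (use upper lower in auto)
    define \<psi> where "\<psi> z = - v z / u z" for z
    have 1: "nevanlinna (Some \<psi>)" unfolding nevanlinna_def option.case
    proof (intro conjI allI impI)
      show "\<psi> holomorphic_on {z. 0 < Im z}" unfolding \<psi>_def[abs_def]
        by (intro holomorphic_intros holomorphic_on_subset[OF hol(1)] holomorphic_on_subset[OF hol(2)])
          (use unz Im_pos_not_nonneg in auto)
      fix z :: complex assume "0 < Im z"
      have "Im (\<psi> z) = Im (u z * cnj (v z)) / (cmod (u z))\<^sup>2"
        unfolding \<psi>_def complex_div_cnj[of "- v z" "u z"]
        by (simp add: Im_divide_of_real minus_divide_left algebra_simps del: divide_minus_left flip: of_real_power)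
      thus "0 \<le> Im (\<psi> z)" using Im[OF \<open>0 < Im z\<close>] by simp
    qed
    have 2: "analytic_off_nonneg_ge (nev_d0 \<sigma>) (Some \<psi>)" unfolding analytic_off_nonneg_ge_def option.case
    proof (intro conjI allI impI)
      show "\<psi> holomorphic_on ?S" unfolding \<psi>_def[abs_def]
        by (intro holomorphic_intros hol) (use unz in auto)
      fix x :: real assume x: "x < 0"
      have e: "\<psi> (of_real x) = of_real (- (rA x + t.res x * rB x) / (rC x + t.res x * rD x))"
        unfolding \<psi>_def real[OF x] by simp
      show "\<psi> (of_real x) \<in> \<real>" unfolding e by (rule Reals_of_real)
      have "rC x + t.res x * rD x > 0"
        using denominator_nonneg[OF tau x] negative[OF x] real(1)[OF x] by (metis less_le of_real_0)
      thus "nev_d0 \<sigma> \<le> Re (\<psi> (of_real x))" unfolding e Re_complex_of_real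
        using solution_ineq_d0[OF tau x] by (simp add: pos_le_divide_eq)
    qed
    have 3: "t.cres z = nevanlinna_fraction \<sigma> (Some \<psi>) z" if "z \<in> ?S" for z
    proof -
      have u: "u z \<noteq> 0" by (rule unz[OF that])
      have a: "nevC \<sigma> z * \<psi> z + nevA \<sigma> z = t.cres z / u z"
        using fr[of z] u unfolding vu \<psi>_def by (simp add: field_simps)
      have b: "nevD \<sigma> z * \<psi> z + nevB \<sigma> z = - (1 / u z)"
        using vu[of z] u unfolding \<psi>_def by (simp add: field_simps)
      show ?thesis unfolding nevanlinna_fraction_def option.case a b using u by simp
    qed
    show ?thesis by (rule that[of "Some \<psi>"]) (use 1 2 3 in \<open>auto simp: t.cres_def\<close>)
  qed
qed

end

section \<open>Weak compactness on the simplex\<close>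

text \<open>The auxiliary function of Schoenberg's curve, of period 2, equal to 0 on [0, 1/3] and to
  1 on [2/3, 1]. The truncated cosine is continuous and periodic at once, and it is cut off where
  cos (pi x) is 1/2 and -1/2.\<close>

definition schoenberg_step :: "real \<Rightarrow> real" where
  "schoenberg_step x = max 0 (min 1 (1 / 2 - cos (pi * x)))"

lemma schoenberg_step_bounds: "0 \<le> schoenberg_step x" "schoenberg_step x \<le> 1"
  by (auto simp: schoenberg_step_def)

lemma schoenberg_step_periodic: "schoenberg_step (2 * of_nat n + x) = schoenberg_step x"
proof -
  have "pi * (2 * of_nat n + x) = pi * x + 2 * of_nat n * pi" by (simp add: algebra_simps)
  hence "cos (pi * (2 * of_nat n + x)) = cos (pi * x)" by (simp only: cos_add cos_2npi sin_2npi)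
  thus ?thesis by (simp only: schoenberg_step_def)
qed

lemma schoenberg_step_low: assumes "0 \<le> x" "x \<le> 1 / 3" shows "schoenberg_step x = 0"
proof -
  have "cos (pi / 3) \<le> cos (pi * x)" using assms by (intro cos_monotone_0_pi_le) auto
  thus ?thesis by (simp add: schoenberg_step_def cos_60)
qed

lemma schoenberg_step_high: assumes "2 / 3 \<le> x" "x \<le> 1" shows "schoenberg_step x = 1"
proof -
  have "cos (pi * x) \<le> cos (pi * (2 / 3))" using assms by (intro cos_monotone_0_pi_le) auto
  moreover have "cos (pi * (2 / 3)) = - (1 / 2)" using cos_120 by (simp add: field_simps)
  ultimately show ?thesis by (simp add: schoenberg_step_def)
qed

text \<open>For digits 0 and 1 a point of the Cantor set. Multiplication by 3^m brings digit m to
  the front up to an even integer, which the period of \<open>schoenberg_step\<close> absorbs, and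
  the step function reads that digit.\<close>

definition ternary :: "(nat \<Rightarrow> nat) \<Rightarrow> real" where "ternary e = (\<Sum>n. 2 * real (e n) / 3 ^ Suc n)"

lemma
  assumes e: "\<And>n. e n \<le> 1"
  shows ternary_bounds: "0 \<le> ternary e" "ternary e \<le> 1"
    and ternary_shift: "3 * ternary e = 2 * real (e 0) + ternary (\<lambda>n. e (Suc n))"
proof -
  have g: "(\<lambda>n. 2 / 3 * (1 / 3) ^ n :: real) sums 1"
    using sums_mult[OF geometric_sums[of "1 / 3 :: real"], of "2 / 3"] by simp
  have le: "2 * real (e n) / 3 ^ Suc n \<le> 2 / 3 * (1 / 3) ^ n" if "\<And>n. e n \<le> 1" for e :: "nat \<Rightarrow> nat" and n
    using that[of n] by (simp add: field_simps power_divide)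
  have sm: "summable (\<lambda>n. 2 * real (e n) / 3 ^ Suc n)" if "\<And>n. e n \<le> 1" for e :: "nat \<Rightarrow> nat"
    by (rule summable_comparison_test'[OF sums_summable[OF g]]) (use le[of e] that in simp)
  have s: "summable (\<lambda>n. 2 * real (e n) / 3 ^ Suc n)" by (rule sm[OF e])
  show "0 \<le> ternary e" unfolding ternary_def by (rule suminf_nonneg[OF s]) simp
  have "ternary e \<le> (\<Sum>n. 2 / 3 * (1 / 3) ^ n)" unfolding ternary_def
    by (rule suminf_le[OF _ s sums_summable[OF g]]) (rule le[OF e])
  thus "ternary e \<le> 1" by (simp only: sums_unique[OF g, symmetric])
  have "ternary e = (\<Sum>n. 2 * real (e (Suc n)) / 3 ^ Suc (Suc n)) + 2 * real (e 0) / 3"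
    unfolding ternary_def using suminf_split_head[OF s] by simp
  also have "(\<Sum>n. 2 * real (e (Suc n)) / 3 ^ Suc (Suc n)) = ternary (\<lambda>n. e (Suc n)) / 3"
    unfolding ternary_def using suminf_divide[OF sm[of "\<lambda>n. e (Suc n)"], of 3] e by (simp add: field_simps)
  finally show "3 * ternary e = 2 * real (e 0) + ternary (\<lambda>n. e (Suc n))" by simp
qed

lemma schoenberg_step_ternary:
  assumes "\<And>n. e n \<le> 1" shows "schoenberg_step (3 ^ m * ternary e) = real (e m)"
  using assms
proof (induction m arbitrary: e)
  case 0
  let ?t = "ternary (\<lambda>n. e (Suc n))"
  have t: "0 \<le> ?t" "?t \<le> 1" using ternary_bounds[of "\<lambda>n. e (Suc n)"] 0 by auto
  have "3 * ternary e = 2 * real (e 0) + ?t" using ternary_shift 0 by blast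
  moreover have "e 0 = 0 \<or> e 0 = 1" using 0[of 0] by linarith
  ultimately show ?case using t schoenberg_step_low[of "ternary e"] schoenberg_step_high[of "ternary e"] by auto
next
  case (Suc m)
  have "3 ^ Suc m * ternary e = 3 ^ m * (3 * ternary e)" by simp
  also have "\<dots> = 2 * of_nat (3 ^ m * e 0) + 3 ^ m * ternary (\<lambda>n. e (Suc n))"
    by (subst ternary_shift[OF Suc.prems]) (simp add: algebra_simps)
  finally show ?case using Suc.IH[of "\<lambda>n. e (Suc n)"] Suc.prems by (simp only: schoenberg_step_periodic)
qed

lemma binary_expansion:
  assumes "0 \<le> x" "x < 1"
  obtains a :: "nat \<Rightarrow> nat" where "\<And>n. a n \<le> 1" "(\<lambda>k. real (a k) / 2 ^ Suc k) sums x"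
proof -
  define a where "a k = nat (\<lfloor>2 ^ Suc k * x\<rfloor> - 2 * \<lfloor>2 ^ k * x\<rfloor>)" for k
  have d: "0 \<le> \<lfloor>2 ^ Suc k * x\<rfloor> - 2 * \<lfloor>2 ^ k * x\<rfloor> \<and> \<lfloor>2 ^ Suc k * x\<rfloor> - 2 * \<lfloor>2 ^ k * x\<rfloor> \<le> 1" for k
    by (simp add: mult.assoc) linarith
  have "(\<Sum>k<n. real (a k) / 2 ^ Suc k) = real_of_int \<lfloor>2 ^ n * x\<rfloor> / 2 ^ n" for n
  proof (induction n)
    case 0 thus ?case using assms by (simp add: floor_eq_iff)
  next
    case (Suc n)
    have "real (a n) = real_of_int \<lfloor>2 ^ Suc n * x\<rfloor> - 2 * real_of_int \<lfloor>2 ^ n * x\<rfloor>"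
      using d[of n] by (simp add: a_def)
    thus ?case using Suc by (simp add: field_simps)
  qed
  moreover have "(\<lambda>n. real_of_int \<lfloor>2 ^ n * x\<rfloor> / 2 ^ n) \<longlonglongrightarrow> x"
  proof (rule real_tendsto_sandwich)
    show "\<forall>\<^sub>F n in sequentially. x - (1 / 2) ^ n \<le> real_of_int \<lfloor>2 ^ n * x\<rfloor> / 2 ^ n"
    proof (intro always_eventually allI)
      fix n
      have "2 ^ n * x - 1 \<le> real_of_int \<lfloor>2 ^ n * x\<rfloor>" by linarith
      hence "(2 ^ n * x - 1) / 2 ^ n \<le> real_of_int \<lfloor>2 ^ n * x\<rfloor> / 2 ^ n" by (intro divide_right_mono) auto
      thus "x - (1 / 2) ^ n \<le> real_of_int \<lfloor>2 ^ n * x\<rfloor> / 2 ^ n" by (simp add: field_simps power_divide)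
    qed
    show "\<forall>\<^sub>F n in sequentially. real_of_int \<lfloor>2 ^ n * x\<rfloor> / 2 ^ n \<le> x"
      by (intro always_eventually allI) (simp add: field_simps)
    show "(\<lambda>n. x - (1 / 2) ^ n) \<longlonglongrightarrow> x" by (auto intro!: tendsto_eq_intros LIMSEQ_power_zero)
  qed auto
  ultimately have "(\<lambda>k. real (a k) / 2 ^ Suc k) sums x" unfolding sums_def by simp
  moreover have "a n \<le> 1" for n using d[of n] unfolding a_def by linarith
  ultimately show ?thesis using that by blast
qed

text \<open>Schoenberg's space-filling curve. It transfers Helly's selection theorem from the line to a
  cube.\<close>

lemma space_filling_curve:
  obtains \<phi> :: "real \<Rightarrow> 'a::euclidean_space" where "continuous_on UNIV \<phi>"
    "bounded (range \<phi>)" "\<And>y. (\<And>b. b \<in> Basis \<Longrightarrow> 0 \<le> y \<bullet> b \<and> y \<bullet> b \<le> 1) \<Longrightarrow> \<exists>t\<in>{0..1}. \<phi> t = y"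
proof -
  define d where "d = DIM('a)"
  have d: "d > 0" by (simp add: d_def)
  obtain \<iota> where \<iota>: "bij_betw \<iota> (Basis :: 'a set) {0..<d}"
    using ex_bij_betw_finite_nat[OF finite_Basis] unfolding d_def by blast
  have \<iota>d: "\<iota> b < d" if "b \<in> Basis" for b using \<iota> that by (auto simp: bij_betw_def)
  define c where "c b t = (\<Sum>k. (1 / 2) ^ Suc k * schoenberg_step (3 ^ (d * k + \<iota> b) * t))" for b t
  have trm: "norm ((1 / 2) ^ Suc k * schoenberg_step x) \<le> (1 / 2) ^ Suc k" for k x
    using schoenberg_step_bounds[of x] by (simp add: mult_left_le)
  have geo: "summable (\<lambda>k. (1 / 2 :: real) ^ Suc k)" by (simp add: summable_geometric)
  have sm: "summable (\<lambda>k. (1 / 2) ^ Suc k * schoenberg_step (3 ^ (d * k + \<iota> b) * t))" for b t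
    by (rule summable_comparison_test'[OF geo trm])
  have cont: "continuous_on UNIV (c b)" for b
  proof -
    have "uniform_limit UNIV (\<lambda>n t. \<Sum>k<n. (1 / 2) ^ Suc k * schoenberg_step (3 ^ (d * k + \<iota> b) * t)) (c b) sequentially"
      unfolding c_def[abs_def] by (rule Weierstrass_m_test[OF trm geo])
    thus ?thesis
      by (rule uniform_limit_theorem[rotated])
        (auto simp: schoenberg_step_def intro!: always_eventually continuous_intros)
  qed
  have cb: "\<bar>c b t\<bar> \<le> 1" for b t
  proof -
    have "\<bar>c b t\<bar> \<le> (\<Sum>k. (1 / 2 :: real) ^ Suc k)" unfolding c_def
      by (rule norm_suminf_le[OF trm geo, unfolded real_norm_def])
    also have "\<dots> = 1" using suminf_split_head[of "\<lambda>k. (1 / 2 :: real) ^ k"] by (simp add: suminf_geometric summable_geometric)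
    finally show ?thesis .
  qed
  \<comment> \<open>The factor 2 undoes the halving of y \<bullet> b below, which brings coordinates
    in [0, 1], including 1, into the half-open range of \<open>binary_expansion\<close>.\<close>
  define \<phi> where "\<phi> t = (\<Sum>b\<in>Basis. (2 * c b t) *\<^sub>R b)" for t
  show ?thesis
  proof (rule that)
    show "continuous_on UNIV \<phi>" unfolding \<phi>_def[abs_def] by (intro continuous_intros cont)
    show "bounded (range \<phi>)" unfolding bounded_iff
    proof (intro exI ballI)
      fix x assume "x \<in> range \<phi>"
      then obtain t where x: "x = \<phi> t" by blast
      have "norm (\<phi> t) \<le> (\<Sum>b\<in>Basis. norm ((2 * c b t) *\<^sub>R b))" unfolding \<phi>_def by (rule norm_sum)
      also have "\<dots> \<le> (\<Sum>b\<in>(Basis :: 'a set). 2)" 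
      proof (rule sum_mono)
        show "norm ((2 * c b t) *\<^sub>R b) \<le> 2" if "b \<in> Basis" for b :: 'a
          using cb[of b t] that by (simp add: abs_mult)
      qed
      finally show "norm x \<le> 2 * real d" by (simp add: x d_def mult.commute)
    qed
    fix y :: 'a assume y: "\<And>b. b \<in> Basis \<Longrightarrow> 0 \<le> y \<bullet> b \<and> y \<bullet> b \<le> 1"
    have "\<exists>a :: nat \<Rightarrow> nat. (\<forall>n. a n \<le> 1) \<and> (\<lambda>k. real (a k) / 2 ^ Suc k) sums ((y \<bullet> b) / 2)" if "b \<in> Basis" for b
      using y[OF that] by (rule_tac binary_expansion[of "(y \<bullet> b) / 2"]) auto
    then obtain a :: "'a \<Rightarrow> nat \<Rightarrow> nat" where a: "\<And>b n. b \<in> Basis \<Longrightarrow> a b n \<le> 1"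
      "\<And>b. b \<in> Basis \<Longrightarrow> (\<lambda>k. real (a b k) / 2 ^ Suc k) sums ((y \<bullet> b) / 2)" by metis
    \<comment> \<open>The digits of all coordinates are interleaved: position d k + \<iota> b holds
      digit k of coordinate b.\<close>
    define e where "e n = a (inv_into Basis \<iota> (n mod d)) (n div d)" for n
    have e1: "e n \<le> 1" for n
    proof -
      have "n mod d \<in> \<iota> ` Basis" using \<iota> d by (simp add: bij_betw_def)
      thus ?thesis unfolding e_def by (intro a(1) inv_into_into)
    qed
    have eb: "e (d * k + \<iota> b) = a b k" if "b \<in> Basis" for b k
      unfolding e_def using \<iota>d[OF that] \<iota> that by (simp add: bij_betw_def)
    have "c b (ternary e) = (y \<bullet> b) / 2" if b: "b \<in> Basis" for b
    proof -
      have "(\<lambda>k. (1 / 2) ^ Suc k * schoenberg_step (3 ^ (d * k + \<iota> b) * ternary e)) = (\<lambda>k. real (a b k) / 2 ^ Suc k)"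
        by (simp add: schoenberg_step_ternary[OF e1] eb[OF b] power_divide)
      thus ?thesis unfolding c_def using sums_unique[OF a(2)[OF b]] by simp
    qed
    hence "\<phi> (ternary e) = (\<Sum>b\<in>Basis. (y \<bullet> b) *\<^sub>R b)" 
      unfolding \<phi>_def by (intro sum.cong) (simp_all add: mult.commute)
    hence "\<phi> (ternary e) = y" by (simp only: euclidean_representation)
    thus "\<exists>t\<in>{0..1}. \<phi> t = y" using ternary_bounds[OF e1] by (intro bexI[of _ "ternary e"]) auto
  qed
qed

text \<open>The points are lifted to parameters in [0, 1] of the space-filling curve. The lifted
  measures are tight, Helly's theorem gives a weak limit on the line, and its image under the curve
  is \<rho>.\<close>

lemma discrete_weak_compactness:
  fixes y :: "nat \<Rightarrow> 'i \<Rightarrow> 'a::euclidean_space"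
  assumes W: "\<And>n. finite (W n)" and w: "\<And>n i. i \<in> W n \<Longrightarrow> 0 \<le> w n i" "\<And>n. (\<Sum>i\<in>W n. w n i) = 1"
    and y: "\<And>n i b. i \<in> W n \<Longrightarrow> b \<in> Basis \<Longrightarrow> 0 \<le> y n i \<bullet> b \<and> y n i \<bullet> b \<le> 1"
  obtains r :: "nat \<Rightarrow> nat" and \<rho> where "strict_mono r" "prob_space \<rho>" "sets \<rho> = sets borel"
    "\<And>f :: 'a \<Rightarrow> real. continuous_on UNIV f \<Longrightarrow>
      (\<lambda>n. \<Sum>i\<in>W (r n). w (r n) i * f (y (r n) i)) \<longlonglongrightarrow> (\<integral>x. f x \<partial>\<rho>)"
proof -
  obtain \<phi> :: "real \<Rightarrow> 'a" where \<phi>: "continuous_on UNIV \<phi>" "bounded (range \<phi>)"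
    "\<And>y. (\<And>b. b \<in> Basis \<Longrightarrow> 0 \<le> y \<bullet> b \<and> y \<bullet> b \<le> 1) \<Longrightarrow> \<exists>t\<in>{0..1}. \<phi> t = y"
    using space_filling_curve by blast
  have "\<forall>n. \<forall>i\<in>W n. \<exists>t. 0 \<le> t \<and> t \<le> 1 \<and> \<phi> t = y n i" using \<phi>(3) y by (meson atLeastAtMost_iff)
  then obtain t where t: "\<And>n i. i \<in> W n \<Longrightarrow> 0 \<le> t n i \<and> t n i \<le> 1 \<and> \<phi> (t n i) = y n i" by metis
  define P where "P n = point_measure (W n) (\<lambda>i. ennreal (w n i))" for n
  define M where "M n = distr (P n) borel (t n)" for n
  have meas: "t n \<in> measurable (P n) borel" for n by (simp add: P_def)
  have integral: "(\<integral>x. f x \<partial>M n) = (\<Sum>i\<in>W n. w n i * f (t n i))" if "f \<in> borel_measurable borel" for n and f :: "real \<Rightarrow> real"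
    unfolding M_def using that w(1) W
    by (subst integral_distr[OF meas]) (simp_all add: P_def lebesgue_integral_point_measure_finite)
  have prob: "prob_space (P n)" for n
  proof
    show "emeasure (P n) (space (P n)) = 1" unfolding P_def space_point_measure
      using W w by (subst emeasure_point_measure_finite) (simp_all add: sum_ennreal)
  qed
  have rd: "real_distribution (M n)" for n
    unfolding real_distribution_def real_distribution_axioms_def M_def
    using prob_space.prob_space_distr[OF prob meas] by simp
  \<comment> \<open>Tightness is phrased with intervals open on the left, so the interval starts
    below 0 to contain the parameter 0.\<close>
  have "measure (M n) {-1<..1} = 1" for n
  proof -
    interpret real_distribution "M n" by (rule rd)
    have "AE i in P n. t n i \<in> {-1<..1}"
      unfolding P_def AE_point_measure using t[of _ n] by (fastforce intro: less_le_trans[of _ 0])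
    hence "AE x in M n. x \<in> {-1<..1}" unfolding M_def by (subst AE_distr_iff[OF meas]) simp_all
    thus ?thesis by (subst prob_eq_1) auto
  qed
  hence "\<exists>a b. a < b \<and> (\<forall>n. 1 - \<epsilon> < measure (M n) {a<..b})" if "\<epsilon> > 0" for \<epsilon>
    using that by (intro exI[of _ "- 1 :: real"] exI[of _ "1 :: real"]) simp
  hence "tight M" unfolding tight_def using rd by blast
  from tight_imp_convergent_subsubsequence[OF this strict_mono_id]
  obtain r N where r: "strict_mono r" "real_distribution N" "weak_conv_m (M \<circ> id \<circ> r) N" by blast
  interpret N: real_distribution N by (rule r(2))
  have \<phi>m [measurable]: "\<phi> \<in> borel_measurable borel" by (rule borel_measurable_continuous_onI[OF \<phi>(1)])
  show ?thesis
  proof (rule that[of r "distr N borel \<phi>"])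
    show "prob_space (distr N borel \<phi>)" by (rule N.prob_space_distr) measurable
    fix f :: "'a \<Rightarrow> real" assume f: "continuous_on UNIV f"
    have fm [measurable]: "f \<in> borel_measurable borel" by (rule borel_measurable_continuous_onI[OF f])
    have "bounded (f ` closure (range \<phi>))"
      using \<phi>(2) by (intro compact_imp_bounded compact_continuous_image continuous_on_subset[OF f]) auto
    then obtain B where B: "\<And>x. norm (f (\<phi> x)) \<le> B"
      unfolding bounded_iff using closure_subset by (metis imageI rangeI subsetD)
    have isC: "isCont (\<lambda>x. f (\<phi> x)) x" for x
      using continuous_on_compose2[OF f \<phi>(1)] by (auto simp: continuous_on_eq_continuous_at)
    have "real_distribution ((M \<circ> id \<circ> r) n)" for n by (simp add: rd)
    from weak_conv_imp_integral_bdd_continuous_conv[OF this r(2,3) isC B]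
    have "(\<lambda>n. \<integral>x. f (\<phi> x) \<partial>M (r n)) \<longlonglongrightarrow> (\<integral>x. f (\<phi> x) \<partial>N)" by simp
    moreover have "(\<integral>x. f (\<phi> x) \<partial>M (r n)) = (\<Sum>i\<in>W (r n). w (r n) i * f (y (r n) i))" for n
      using t by (subst integral) auto
    moreover have "(\<integral>x. f x \<partial>distr N borel \<phi>) = (\<integral>x. f (\<phi> x) \<partial>N)"
      by (rule integral_distr) measurable
    ultimately show "(\<lambda>n. \<Sum>i\<in>W (r n). w (r n) i * f (y (r n) i)) \<longlonglongrightarrow> (\<integral>x. f x \<partial>distr N borel \<phi>)" by simp
  qed (use r in auto)
qed

section \<open>Homogeneous completely monotonic functions\<close>

lemma binomial_over_power_tendsto: "(\<lambda>n. real (n choose k) / real n ^ k) \<longlonglongrightarrow> 1 / fact k"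
proof -
  have "(\<lambda>n. (\<Prod>i<k. 1 - real i * (1 / real n)) / fact k) \<longlonglongrightarrow> (\<Prod>i<k. 1 - real i * 0) / fact k"
    by (intro tendsto_intros lim_1_over_n) auto
  hence "(\<lambda>n. (\<Prod>i<k. 1 - real i * (1 / real n)) / fact k) \<longlonglongrightarrow> 1 / fact k" by simp
  moreover have "\<forall>\<^sub>F n in sequentially. (\<Prod>i<k. 1 - real i * (1 / real n)) / fact k = real (n choose k) / real n ^ k"
    using eventually_gt_at_top[of 0]
  proof eventually_elim
    case (elim n)
    have "real (n choose k) = (\<Prod>i<k. real n - real i) / fact k"
      by (simp add: binomial_gbinomial gbinomial_prod_rev atLeast0LessThan)
    also have "(\<Prod>i<k. real n - real i) = (\<Prod>i<k. real n * (1 - real i * (1 / real n)))"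
      using elim by (intro prod.cong) (auto simp: field_simps)
    also have "\<dots> = real n ^ k * (\<Prod>i<k. 1 - real i * (1 / real n))" by (simp add: prod.distrib)
    finally show ?case using elim by simp
  qed
  ultimately show ?thesis by (rule Lim_transform_eventually)
qed

text \<open>Telescoping: for factors in [0, 1] the difference of the products is at most the sum of
  the differences of the factors. The range bounds are carried along for the induction.\<close>

lemma abs_prod_list_diff_le:
  fixes f g :: "'b \<Rightarrow> real"
  assumes "\<And>b. b \<in> set ws \<Longrightarrow> 0 \<le> f b \<and> f b \<le> 1 \<and> 0 \<le> g b \<and> g b \<le> 1 \<and> \<bar>f b - g b\<bar> \<le> e"
  shows "0 \<le> prod_list (map f ws) \<and> prod_list (map f ws) \<le> 1 \<and>
    0 \<le> prod_list (map g ws) \<and> prod_list (map g ws) \<le> 1 \<and>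
    \<bar>prod_list (map f ws) - prod_list (map g ws)\<bar> \<le> real (length ws) * e"
  using assms
proof (induction ws)
  case (Cons b ws)
  let ?F = "prod_list (map f ws)" and ?G = "prod_list (map g ws)"
  have IH: "0 \<le> ?F" "?F \<le> 1" "0 \<le> ?G" "?G \<le> 1" "\<bar>?F - ?G\<bar> \<le> real (length ws) * e"
    using Cons by auto
  have b: "0 \<le> f b" "f b \<le> 1" "0 \<le> g b" "g b \<le> 1" "\<bar>f b - g b\<bar> \<le> e" using Cons.prems by auto
  have "f b * ?F - g b * ?G = f b * (?F - ?G) + (f b - g b) * ?G" by (simp add: algebra_simps)
  also have "\<bar>\<dots>\<bar> \<le> \<bar>f b\<bar> * \<bar>?F - ?G\<bar> + \<bar>f b - g b\<bar> * \<bar>?G\<bar>"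
    by (simp only: abs_mult[symmetric] abs_triangle_ineq)
  also have "\<dots> \<le> 1 * (real (length ws) * e) + e * 1"
    using IH b by (intro add_mono mult_mono) auto
  finally show ?case using IH b by (simp add: mult_le_one algebra_simps)
qed simp

lemma exp_minus_linear_bound:
  fixes x :: real
  assumes "0 \<le> x" "x \<le> 1" shows "\<bar>exp (- x) - (1 - x)\<bar> \<le> x\<^sup>2"
proof -
  have 1: "1 - x \<le> exp (- x)" using exp_ge_add_one_self[of "- x"] by simp
  have "1 \<le> exp x * (1 - x + x\<^sup>2)"
  proof -
    have "1 \<le> (1 + x) * (1 - x + x\<^sup>2)" using assms by (simp add: algebra_simps power2_eq_square)
    also have "\<dots> \<le> exp x * (1 - x + x\<^sup>2)"
      using assms exp_ge_add_one_self[of x] by (intro mult_right_mono) auto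
    finally show ?thesis .
  qed
  hence "exp (- x) \<le> 1 - x + x\<^sup>2" by (simp add: exp_minus field_simps)
  thus ?thesis using 1 by simp
qed

lemma basis_word_average:
  fixes ws :: "'a::euclidean_space list"
  assumes "ws \<in> basis_words n" "b \<in> Basis"
  shows "0 \<le> (sum_list ws /\<^sub>R real n) \<bullet> b \<and> (sum_list ws /\<^sub>R real n) \<bullet> b \<le> 1"
proof -
  have "sum_list ws \<bullet> b = real (count_list ws b)" if "set ws \<subseteq> Basis" for ws :: "'a list"
    using that by (induction ws) (auto simp: inner_add_left inner_Basis assms(2))
  moreover have "count_list ws b \<le> n" using count_le_length[of ws b] assms(1) by (auto simp: basis_words_def)
  ultimately show ?thesis using assms(1) by (auto simp: basis_words_def divide_le_eq_1 inverse_eq_divide)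
qed

lemma basis_word_average_One:
  fixes ws :: "'a::euclidean_space list"
  assumes "ws \<in> basis_words n" "n > 0"
  shows "One \<bullet> (sum_list ws /\<^sub>R real n) = 1"
proof -
  have "One \<bullet> sum_list ws = real (length ws)" if "set ws \<subseteq> Basis" for ws :: "'a list"
    using that by (induction ws) (auto simp: inner_add_right)
  thus ?thesis using assms by (auto simp: basis_words_def)
qed

text \<open>The pairs (a, t) will be treated as points of one orthant, hence a single variable here.
  Positivity at \<open>One\<close> serves to normalise the weights to total mass 1.\<close>

locale homogeneous_cm =
  fixes G :: "'a::euclidean_space \<Rightarrow> real"
  assumes smooth: "smooth_on (interior nonneg_orthant) G"
    and homogeneous: "\<And>x r. x \<in> interior nonneg_orthant \<Longrightarrow> r > 0 \<Longrightarrow> G (r *\<^sub>R x) = G x / r"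
    and cm: "\<And>ws x. set ws \<subseteq> Basis \<Longrightarrow> x \<in> interior nonneg_orthant \<Longrightarrow> 0 \<le> (- 1) ^ length ws * fold dir_deriv ws G x"
    and pos: "G One > 0"
begin

abbreviation "S \<equiv> (interior nonneg_orthant :: 'a set)"

lemma S_scale: "x \<in> S \<Longrightarrow> r > 0 \<Longrightarrow> r *\<^sub>R x \<in> S"
  by (simp add: mem_interior_nonneg_orthant)

lemma hom1: "x \<in> S \<Longrightarrow> r > 0 \<Longrightarrow> G (r *\<^sub>R x) = G x / r ^ 1"
  using homogeneous by simp

text \<open>The candidate for the n-th moment of c \<bullet> y: if G(c) is an integral of 1 / (c
  \<bullet> y) over the simplex, differentiation at \<open>One\<close> produces the integral of (c
  \<bullet> y)^n.\<close>

definition P :: "nat \<Rightarrow> 'a \<Rightarrow> real" where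
  "P n c = (- 1) ^ n / fact n * (dir_deriv c ^^ n) G One"

definition wt :: "nat \<Rightarrow> 'a list \<Rightarrow> real" where
  "wt n ws = (- 1) ^ n / fact n * fold dir_deriv ws G One"

lemma P_words: "P n c = (\<Sum>ws\<in>basis_words n. wt n ws * prod_list (map ((\<bullet>) c) ws))"
  unfolding P_def wt_def dir_deriv_pow_words[OF smooth open_interior One_in_interior]
  by (simp add: sum_distrib_left mult_ac)

lemma wt_nonneg: "ws \<in> basis_words n \<Longrightarrow> 0 \<le> wt n ws"
  using cm[of ws One] One_in_interior unfolding wt_def basis_words_def by (auto simp: zero_le_divide_iff zero_le_mult_iff mult_ac)

lemma Euler: "x \<in> S \<Longrightarrow> (dir_deriv x ^^ n) G x = (- 1) ^ n * fact n * G x"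
  using dir_deriv_pow_Euler[OF smooth open_interior S_scale hom1, of x n] by (simp add: pochhammer_fact)

lemma P_One: "P n One = G One"
  using Euler[OF One_in_interior, of n] by (simp add: P_def flip: power_mult_distrib)

lemma sum_wt: "(\<Sum>ws\<in>basis_words n. wt n ws) = G One"
proof -
  have "prod_list (map ((\<bullet>) One) ws) = 1" if "set ws \<subseteq> Basis" for ws :: "'a list"
    using that by (induction ws) auto
  hence "P n One = (\<Sum>ws\<in>basis_words n. wt n ws)"
    unfolding P_words by (auto simp: basis_words_def intro!: sum.cong)
  thus ?thesis by (simp add: P_One)
qed

lemma P_scale: "P n (s *\<^sub>R h) = s ^ n * P n h"
  unfolding P_def by (simp add: dir_deriv_pow_scale[OF smooth open_interior One_in_interior])

lemma prod_list_le_power: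
  fixes f g :: "'b \<Rightarrow> real"
  assumes "\<And>b. b \<in> set ws \<Longrightarrow> 0 \<le> f b \<and> f b \<le> g b"
  shows "0 \<le> prod_list (map f ws) \<and> prod_list (map f ws) \<le> prod_list (map g ws)"
  using assms
proof (induction ws)
  case (Cons b ws)
  hence "0 \<le> prod_list (map f ws)" "prod_list (map f ws) \<le> prod_list (map g ws)" "0 \<le> f b" "f b \<le> g b" by auto
  thus ?case by (auto intro!: mult_mono mult_nonneg_nonneg)
qed simp

text \<open>For nonnegative coordinates every word contributes with the sign given by complete
  monotonicity, so the signed derivative increases with its direction.\<close>

lemma dir_deriv_pow_mono:
  assumes "x \<in> S" "\<And>b. b \<in> Basis \<Longrightarrow> 0 \<le> h \<bullet> b \<and> h \<bullet> b \<le> k \<bullet> b"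
  shows "0 \<le> (- 1) ^ n * (dir_deriv h ^^ n) G x" "(- 1) ^ n * (dir_deriv h ^^ n) G x \<le> (- 1) ^ n * (dir_deriv k ^^ n) G x"
proof -
  have e: "(- 1) ^ n * (dir_deriv c ^^ n) G x = (\<Sum>ws\<in>basis_words n. prod_list (map ((\<bullet>) c) ws) * ((- 1) ^ n * fold dir_deriv ws G x))" for c
    unfolding dir_deriv_pow_words[OF smooth open_interior assms(1)] by (simp add: sum_distrib_left mult_ac)
  have p: "0 \<le> prod_list (map ((\<bullet>) h) ws) \<and> prod_list (map ((\<bullet>) h) ws) \<le> prod_list (map ((\<bullet>) k) ws)" if "ws \<in> basis_words n" for ws
    using that assms(2) by (intro prod_list_le_power) (auto simp: basis_words_def)
  have c: "0 \<le> (- 1) ^ n * fold dir_deriv ws G x" if "ws \<in> basis_words n" for ws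
    using cm[of ws x] that assms(1) by (auto simp: basis_words_def)
  show "0 \<le> (- 1) ^ n * (dir_deriv h ^^ n) G x" 
    unfolding e by (rule sum_nonneg, rule mult_nonneg_nonneg) (use p in blast, rule c)
  show "(- 1) ^ n * (dir_deriv h ^^ n) G x \<le> (- 1) ^ n * (dir_deriv k ^^ n) G x"
    unfolding e by (rule sum_mono, rule mult_right_mono) (use p in blast, rule c)
qed

lemma P_bounds:
  assumes "\<And>b. b \<in> Basis \<Longrightarrow> 0 \<le> h \<bullet> b \<and> h \<bullet> b \<le> 1"
  shows "0 \<le> P n h" "P n h \<le> G One"
proof -
  note m = dir_deriv_pow_mono[OF One_in_interior, of h One n]
  have "0 \<le> (- 1) ^ n * (dir_deriv h ^^ n) G One / fact n"
    using m(1) assms by (intro divide_nonneg_pos) auto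
  thus "0 \<le> P n h" by (simp add: P_def)
  have "(- 1) ^ n * (dir_deriv h ^^ n) G One / fact n \<le> (- 1) ^ n * (dir_deriv One ^^ n) G One / fact n"
    using m(2) assms by (intro divide_right_mono) auto
  hence "P n h \<le> P n One" by (simp add: P_def)
  thus "P n h \<le> G One" by (simp only: P_One)
qed

text \<open>Moments on the simplex satisfy this because \<open>One \<bullet> y\<close> is 1. Here it
  follows from Euler's identity: derivatives in direction \<open>One\<close> at \<open>One\<close>
  only multiply by a rising factorial, which cancels against the factorials in
  \<open>P\<close>.\<close>

lemma P_binomial: "P n (One + h) = (\<Sum>k\<le>n. real (n choose k) * P k h)"
proof -
  have D: "(dir_deriv One ^^ (n - k)) ((dir_deriv h ^^ k) G) One = (- 1) ^ (n - k) * (fact n / fact k) * (dir_deriv h ^^ k) G One"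
    if "k \<le> n" for k
  proof -
    have "(dir_deriv One ^^ (n - k)) ((dir_deriv h ^^ k) G) One = (- 1) ^ (n - k) * pochhammer (real (1 + k)) (n - k) * (dir_deriv h ^^ k) G One"
      by (rule dir_deriv_pow_Euler[OF smooth_on_dir_deriv_pow[OF smooth] open_interior S_scale _ One_in_interior])
        (assumption | rule dir_deriv_pow_homogeneous[OF smooth open_interior S_scale hom1])+
    moreover have "fact n = fact k * pochhammer (real (1 + k)) (n - k)"
      using pochhammer_product[OF that, of "1 :: real"] by (simp add: pochhammer_fact add.commute)
    ultimately show ?thesis by simp
  qed
  have "P n (One + h) = (\<Sum>k\<le>n. (- 1) ^ n / fact n * (real (n choose k) * ((- 1) ^ (n - k) * (fact n / fact k) * (dir_deriv h ^^ k) G One)))"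
    unfolding P_def dir_deriv_pow_add[OF smooth open_interior One_in_interior] sum_distrib_left
    by (intro sum.cong refl) (simp add: D)
  also have "\<dots> = (\<Sum>k\<le>n. real (n choose k) * P k h)"
  proof (intro sum.cong refl)
    fix k assume k: "k \<in> {..n}"
    have "(- 1 :: real) ^ n * (- 1) ^ (n - k) = (- 1) ^ k"
    proof -
      have "(- 1 :: real) ^ n = (- 1) ^ k * (- 1) ^ (n - k)" using k by (simp flip: power_add)
      thus ?thesis by (simp add: mult.assoc flip: power_mult_distrib)
    qed
    thus "(- 1) ^ n / fact n * (real (n choose k) * ((- 1) ^ (n - k) * (fact n / fact k) * (dir_deriv h ^^ k) G One)) = real (n choose k) * P k h"
      unfolding P_def by (simp add: field_simps)
  qed
  finally show ?thesis .
qed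

text \<open>The integrated form of the convergence of (1 - h \<bullet> y / n)^n to exp (- h
  \<bullet> y). Tannery's theorem exchanges limit and sum, dominated by G(One) / k!.\<close>

lemma P_limit:
  assumes h: "\<And>b. b \<in> Basis \<Longrightarrow> 0 \<le> h \<bullet> b \<and> h \<bullet> b \<le> 1"
  shows "(\<lambda>n. P n (One - h /\<^sub>R real n)) \<longlonglongrightarrow> (\<Sum>k. (- 1) ^ k / fact k * P k h)"
proof -
  define a where "a k n = real (n choose k) * ((- (1 / real n)) ^ k * P k h)" for k n
  have "P n (One - h /\<^sub>R real n) = (\<Sum>k. a k n)" for n
  proof -
    have "P n (One - h /\<^sub>R real n) = P n (One + (- (1 / real n)) *\<^sub>R h)" by (simp add: inverse_eq_divide)
    also have "\<dots> = (\<Sum>k\<le>n. a k n)" unfolding P_binomial P_scale a_def by simp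
    also have "\<dots> = (\<Sum>k. a k n)" by (rule suminf_finite[symmetric]) (auto simp: a_def binomial_eq_0)
    finally show ?thesis .
  qed
  moreover have "(\<lambda>n. \<Sum>k. a k n) \<longlonglongrightarrow> (\<Sum>k. (- 1) ^ k / fact k * P k h)"
  proof (rule tannerys_theorem[THEN conjunct2, THEN conjunct2])
    show "(\<lambda>n. a k n) \<longlonglongrightarrow> (- 1) ^ k / fact k * P k h" for k
    proof -
      have "(\<lambda>n. (- 1) ^ k * (real (n choose k) / real n ^ k) * P k h) \<longlonglongrightarrow> (- 1) ^ k * (1 / fact k) * P k h"
        by (intro tendsto_intros binomial_over_power_tendsto)
      moreover have "a k n = (- 1) ^ k * (real (n choose k) / real n ^ k) * P k h" for n
        by (simp add: a_def power_minus[of "1 / real n"] power_divide)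
      ultimately show ?thesis by simp
    qed
    have "norm (a k n) \<le> G One / fact k" for k n
    proof -
      have "real (n choose k) * fact k \<le> real n ^ k" using binomial_fact_pow[of n k] by (metis of_nat_fact of_nat_le_iff of_nat_mult of_nat_power)
      hence "real (n choose k) / real n ^ k \<le> 1 / fact k"
        by (cases "n = 0"; cases "k = 0") (simp_all add: field_simps power_0_left)
      moreover have "norm (a k n) = (real (n choose k) / real n ^ k) * P k h"
        using P_bounds[OF h, of k] by (simp add: a_def abs_mult power_abs power_divide)
      ultimately have "norm (a k n) \<le> (1 / fact k) * G One"
        using P_bounds[OF h, of k] by (simp only:) (intro mult_mono, auto)
      thus ?thesis by simp
    qed
    thus "\<forall>\<^sub>F (k, n) in at_top \<times>\<^sub>F sequentially. norm (a k n) \<le> G One / fact k"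
      by (intro always_eventually) auto
    show "summable (\<lambda>k. G One / fact k)"
      using summable_mult[OF summable_exp[of 1], of "G One"] by (simp add: field_simps)
  qed simp
  ultimately show ?thesis by simp
qed

text \<open>A word of order n carries the weight \<open>wt\<close> and is placed at its vector of
  letter frequencies. \<open>P_limit\<close> then computes the integral of exp (- h \<bullet> y) for
  the weak limit \<rho>, and comparing power series along s h identifies all moments.\<close>

lemma limit_measure:
  obtains \<rho> where "prob_space \<rho>" "sets \<rho> = sets borel" "AE y in \<rho>. y \<in> unit_simplex"
    "\<And>h n. (\<And>b. b \<in> Basis \<Longrightarrow> 0 \<le> h \<bullet> b \<and> h \<bullet> b \<le> 1) \<Longrightarrow> P n h = G One * (\<integral>y. (h \<bullet> y) ^ n \<partial>\<rho>)"
proof -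
  define w where "w n ws = wt n ws / G One" for n ws
  define y where "y n ws = sum_list ws /\<^sub>R real n" for n and ws :: "'a list"
  have w: "0 \<le> w n ws" if "ws \<in> basis_words n" for n ws using wt_nonneg[OF that] pos by (simp add: w_def)
  have w1: "(\<Sum>ws\<in>basis_words n. w n ws) = 1" for n
    using sum_wt[of n] pos by (simp add: w_def flip: sum_divide_distrib)
  have yb: "0 \<le> y n ws \<bullet> b \<and> y n ws \<bullet> b \<le> 1" if "ws \<in> basis_words n" "b \<in> Basis" for n ws b
    unfolding y_def by (rule basis_word_average[OF that])
  obtain r :: "nat \<Rightarrow> nat" and \<rho> where r: "strict_mono r" and \<rho>: "prob_space \<rho>" "sets \<rho> = sets borel"
    and lim: "\<And>f :: 'a \<Rightarrow> real. continuous_on UNIV f \<Longrightarrow> (\<lambda>n. \<Sum>ws\<in>basis_words (r n). w (r n) ws * f (y (r n) ws)) \<longlonglongrightarrow> (\<integral>x. f x \<partial>\<rho>)"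
    by (rule discrete_weak_compactness[of basis_words w y, OF finite_basis_words w w1 yb])
      (assumption | (rule that; assumption))+
  interpret prob_space \<rho> by (rule \<rho>(1))
  note [measurable_cong] = \<rho>(2)
  have rpos: "\<forall>\<^sub>F n in sequentially. 0 < r n"
    using eventually_gt_at_top[of 0]
  proof eventually_elim
    case (elim n) thus ?case using seq_suble[OF r, of n] by linarith
  qed
  have simplex: "AE y in \<rho>. y \<in> unit_simplex"
  proof -
    \<comment> \<open>A bounded continuous function that vanishes exactly on the simplex, so its
      integral survives the weak limit and stays 0.\<close>
    define f where "f y = min 1 (\<bar>One \<bullet> y - 1\<bar> + (\<Sum>b\<in>Basis. max 0 (- (y \<bullet> b))))" for y :: 'a
    have fc: "continuous_on UNIV f" unfolding f_def[abs_def] by (intro continuous_intros)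
    have [measurable]: "f \<in> borel_measurable borel" by (rule borel_measurable_continuous_onI[OF fc])
    have f01: "0 \<le> f y" "f y \<le> 1" for y by (auto simp: f_def intro!: add_nonneg_nonneg sum_nonneg)
    have "f (y n ws) = 0" if ws: "ws \<in> basis_words n" "n > 0" for n ws
    proof -
      have "(\<Sum>b\<in>Basis. max 0 (- (y n ws \<bullet> b))) = 0"
        using yb[OF ws(1)] by (intro sum.neutral) (auto intro: max_absorb1)
      moreover have "One \<bullet> y n ws = 1" unfolding y_def by (rule basis_word_average_One[OF ws])
      ultimately show ?thesis by (simp add: f_def)
    qed
    hence "\<forall>\<^sub>F n in sequentially. (\<Sum>ws\<in>basis_words (r n). w (r n) ws * f (y (r n) ws)) = 0"
      using rpos by (auto elim!: eventually_mono)
    hence "(\<integral>x. f x \<partial>\<rho>) = 0" by (intro LIMSEQ_unique[OF lim[OF fc] tendsto_eventually])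
    moreover have "integrable \<rho> f" by (rule integrable_const_bound[of _ 1]) (use f01 in auto)
    ultimately have "AE y in \<rho>. f y = 0" using integral_nonneg_eq_0_iff_AE[of \<rho> f] f01 by auto
    thus ?thesis
    proof eventually_elim
      case (elim y)
      have s: "0 \<le> (\<Sum>b\<in>Basis. max 0 (- (y \<bullet> b)))" by (intro sum_nonneg) auto
      hence "\<bar>One \<bullet> y - 1\<bar> = 0" "(\<Sum>b\<in>Basis. max 0 (- (y \<bullet> b))) = 0" using elim by (auto simp: f_def min_def split: if_splits)
      moreover have "0 \<le> y \<bullet> b" if "b \<in> Basis" for b
        using \<open>(\<Sum>b\<in>Basis. max 0 (- (y \<bullet> b))) = 0\<close> that by (subst (asm) sum_nonneg_eq_0_iff) (auto simp: max_def split: if_splits)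
      ultimately show ?case by (simp add: unit_simplex_def nonneg_orthant_def)
    qed
  qed
  have exp_eq: "G One * (\<integral>y. exp (- (h \<bullet> y)) \<partial>\<rho>) = (\<Sum>k. (- 1) ^ k / fact k * P k h)"
    if h: "\<And>b. b \<in> Basis \<Longrightarrow> 0 \<le> h \<bullet> b \<and> h \<bullet> b \<le> 1" for h
  proof -
    let ?E = "\<lambda>n. \<Sum>ws\<in>basis_words n. w n ws * exp (- (h \<bullet> y n ws))"
    \<comment> \<open>Both are sums over words with the same weights. Replacing exp (- h \<bullet> b
      / n) by 1 - h \<bullet> b / n costs at most 1 / n^2 for each of the n letters.\<close>
    have "\<bar>G One * ?E n - P n (One - h /\<^sub>R real n)\<bar> \<le> G One * (1 / real n)" if n: "n > 0" for n
    proof -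
      have "G One * ?E n - P n (One - h /\<^sub>R real n)
         = (\<Sum>ws\<in>basis_words n. wt n ws * (exp (- (h \<bullet> y n ws)) - prod_list (map ((\<bullet>) (One - h /\<^sub>R real n)) ws)))"
        using pos unfolding P_words by (simp add: w_def sum_distrib_left sum_subtractf right_diff_distrib)
      also have "\<bar>\<dots>\<bar> \<le> (\<Sum>ws\<in>basis_words n. wt n ws * (1 / real n))"
      proof (rule order_trans[OF sum_abs sum_mono])
        fix ws :: "'a list" assume ws: "ws \<in> basis_words n"
        have e: "exp (- (h \<bullet> y n ws)) = prod_list (map (\<lambda>b. exp (- (h \<bullet> b / real n))) ws)"
        proof -
          have "exp (- (h \<bullet> (sum_list vs /\<^sub>R real n))) = prod_list (map (\<lambda>b. exp (- (h \<bullet> b / real n))) vs)" for vs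
          proof (induction vs)
            case (Cons b vs)
            have "exp (- (h \<bullet> (sum_list (b # vs) /\<^sub>R real n)))
              = exp (- (h \<bullet> b / real n)) * exp (- (h \<bullet> (sum_list vs /\<^sub>R real n)))"
              by (simp add: inner_add_right distrib_left divide_inverse mult.commute flip: exp_add)
            thus ?case using Cons by simp
          qed simp
          thus ?thesis by (simp add: y_def)
        qed
        have "\<bar>prod_list (map (\<lambda>b. exp (- (h \<bullet> b / real n))) ws) - prod_list (map ((\<bullet>) (One - h /\<^sub>R real n)) ws)\<bar>
          \<le> real (length ws) * (1 / (real n)\<^sup>2)"
        proof (rule abs_prod_list_diff_le[THEN conjunct2, THEN conjunct2, THEN conjunct2, THEN conjunct2])
          fix b assume "b \<in> set ws"
          hence b: "b \<in> Basis" using ws by (auto simp: basis_words_def)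
          define x where "x = h \<bullet> b / real n"
          have "x \<le> 1 / real n" using h[OF b] n by (simp add: x_def divide_right_mono)
          moreover have "1 / real n \<le> 1" using n by simp
          ultimately have x: "0 \<le> x" "x \<le> 1 / real n" "x \<le> 1" using h[OF b] by (auto simp: x_def)
          have "x\<^sup>2 \<le> (1 / real n)\<^sup>2" using x by (intro power_mono) auto
          moreover have "(One - h /\<^sub>R real n) \<bullet> b = 1 - x" using b by (simp add: inner_diff_left x_def divide_inverse)
          ultimately show "0 \<le> exp (- (h \<bullet> b / real n)) \<and> exp (- (h \<bullet> b / real n)) \<le> 1 \<and>
            0 \<le> (One - h /\<^sub>R real n) \<bullet> b \<and> (One - h /\<^sub>R real n) \<bullet> b \<le> 1 \<and>
            \<bar>exp (- (h \<bullet> b / real n)) - (One - h /\<^sub>R real n) \<bullet> b\<bar> \<le> 1 / (real n)\<^sup>2"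
            unfolding x_def[symmetric] using x exp_minus_linear_bound[of x] by (auto simp: power_divide)
        qed
        also have "\<dots> = 1 / real n" using ws n by (simp add: basis_words_def power2_eq_square)
        finally show "\<bar>wt n ws * (exp (- (h \<bullet> y n ws)) - prod_list (map ((\<bullet>) (One - h /\<^sub>R real n)) ws))\<bar> \<le> wt n ws * (1 / real n)"
          unfolding abs_mult e using wt_nonneg[OF ws] by (intro mult_mono) auto
      qed
      also have "\<dots> = G One * (1 / real n)" by (simp only: sum_distrib_right[symmetric] sum_wt)
      finally show ?thesis .
    qed
    hence "\<forall>\<^sub>F n in sequentially. norm (G One * ?E n - P n (One - h /\<^sub>R real n)) \<le> G One * (1 / real n)"
      by (intro eventually_mono[OF eventually_gt_at_top[of "0 :: nat"]]) (simp only: real_norm_def)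
    moreover have "(\<lambda>n. G One * (1 / real n)) \<longlonglongrightarrow> 0" using lim_1_over_n by (auto intro!: tendsto_eq_intros)
    ultimately have "(\<lambda>n. G One * ?E n - P n (One - h /\<^sub>R real n)) \<longlonglongrightarrow> 0"
      by (rule Lim_null_comparison)
    from tendsto_add[OF this P_limit[OF h]]
    have "(\<lambda>n. G One * ?E n) \<longlonglongrightarrow> (\<Sum>k. (- 1) ^ k / fact k * P k h)" by simp
    hence "(\<lambda>n. G One * ?E (r n)) \<longlonglongrightarrow> (\<Sum>k. (- 1) ^ k / fact k * P k h)"
      using LIMSEQ_subseq_LIMSEQ[OF _ r] by (force simp: o_def)
    moreover have "(\<lambda>n. G One * ?E (r n)) \<longlonglongrightarrow> G One * (\<integral>y. exp (- (h \<bullet> y)) \<partial>\<rho>)"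
      by (intro tendsto_mult_left lim continuous_intros)
    ultimately show ?thesis using LIMSEQ_unique by blast
  qed
  show ?thesis
  proof (rule that[OF \<rho> simplex])
    fix h :: 'a and n assume h: "\<And>b. b \<in> Basis \<Longrightarrow> 0 \<le> h \<bullet> b \<and> h \<bullet> b \<le> 1"
    define m where "m k = (\<integral>y. (h \<bullet> y) ^ k \<partial>\<rho>)" for k
    have "(- 1) ^ k / fact k * (P k h - G One * m k) = 0" for k
    proof (rule power_series_zeroI[of 1])
      fix s :: real assume s: "0 \<le> s" "s < 1"
      have sh: "0 \<le> (s *\<^sub>R h) \<bullet> b \<and> (s *\<^sub>R h) \<bullet> b \<le> 1" if "b \<in> Basis" for b
        using h[OF that] s by (auto simp: mult_le_one)
      have "summable (\<lambda>k. (- 1) ^ k / fact k * P k (s *\<^sub>R h))"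
      proof (rule summable_comparison_test')
        show "summable (\<lambda>k. G One / fact k)"
          using summable_mult[OF summable_exp[of 1], of "G One"] by (simp add: field_simps)
        show "norm ((- 1) ^ k / fact k * P k (s *\<^sub>R h)) \<le> G One / fact k" for k
          using P_bounds[OF sh, of k] by (simp add: abs_mult power_abs divide_right_mono)
      qed
      from summable_sums[OF this]
      have 1: "(\<lambda>k. (- 1) ^ k / fact k * P k (s *\<^sub>R h)) sums (G One * (\<integral>y. exp (- ((s *\<^sub>R h) \<bullet> y)) \<partial>\<rho>))"
        by (simp only: exp_eq[OF sh])
      have 2: "(\<lambda>k. G One * (\<integral>y. ((- s *\<^sub>R h) \<bullet> y) ^ k / fact k \<partial>\<rho>)) sums (G One * (\<integral>y. exp ((- s *\<^sub>R h) \<bullet> y) \<partial>\<rho>))"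
        by (intro sums_mult unit_simplex_power_series(2)[OF finite_measure_axioms \<rho>(2) simplex])
      have eqk: "G One * (\<integral>y. ((- s *\<^sub>R h) \<bullet> y) ^ k / fact k \<partial>\<rho>) = (- 1) ^ k / fact k * (G One * m k) * s ^ k" for k
      proof -
        have "((- s *\<^sub>R h) \<bullet> y) ^ k / fact k = ((- 1) ^ k * s ^ k / fact k) * (h \<bullet> y) ^ k" for y
          by (simp add: power_mult_distrib power_minus[of "s * (h \<bullet> y)"])
        thus ?thesis by (simp add: m_def)
      qed
      have "(- 1) ^ k / fact k * P k (s *\<^sub>R h) - G One * (\<integral>y. ((- s *\<^sub>R h) \<bullet> y) ^ k / fact k \<partial>\<rho>)
          = (- 1) ^ k / fact k * (P k h - G One * m k) * s ^ k" for k
        unfolding eqk P_scale by (simp add: algebra_simps diff_divide_distrib)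
      moreover have "G One * (\<integral>y. exp (- ((s *\<^sub>R h) \<bullet> y)) \<partial>\<rho>) - G One * (\<integral>y. exp ((- s *\<^sub>R h) \<bullet> y) \<partial>\<rho>) = 0"
        by simp
      ultimately show "(\<lambda>k. (- 1) ^ k / fact k * (P k h - G One * m k) * s ^ k) sums 0"
        using sums_diff[OF 1 2] by (simp only:)
    qed simp
    thus "P n h = G One * (\<integral>y. (h \<bullet> y) ^ n \<partial>\<rho>)" by (simp add: m_def)
  qed
qed

text \<open>Smoothness alone gives no convergence; positivity controls the remainder, as in
  Bernstein's theorem. At an intermediate point q the direction h is dominated coordinatewise by a
  multiple of q, and in direction q Euler's identity gives the derivatives exactly.\<close>

lemma Taylor_expansion:
  assumes \<kappa>: "\<kappa> < 1" and h: "\<And>b. b \<in> Basis \<Longrightarrow> 0 \<le> h \<bullet> b \<and> h \<bullet> b \<le> \<kappa>"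
  shows "(\<lambda>n. P n h) sums G (One - h)"
proof -
  have \<kappa>0: "0 \<le> \<kappa>" using h SOME_Basis by force
  define Df where "Df n t = (dir_deriv (- h) ^^ n) G (One + t *\<^sub>R (- h))" for n t
  have inS: "One + t *\<^sub>R (- h) \<in> S" if "0 \<le> t" "t \<le> 1" for t
    unfolding mem_interior_nonneg_orthant
  proof
    fix b :: 'a assume b: "b \<in> Basis"
    have "t * (h \<bullet> b) \<le> 1 * \<kappa>" using that h[OF b] \<kappa>0 by (intro mult_mono) auto
    thus "0 < (One + t *\<^sub>R (- h)) \<bullet> b" using b \<kappa> by (simp add: inner_diff_left)
  qed
  have deriv: "(Df n has_field_derivative Df (Suc n) t) (at t)" if "0 \<le> t" "t \<le> 1" for n t
    unfolding Df_def using smooth_on_line_derivative[OF smooth_on_dir_deriv_pow[OF smooth] inS[OF that]] by simp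
  have "continuous_on {0..1} (Df 0)"
    by (intro continuous_at_imp_continuous_on ballI DERIV_isCont[OF deriv]) auto
  hence "bounded (Df 0 ` {0..1})" by (intro compact_imp_bounded compact_continuous_image) auto
  then obtain M where M: "\<And>t. t \<in> {0..1} \<Longrightarrow> \<bar>Df 0 t\<bar> \<le> M" unfolding bounded_iff by (metis imageI real_norm_def)
  have M0: "0 \<le> M" using M[of 0] by auto
  have remainder: "\<bar>G (One - h) - (\<Sum>i<p. P i h)\<bar> \<le> real p * \<kappa> ^ p * (M / (1 - \<kappa>))" if p: "p > 0" for p
  proof -
    have vd: "(Df m has_vector_derivative Df (Suc m) t) (at t within {0..1})" if "m < p" "0 \<le> t" "t \<le> 1" for m t
      using deriv[OF that(2,3)] has_real_derivative_iff_has_vector_derivative has_field_derivative_at_within by blast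
    have "((\<lambda>x. ((1 - x) ^ (p - 1) / fact (p - 1)) *\<^sub>R Df p x) has_integral
       Df 0 1 - (\<Sum>i<p. ((1 - 0) ^ i / fact i) *\<^sub>R Df i 0)) {0..1}"
      by (rule Taylor_has_integral[where Df=Df and f="Df 0" and a=0 and b=1, OF p refl vd]) auto
    moreover have "Df i 0 / fact i = P i h" for i
      using dir_deriv_pow_scale[OF smooth open_interior One_in_interior, where \<alpha>="- 1" and v=h and n=i] by (simp add: Df_def P_def)
    moreover have "Df 0 1 = G (One - h)" by (simp add: Df_def)
    ultimately have int: "((\<lambda>x. ((1 - x) ^ (p - 1) / fact (p - 1)) * Df p x) has_integral (G (One - h) - (\<Sum>i<p. P i h))) {0..1}"
      by simp
    have "norm (G (One - h) - (\<Sum>i<p. P i h)) \<le> (real p * \<kappa> ^ p * (M / (1 - \<kappa>))) * measure lborel (cbox 0 (1::real))"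
    proof (rule has_integral_bound)
      show "0 \<le> real p * \<kappa> ^ p * (M / (1 - \<kappa>))" using \<kappa> \<kappa>0 M0 by simp
      show "((\<lambda>x. ((1 - x) ^ (p - 1) / fact (p - 1)) * Df p x) has_integral (G (One - h) - (\<Sum>i<p. P i h))) (cbox 0 1)"
        using int by simp
      fix t :: real assume "t \<in> cbox 0 1"
      hence t: "0 \<le> t" "t \<le> 1" by auto
      define q where "q = One + t *\<^sub>R (- h)"
      have q: "q \<in> S" using inS[OF t] by (simp add: q_def)
      have t\<kappa>: "t * \<kappa> \<le> \<kappa>" using t \<kappa>0 by (simp add: mult_left_le_one_le)
      \<comment> \<open>The solution of \<kappa> (1 + lam t) = lam, so that h \<bullet> b \<le>
        \<kappa> implies h \<bullet> b \<le> lam (1 - t (h \<bullet> b)), the coordinate of lam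
        q.\<close>
      define lam where "lam = \<kappa> / (1 - t * \<kappa>)"
      have den: "0 < 1 - t * \<kappa>" using t\<kappa> \<kappa> by linarith
      have lam0: "0 \<le> lam" using \<kappa>0 den by (simp add: lam_def)
      have hq: "0 \<le> h \<bullet> b \<and> h \<bullet> b \<le> (lam *\<^sub>R q) \<bullet> b" if b: "b \<in> Basis" for b
      proof -
        have "h \<bullet> b * (1 + lam * t) \<le> \<kappa> * (1 + lam * t)" using h[OF b] lam0 t by (intro mult_right_mono) auto
        also have "\<kappa> * (1 + lam * t) = lam" using den by (simp add: lam_def field_simps)
        finally show ?thesis using b h[OF b] by (simp add: q_def inner_diff_left algebra_simps)
      qed
      have D: "Df p t = (- 1) ^ p * (dir_deriv h ^^ p) G q"
        using dir_deriv_pow_scale[OF smooth open_interior q, where \<alpha>="- 1" and v=h and n=p] by (simp add: Df_def q_def)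
      have "Df p t \<le> (- 1) ^ p * (dir_deriv (lam *\<^sub>R q) ^^ p) G q" "0 \<le> Df p t"
        unfolding D using dir_deriv_pow_mono[OF q hq] by auto
      moreover have "(- 1) ^ p * (dir_deriv (lam *\<^sub>R q) ^^ p) G q = lam ^ p * fact p * G q"
        unfolding dir_deriv_pow_scale[OF smooth open_interior q] Euler[OF q] by (simp add: mult_ac flip: power_mult_distrib)
      moreover have "lam ^ p * fact p * G q \<le> lam ^ p * fact p * M"
        using M[of t] t lam0 by (intro mult_left_mono) (auto simp: Df_def q_def)
      ultimately have b1: "0 \<le> Df p t" "Df p t \<le> lam ^ p * fact p * M"
        by linarith+
      have pf: "fact p = real p * fact (p - 1)" using p by (simp add: fact_reduce)
      have "norm ((1 - t) ^ (p - 1) / fact (p - 1) * Df p t) \<le> (1 - t) ^ (p - 1) / fact (p - 1) * (lam ^ p * fact p * M)"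
        using b1 t by (simp add: abs_mult) (intro divide_right_mono mult_left_mono, auto)
      also have "\<dots> = real p * M * lam * ((1 - t) * lam) ^ (p - 1)"
      proof -
        have "lam ^ p = lam * lam ^ (p - 1)" using p by (simp flip: power_Suc)
        thus ?thesis unfolding pf by (simp add: power_mult_distrib)
      qed
      \<comment> \<open>The Taylor weight tames the growth of lam: (1 - t) lam \<le> \<kappa> on all
        of [0, 1]. What is left is p \<kappa>^p, a null sequence.\<close>
      also have "\<dots> \<le> real p * M * (\<kappa> / (1 - \<kappa>)) * \<kappa> ^ (p - 1)"
      proof (intro mult_mono power_mono mult_left_mono)
        show "lam \<le> \<kappa> / (1 - \<kappa>)" unfolding lam_def using \<kappa> \<kappa>0 t\<kappa> by (intro divide_left_mono mult_pos_pos) auto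
        have "\<kappa> * (1 - t) \<le> \<kappa> * (1 - t * \<kappa>)" using \<kappa> \<kappa>0 t by (intro mult_left_mono) (auto simp: mult_left_le)
        thus "(1 - t) * lam \<le> \<kappa>" using den by (simp add: lam_def pos_divide_le_eq mult_ac)
      qed (use M0 lam0 t \<kappa> \<kappa>0 in auto)
      also have "\<dots> = real p * \<kappa> ^ p * (M / (1 - \<kappa>))"
      proof -
        have "\<kappa> ^ p = \<kappa> * \<kappa> ^ (p - 1)" using p by (simp flip: power_Suc)
        thus ?thesis by simp
      qed
      finally show "norm ((1 - t) ^ (p - 1) / fact (p - 1) * Df p t) \<le> real p * \<kappa> ^ p * (M / (1 - \<kappa>))" .
    qed
    thus ?thesis by simp
  qed
  have "(\<lambda>p. real p * \<kappa> ^ p * (M / (1 - \<kappa>))) \<longlonglongrightarrow> 0 * (M / (1 - \<kappa>))"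
    using \<kappa> \<kappa>0 by (intro tendsto_mult tendsto_const powser_times_n_limit_0) auto
  hence l0: "(\<lambda>p. real p * \<kappa> ^ p * (M / (1 - \<kappa>))) \<longlonglongrightarrow> 0" by (simp only: mult_zero_left)
  have "\<forall>\<^sub>F p in sequentially. norm ((\<Sum>i<p. P i h) - G (One - h)) \<le> real p * \<kappa> ^ p * (M / (1 - \<kappa>))"
    by (intro eventually_mono[OF eventually_gt_at_top[of "0 :: nat"]])
      (simp only: real_norm_def abs_minus_commute[of _ "G (One - h)"] remainder)
  from Lim_null_comparison[OF this l0] have "(\<lambda>p. (\<Sum>i<p. P i h) - G (One - h)) \<longlonglongrightarrow> 0" .
  thus ?thesis unfolding sums_def by (simp add: LIM_zero_iff)
qed

theorem representation:
  obtains \<rho> where "finite_measure \<rho>" "sets \<rho> = sets borel" "AE y in \<rho>. y \<in> unit_simplex"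
    "\<And>c. c \<in> interior nonneg_orthant \<Longrightarrow> G c = (\<integral>y. 1 / (c \<bullet> y) \<partial>\<rho>)"
proof -
  obtain \<rho> where \<rho>: "prob_space \<rho>" "sets \<rho> = sets borel" "AE y in \<rho>. y \<in> unit_simplex"
    and P: "\<And>h n. (\<And>b. b \<in> Basis \<Longrightarrow> 0 \<le> h \<bullet> b \<and> h \<bullet> b \<le> 1) \<Longrightarrow> P n h = G One * (\<integral>y. (h \<bullet> y) ^ n \<partial>\<rho>)"
    using limit_measure by blast
  interpret prob_space \<rho> by fact
  note [measurable_cong] = \<rho>(2)
  have G: "G c = G One * (\<integral>y. 1 / (c \<bullet> y) \<partial>\<rho>)" if c: "c \<in> S" for c
  proof -
    have cb: "0 < c \<bullet> b" if "b \<in> Basis" for b using c that by (simp add: mem_interior_nonneg_orthant)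
    \<comment> \<open>Dividing c by its coordinate sum makes h = One - c / lam satisfy 0 \<le> h
      \<bullet> b \<le> \<kappa> < 1, where the Taylor series converges; homogeneity removes the
      scaling at the end.\<close>
    define lam where "lam = (\<Sum>b\<in>Basis. c \<bullet> b)"
    have lam: "0 < lam" unfolding lam_def by (rule sum_pos) (use cb in auto)
    have clam: "c \<bullet> b \<le> lam" if "b \<in> Basis" for b
      unfolding lam_def using that cb by (intro member_le_sum) (auto intro: less_imp_le)
    define h where "h = One - c /\<^sub>R lam"
    have hb: "h \<bullet> b = 1 - c \<bullet> b / lam" if "b \<in> Basis" for b using that by (simp add: h_def inner_diff_left divide_inverse)
    define \<kappa> where "\<kappa> = Max ((\<lambda>b. h \<bullet> b) ` Basis)"
    have \<kappa>: "\<kappa> < 1" unfolding \<kappa>_def using lam cb by (subst Max_less_iff) (auto simp: hb)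
    have h: "0 \<le> h \<bullet> b \<and> h \<bullet> b \<le> \<kappa>" if "b \<in> Basis" for b
      using clam[OF that] lam that unfolding \<kappa>_def by (auto simp: hb)
    have h1: "0 \<le> h \<bullet> b \<and> h \<bullet> b \<le> 1" if "b \<in> Basis" for b using h[OF that] \<kappa> by simp
    have hy: "0 \<le> h \<bullet> y \<and> h \<bullet> y \<le> \<kappa>" if "y \<in> unit_simplex" for y
    proof -
      have "h \<bullet> y = (\<Sum>b\<in>Basis. (h \<bullet> b) * (y \<bullet> b))" by (rule euclidean_inner)
      moreover have "(\<Sum>b\<in>Basis. (h \<bullet> b) * (y \<bullet> b)) \<le> (\<Sum>b\<in>Basis. \<kappa> * (y \<bullet> b))"
        using h that by (intro sum_mono mult_right_mono) (auto simp: unit_simplex_def nonneg_orthant_def)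
      moreover have "(\<Sum>b\<in>Basis. \<kappa> * (y \<bullet> b)) = \<kappa> * (One \<bullet> y)"
        by (simp add: sum_distrib_left euclidean_inner[of One y])
      moreover have "0 \<le> (\<Sum>b\<in>Basis. (h \<bullet> b) * (y \<bullet> b))"
        using h that by (intro sum_nonneg mult_nonneg_nonneg) (auto simp: unit_simplex_def nonneg_orthant_def)
      ultimately show ?thesis using that by (simp add: unit_simplex_def)
    qed
    have "(\<lambda>k. \<integral>y. (h \<bullet> y) ^ k \<partial>\<rho>) sums (\<integral>y. 1 / (1 - h \<bullet> y) \<partial>\<rho>)"
    proof (rule integral_sums[where B="1 / (1 - \<kappa>)"])
      show "AE y in \<rho>. (\<lambda>k. (h \<bullet> y) ^ k) sums (1 / (1 - h \<bullet> y))" using \<rho>(3)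
        by eventually_elim (use hy \<kappa> in \<open>fastforce intro!: geometric_sums\<close>)
      show "AE y in \<rho>. \<bar>\<Sum>k<n. (h \<bullet> y) ^ k\<bar> \<le> 1 / (1 - \<kappa>)" for n using \<rho>(3)
      proof eventually_elim
        case (elim y)
        have "\<kappa> \<ge> 0" using hy[OF elim] by linarith
        have "\<bar>\<Sum>k<n. (h \<bullet> y) ^ k\<bar> \<le> (\<Sum>k<n. \<kappa> ^ k)"
          using hy[OF elim] by (intro order_trans[OF sum_abs] sum_mono) (auto simp: power_abs intro!: power_mono)
        also have "\<dots> \<le> (\<Sum>k. \<kappa> ^ k)" using \<kappa> \<open>\<kappa> \<ge> 0\<close> by (intro sum_le_suminf) (auto intro: summable_geometric)
        also have "\<dots> = 1 / (1 - \<kappa>)" using \<kappa> \<open>\<kappa> \<ge> 0\<close> by (subst suminf_geometric) auto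
        finally show ?case .
      qed
    qed simp_all
    from sums_mult[OF this, of "G One"] have "(\<lambda>k. P k h) sums (G One * (\<integral>y. 1 / (1 - h \<bullet> y) \<partial>\<rho>))"
      by (simp only: P[OF h1])
    with Taylor_expansion[OF \<kappa> h] have "G (One - h) = G One * (\<integral>y. 1 / (1 - h \<bullet> y) \<partial>\<rho>)" by (rule sums_unique2)
    moreover have "(\<integral>y. 1 / (1 - h \<bullet> y) \<partial>\<rho>) = lam * (\<integral>y. 1 / (c \<bullet> y) \<partial>\<rho>)"
      unfolding integral_mult_right_zero[symmetric]
    proof (rule integral_cong_AE)
      show "AE y in \<rho>. 1 / (1 - h \<bullet> y) = lam * (1 / (c \<bullet> y))" using \<rho>(3)
        by eventually_elim (simp add: unit_simplex_def h_def inner_diff_left divide_inverse)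
    qed measurable
    moreover have "G (One - h) = G c * lam"
      using homogeneous[OF c, of "inverse lam"] lam by (simp add: h_def divide_inverse)
    ultimately show ?thesis using lam by simp
  qed
  show ?thesis
  \<comment> \<open>\<open>limit_measure\<close> delivers a probability measure; the constant
    density restores the total mass.\<close>
  proof (rule that[of "density \<rho> (\<lambda>_. ennreal (G One))"])
    show "finite_measure (density \<rho> (\<lambda>_. ennreal (G One)))"
      by standard (simp add: emeasure_density nn_integral_cmult emeasure_space_1 ennreal_mult_eq_top_iff)
    show "AE y in density \<rho> (\<lambda>_. ennreal (G One)). y \<in> unit_simplex" using \<rho>(3) by (simp add: AE_density)
    show "G c = (\<integral>y. 1 / (c \<bullet> y) \<partial>density \<rho> (\<lambda>_. ennreal (G One)))" if "c \<in> interior nonneg_orthant" for c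
      using G[OF that] pos by (subst integral_density) (simp_all del: times_divide_eq_right)
  qed (simp add: \<rho>(2))
qed

end

section \<open>The multidimensional moment problem\<close>

lemma fold_dir_deriv_cong:
  assumes "open S" "\<And>y. y \<in> S \<Longrightarrow> f y = g y" "x \<in> S"
  shows "fold dir_deriv ws f x = fold dir_deriv ws g x"
  using assms(2)
proof (induction ws arbitrary: f g)
  case (Cons w ws)
  have "dir_deriv w f y = dir_deriv w g y" if "y \<in> S" for y
    by (rule dir_deriv_cong[OF assms(1) that Cons.prems])
  from Cons.IH[OF this] show ?case by simp
qed (simp add: assms(3))

lemma fold_dir_deriv_commute:
  fixes f :: "'a::euclidean_space \<Rightarrow> real"
  assumes "smooth_on S f" "open S" "x \<in> S"
  shows "dir_deriv v (fold dir_deriv ws f) x = fold dir_deriv ws (dir_deriv v f) x"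
  using assms(1)
proof (induction ws arbitrary: f)
  case (Cons w ws)
  have "dir_deriv v (fold dir_deriv (w # ws) f) x = fold dir_deriv ws (dir_deriv v (dir_deriv w f)) x"
    using Cons.IH[OF smooth_on_dir_deriv[OF Cons.prems]] by simp
  also have "\<dots> = fold dir_deriv ws (dir_deriv w (dir_deriv v f)) x"
    by (rule fold_dir_deriv_cong[OF assms(2) _ assms(3)]) (rule dir_deriv_commute[OF Cons.prems assms(2)])
  finally show ?case by simp
qed simp

text \<open>\<open>completely_monotonic\<close> speaks of t-derivatives taken before all others.
  Commuting derivatives sorts an arbitrary word over the product basis into this form.\<close>

lemma basis_word_reorder:
  fixes G :: "'a::euclidean_space \<times> real \<Rightarrow> real"
  assumes sm: "smooth_on S G" and S: "open S" and ws: "set ws \<subseteq> Basis"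
  shows "\<exists>bs j. set bs \<subseteq> Basis \<and> length bs + j = length ws \<and>
    (\<forall>x\<in>S. fold dir_deriv ws G x = fold (\<lambda>b. dir_deriv (b, 0)) bs ((dir_deriv (0, 1) ^^ j) G) x)"
  using ws
proof (induction ws rule: rev_induct)
  case Nil
  show ?case by (intro exI[of _ "[]"] exI[of _ 0]) simp
next
  case (snoc w ws)
  then obtain bs j where bj: "set bs \<subseteq> Basis" "length bs + j = length ws"
    "\<And>x. x \<in> S \<Longrightarrow> fold dir_deriv ws G x = fold (\<lambda>b. dir_deriv (b, 0)) bs ((dir_deriv (0, 1) ^^ j) G) x" by auto
  have fm: "fold (\<lambda>b. dir_deriv (b, 0)) bs f = fold dir_deriv (map (\<lambda>b. (b, 0)) bs) f" for bs and f :: "'a \<times> real \<Rightarrow> real"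
    by (simp add: fold_map o_def)
  have step: "fold dir_deriv (ws @ [w]) G x = dir_deriv w (fold (\<lambda>b. dir_deriv (b, 0)) bs ((dir_deriv (0, 1) ^^ j) G)) x" if "x \<in> S" for x
    using dir_deriv_cong[OF S that bj(3)] by simp
  have "w \<in> Basis" using snoc.prems by simp
  then consider b where "b \<in> Basis" "w = (b, 0)" | "w = (0, 1)" by (auto simp: Basis_prod_def)
  thus ?case
  proof cases
    case 1
    thus ?thesis using bj step by (intro exI[of _ "bs @ [b]"] exI[of _ j]) simp
  next
    case 2
    have "dir_deriv (0, 1) (fold (\<lambda>b. dir_deriv (b, 0)) bs ((dir_deriv (0, 1) ^^ j) G)) x
       = fold (\<lambda>b. dir_deriv (b, 0)) bs ((dir_deriv (0, 1) ^^ Suc j) G) x" if "x \<in> S" for x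
      unfolding fm using fold_dir_deriv_commute[OF smooth_on_dir_deriv_pow[OF sm] S that] by simp
    thus ?thesis using 2 bj step by (intro exI[of _ bs] exI[of _ "Suc j"]) simp
  qed
qed

lemma interior_nonneg_orthant_prod:
  "(interior nonneg_orthant :: ('a::euclidean_space \<times> real) set) = interior nonneg_orthant \<times> {0<..}"
  by (auto simp: mem_interior_prod)

lemma completely_monotonic_word_sign:
  fixes G :: "'a::euclidean_space \<times> real \<Rightarrow> real"
  assumes "completely_monotonic G" "set ws \<subseteq> Basis" "x \<in> interior nonneg_orthant"
  shows "0 \<le> (- 1) ^ length ws * fold dir_deriv ws G x"
proof -
  obtain a t where x: "x = (a, t)" "a \<in> interior nonneg_orthant" "t > 0"
    using assms(3) by (cases x) (auto simp: mem_interior_prod)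
  have sm: "smooth_on (interior nonneg_orthant \<times> {0<..}) G" using assms(1) by (simp add: completely_monotonic_def)
  have op: "open (interior (nonneg_orthant :: 'a set) \<times> {0 :: real<..})" by (intro open_Times) auto
  obtain bs j where bj: "set bs \<subseteq> Basis" "length bs + j = length ws"
    "\<forall>x\<in>interior nonneg_orthant \<times> {0<..}. fold dir_deriv ws G x = fold (\<lambda>b. dir_deriv (b, 0)) bs ((dir_deriv (0, 1) ^^ j) G) x"
    using basis_word_reorder[OF sm op assms(2)] by blast
  have "0 \<le> (- 1) ^ (length bs + j) * fold (\<lambda>b. dir_deriv (b, 0)) bs ((dir_deriv (0, 1) ^^ j) G) (a, t)"
    using assms(1) bj(1) x(2,3) unfolding completely_monotonic_def by blast
  thus ?thesis using bj(2,3) x by simp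
qed

text \<open>On the simplex n / ((One, n) \<bullet> y) equals n / (1 + (n - 1) snd y), which tends to
  1 / snd y, or to infinity on the face snd y = 0. Fatou's lemma and the bound make the limit
  integrable, so the face is a null set and the chart y \<mapsto> fst y / snd y leads back to the
  orthant.\<close>

lemma simplex_measure_converse:
  fixes \<rho> :: "('a::euclidean_space \<times> real) measure"
  assumes "finite_measure \<rho>" and sets: "sets \<rho> = sets borel" and AE: "AE y in \<rho>. y \<in> unit_simplex"
    and bound: "\<And>n :: nat. n > 0 \<Longrightarrow> real n * (\<integral>y. 1 / ((One, real n) \<bullet> y) \<partial>\<rho>) \<le> B"
  obtains \<nu> :: "'a measure" where "finite_measure \<nu>" "sets \<nu> = sets borel" "AE x in \<nu>. x \<in> nonneg_orthant"
    "\<And>a t. a \<in> interior nonneg_orthant \<Longrightarrow> t > 0 \<Longrightarrow> (\<integral>x. 1 / (a \<bullet> x + t) \<partial>\<nu>) = (\<integral>y. 1 / ((a, t) \<bullet> y) \<partial>\<rho>)"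
proof -
  interpret finite_measure \<rho> by fact
  note [measurable_cong] = sets
  have [measurable]: "(fst :: 'a \<times> real \<Rightarrow> 'a) \<in> borel_measurable borel" "(snd :: 'a \<times> real \<Rightarrow> real) \<in> borel_measurable borel"
    by (auto intro!: borel_measurable_continuous_onI continuous_intros)
  have simplex: "0 \<le> snd y" "fst y \<in> nonneg_orthant" "One \<bullet> fst y + snd y = 1" if "y \<in> unit_simplex" for y :: "'a \<times> real"
    using that mem_nonneg_orthant_prod[of "fst y" "snd y"] by (cases y, auto simp: unit_simplex_def One_prod)+
  \<comment> \<open>The value on the face is set explicitly, since 1 / 0 is 0.\<close>
  define g :: "'a \<times> real \<Rightarrow> ennreal" where "g y = (if snd y = 0 then \<top> else ennreal (1 / snd y))" for y
  define f :: "nat \<Rightarrow> 'a \<times> real \<Rightarrow> real" where "f n y = real (Suc n) * (1 / ((One, real (Suc n)) \<bullet> y))" for n y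
  have [measurable]: "g \<in> borel_measurable borel" unfolding g_def[abs_def] by measurable
  have [measurable]: "f n \<in> borel_measurable borel" for n unfolding f_def[abs_def] by measurable
  have den: "1 \<le> (One, real (Suc n)) \<bullet> y" if "y \<in> unit_simplex" for n and y :: "'a \<times> real"
  proof -
    have "(One, real (Suc n)) \<bullet> y = One \<bullet> fst y + real (Suc n) * snd y" by (cases y) simp
    also have "\<dots> = 1 + real n * snd y" using simplex(3)[OF that] by (simp add: algebra_simps)
    finally show ?thesis using simplex(1)[OF that] by simp
  qed
  have fpos: "0 \<le> f n y" "f n y \<le> real (Suc n)" if "y \<in> unit_simplex" for n and y :: "'a \<times> real"
    using den[OF that, of n] by (auto simp: f_def divide_le_eq mult_le_cancel_left1)
  have int_f: "integrable \<rho> (f n)" for n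
  proof (rule integrable_const_bound[of _ "real (Suc n)"])
    show "AE y in \<rho>. norm (f n y) \<le> real (Suc n)"
      using AE by eventually_elim (use fpos in \<open>simp add: abs_of_nonneg del: of_nat_Suc\<close>)
  qed simp
  have "(\<integral>\<^sup>+y. g y \<partial>\<rho>) \<le> (\<integral>\<^sup>+y. liminf (\<lambda>n. ennreal (f n y)) \<partial>\<rho>)"
  proof (rule nn_integral_mono_AE)
    show "AE y in \<rho>. g y \<le> liminf (\<lambda>n. ennreal (f n y))" using AE
    proof eventually_elim
      case (elim y)
      have "(\<lambda>n. ennreal (f n y)) \<longlonglongrightarrow> g y"
      proof (cases "snd y = 0")
        case True
        hence "f n y = real (Suc n)" for n using simplex(3)[OF elim] by (cases y) (simp add: f_def)
        moreover have "(\<lambda>n. ennreal (real (Suc n))) \<longlonglongrightarrow> \<top>"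
          using LIMSEQ_Suc[OF of_nat_tendsto_top_ennreal] by (simp only: ennreal_of_nat_eq_real_of_nat)
        ultimately show ?thesis using True by (simp add: g_def)
      next
        case False
        hence s: "snd y > 0" using simplex(1)[OF elim] by simp
        have "f n y = 1 / ((One \<bullet> fst y) * (1 / real (Suc n)) + snd y)" for n
          by (cases y) (simp add: f_def divide_simps, simp add: algebra_simps)
        moreover have "(\<lambda>n. 1 / ((One \<bullet> fst y) * (1 / real (Suc n)) + snd y)) \<longlonglongrightarrow> 1 / ((One \<bullet> fst y) * 0 + snd y)"
          using s by (intro tendsto_intros LIMSEQ_Suc[OF lim_1_over_n]) auto
        ultimately have "(\<lambda>n. f n y) \<longlonglongrightarrow> 1 / snd y" by simp
        thus ?thesis using False by (simp add: g_def tendsto_ennrealI)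
      qed
      thus ?case using lim_imp_Liminf[OF sequentially_bot] by (metis order_refl)
    qed
  qed
  also have "\<dots> \<le> liminf (\<lambda>n. \<integral>\<^sup>+y. ennreal (f n y) \<partial>\<rho>)" by (rule nn_integral_liminf) measurable
  also have "\<dots> \<le> ennreal B"
  proof (rule Liminf_le)
    show "\<forall>\<^sub>F n in sequentially. (\<integral>\<^sup>+y. ennreal (f n y) \<partial>\<rho>) \<le> ennreal B"
    proof (intro always_eventually allI)
      fix n
      have "(\<integral>\<^sup>+y. ennreal (f n y) \<partial>\<rho>) = ennreal (\<integral>y. f n y \<partial>\<rho>)"
        by (rule nn_integral_eq_integral[OF int_f]) (use AE in \<open>auto elim!: eventually_mono dest: fpos\<close>)
      also have "(\<integral>y. f n y \<partial>\<rho>) \<le> B" using bound[of "Suc n"] by (simp only: f_def integral_mult_right_zero zero_less_Suc)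
      finally show "(\<integral>\<^sup>+y. ennreal (f n y) \<partial>\<rho>) \<le> ennreal B" by (simp add: ennreal_leI)
    qed
  qed simp
  finally have gB: "(\<integral>\<^sup>+y. g y \<partial>\<rho>) \<le> ennreal B" .
  have gfin: "AE y in \<rho>. g y \<noteq> \<top>"
    by (rule nn_integral_PInf_AE[unfolded infinity_ennreal_def]) (use gB in \<open>auto simp: top_unique\<close>)
  have spos: "AE y in \<rho>. y \<in> unit_simplex \<and> 0 < snd y"
    using gfin AE by eventually_elim (use simplex(1) in \<open>auto simp: g_def less_le split: if_splits\<close>)
  define \<nu> where "\<nu> = distr (density \<rho> (\<lambda>y. ennreal (1 / snd y))) borel (\<lambda>y. fst y /\<^sub>R snd y)"
  show ?thesis
  proof (rule that[of \<nu>])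
    show "finite_measure \<nu>"
    proof
      have "(\<integral>\<^sup>+y. ennreal (1 / snd y) \<partial>\<rho>) = (\<integral>\<^sup>+y. g y \<partial>\<rho>)"
      proof (rule nn_integral_cong_AE)
        show "AE y in \<rho>. ennreal (1 / snd y) = g y" using spos by eventually_elim (simp add: g_def)
      qed
      hence "(\<integral>\<^sup>+y. ennreal (1 / snd y) \<partial>\<rho>) \<noteq> \<infinity>" using gB by (auto simp: top_unique)
      thus "emeasure \<nu> (space \<nu>) \<noteq> \<infinity>"
        by (simp add: \<nu>_def emeasure_distr emeasure_density)
    qed
    have cl: "(nonneg_orthant :: 'a set) \<in> sets borel" by (rule borel_closed[OF closed_nonneg_orthant])
    have sc: "fst y /\<^sub>R snd y \<in> nonneg_orthant" if "y \<in> unit_simplex" "0 < snd y" for y :: "'a \<times> real"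
      using simplex(2)[OF that(1)] that(2) by (simp add: nonneg_orthant_def)
    show "AE x in \<nu>. x \<in> nonneg_orthant"
    proof -
      have "AE y in \<rho>. fst y /\<^sub>R snd y \<in> nonneg_orthant" using spos by eventually_elim (use sc in blast)
      hence "AE y in density \<rho> (\<lambda>y. ennreal (1 / snd y)). fst y /\<^sub>R snd y \<in> nonneg_orthant"
        by (subst AE_density) (auto elim: eventually_mono)
      thus ?thesis unfolding \<nu>_def using cl by (subst AE_distr_iff) simp_all
    qed
    fix a :: 'a and t :: real assume a: "a \<in> interior nonneg_orthant" "t > 0"
    have "(\<integral>x. 1 / (a \<bullet> x + t) \<partial>\<nu>) = (\<integral>y. 1 / (a \<bullet> (fst y /\<^sub>R snd y) + t) \<partial>density \<rho> (\<lambda>y. ennreal (1 / snd y)))"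
      unfolding \<nu>_def by (rule integral_distr) measurable
    also have "\<dots> = (\<integral>y. (1 / snd y) * (1 / (a \<bullet> (fst y /\<^sub>R snd y) + t)) \<partial>\<rho>)"
    proof (subst integral_density)
      show "AE y in \<rho>. 0 \<le> 1 / snd y" using spos by eventually_elim simp
    qed simp_all
    also have "\<dots> = (\<integral>y. 1 / ((a, t) \<bullet> y) \<partial>\<rho>)"
    proof (rule integral_cong_AE)
      show "AE y in \<rho>. (1 / snd y) * (1 / (a \<bullet> (fst y /\<^sub>R snd y) + t)) = 1 / ((a, t) \<bullet> y)" using spos
      proof eventually_elim
        case (elim y)
        hence "(a, t) \<bullet> y = snd y * (a \<bullet> (fst y /\<^sub>R snd y) + t)" by (cases y) (simp add: distrib_left mult.commute)
        thus ?case by simp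
      qed
    qed measurable
    finally show "(\<integral>x. 1 / (a \<bullet> x + t) \<partial>\<nu>) = (\<integral>y. 1 / ((a, t) \<bullet> y) \<partial>\<rho>)" .
  qed (simp add: \<nu>_def)
qed

section \<open>One-dimensional moments from Weyl disks\<close>

lemma power_Suc_div_shift:
  fixes u :: real
  assumes "u + t \<noteq> 0"
  shows "u ^ Suc k / (u + t) = u ^ k - t * (u ^ k / (u + t))"
  using assms by (simp add: divide_simps) (simp add: algebra_simps)

lemma (in stieltjes_measure) res_recursion:
  assumes "t > 0" shows "integrable \<sigma> (\<lambda>u. u ^ k / (u + t))"
    and "(\<integral>u. u ^ Suc k / (u + t) \<partial>\<sigma>) = (\<integral>u. u ^ k \<partial>\<sigma>) - t * (\<integral>u. u ^ k / (u + t) \<partial>\<sigma>)"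
proof -
  show i: "integrable \<sigma> (\<lambda>u. u ^ k / (u + t))" for k
    using integrable_poly_resolvent[of "- t" "monom 1 k"] assms by (simp add: poly_monom)
  have "(\<integral>u. u ^ Suc k / (u + t) \<partial>\<sigma>) = (\<integral>u. u ^ k - t * (u ^ k / (u + t)) \<partial>\<sigma>)"
    by (rule integral_cong_AE)
      (use AE_nonneg assms in \<open>auto elim!: eventually_mono simp: power_Suc_div_shift measurable_eq simp del: power_Suc\<close>)
  thus "(\<integral>u. u ^ Suc k / (u + t) \<partial>\<sigma>) = (\<integral>u. u ^ k \<partial>\<sigma>) - t * (\<integral>u. u ^ k / (u + t) \<partial>\<sigma>)"
    using i integrable_power by (simp del: times_divide_eq_right)
qed

text \<open>All solutions share the asymptotic expansion at \<open>-\<infinity>\<close>, so a measure whose transform lies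
  in the Weyl disk at every negative point has the prescribed moments, although the solution
  realising the value may change with the point.\<close>

lemma moment_solutionsI_weyl:
  fixes \<theta> :: "real measure"
  assumes th: "finite_measure \<theta>" "sets \<theta> = sets borel" "AE u in \<theta>. 0 \<le> u" and sm: "stieltjes_measure \<sigma>"
    and weyl: "\<And>t. t > 0 \<Longrightarrow> \<exists>\<tau>\<in>moment_solutions \<sigma> {0..}. (\<integral>u. 1 / (u + t) \<partial>\<theta>) = (\<integral>u. 1 / (u + t) \<partial>\<tau>)"
  shows "\<theta> \<in> moment_solutions \<sigma> {0..}"
proof -
  interpret s: stieltjes_measure \<sigma> by (rule sm)
  interpret finite_measure \<theta> by (rule th(1))
  note [measurable_cong] = th(2)
  define s where "s n = (\<integral>u. u ^ n \<partial>\<sigma>)" for n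
  have main: "integrable \<theta> (\<lambda>u. u ^ n) \<and> (\<integral>u. u ^ n \<partial>\<theta>) = s n" for n
  proof (induction n rule: less_induct)
    case (less n)
    \<comment> \<open>The recursion climbs from the numerator 1 to u^n and uses only moments of
      order below n, known by the outer induction. The witness \<tau> stays tied to t.\<close>
    have J: "integrable \<theta> (\<lambda>u. u ^ k / (u + t)) \<and> (\<integral>u. u ^ k / (u + t) \<partial>\<theta>) = (\<integral>u. u ^ k / (u + t) \<partial>\<tau>)"
      if k: "k \<le> n" and t: "t > 0" and tau: "\<tau> \<in> moment_solutions \<sigma> {0..}" "(\<integral>u. 1 / (u + t) \<partial>\<theta>) = (\<integral>u. 1 / (u + t) \<partial>\<tau>)" for k t \<tau>
      using k
    proof (induction k)
      case 0
      have "integrable \<theta> (\<lambda>u. 1 / (u + t))"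
        by (rule integrable_const_bound[of _ "1 / t"]) (use th(3) t in \<open>auto elim!: eventually_mono intro!: divide_left_mono mult_pos_pos\<close>)
      thus ?case using tau(2) by simp
    next
      case (Suc k)
      interpret t: stieltjes_measure \<tau> by (rule moment_solutions_stieltjes[OF tau(1)])
      have IH: "integrable \<theta> (\<lambda>u. u ^ k / (u + t))" "(\<integral>u. u ^ k / (u + t) \<partial>\<theta>) = (\<integral>u. u ^ k / (u + t) \<partial>\<tau>)" using Suc by auto
      have mk: "integrable \<theta> (\<lambda>u. u ^ k)" "(\<integral>u. u ^ k \<partial>\<theta>) = s k" using less Suc.prems by auto
      have eq: "AE u in \<theta>. u ^ Suc k / (u + t) = u ^ k - t * (u ^ k / (u + t))"
        using th(3) by eventually_elim (rule power_Suc_div_shift, use t in simp)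
      have i: "integrable \<theta> (\<lambda>u. u ^ k - t * (u ^ k / (u + t)))" using IH mk by (simp del: times_divide_eq_right)
      have "integrable \<theta> (\<lambda>u. u ^ Suc k / (u + t))"
        by (rule integrable_cong_AE_imp[OF i]) (use eq in \<open>auto elim: eventually_mono\<close>)
      moreover have "(\<integral>u. u ^ Suc k / (u + t) \<partial>\<theta>) = (\<integral>u. u ^ k - t * (u ^ k / (u + t)) \<partial>\<theta>)"
        by (rule integral_cong_AE) (use eq in auto)
      moreover have "(\<integral>u. u ^ k - t * (u ^ k / (u + t)) \<partial>\<theta>) = s k - t * (\<integral>u. u ^ k / (u + t) \<partial>\<tau>)"
        using IH mk by (simp del: times_divide_eq_right)
      moreover have "(\<integral>u. u ^ k \<partial>\<tau>) = s k" using tau(1) by (simp add: s_def moment_solutions_real_iff)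
      ultimately show ?case using t.res_recursion(2)[OF t, of k] by simp
    qed
    \<comment> \<open>These functions increase to u^n for u \<ge> 0, so monotone convergence gives
      integrability of u^n together with its integral; \<open>Suc i\<close> keeps the parameter
      positive.\<close>
    define f where "f i u = real (Suc i) * (u ^ n / (u + real (Suc i)))" for i and u :: real
    have fi: "integrable \<theta> (f i)" for i
      using J[of n "real (Suc i)"] weyl[of "real (Suc i)"] unfolding f_def[abs_def] by (auto simp del: times_divide_eq_right of_nat_Suc)
    \<comment> \<open>Both bounds involve only moments common to all solutions, hence they survive
      that \<tau> changes with i.\<close>
    have fb: "s n - s (Suc n) * (1 / real (Suc i)) \<le> (\<integral>u. f i u \<partial>\<theta>)" "(\<integral>u. f i u \<partial>\<theta>) \<le> s n" for i
    proof -
      let ?t = "real (Suc i)"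
      obtain \<tau> where tau: "\<tau> \<in> moment_solutions \<sigma> {0..}" "(\<integral>u. 1 / (u + ?t) \<partial>\<theta>) = (\<integral>u. 1 / (u + ?t) \<partial>\<tau>)"
        using weyl[of ?t] by auto
      interpret t: stieltjes_measure \<tau> by (rule moment_solutions_stieltjes[OF tau(1)])
      have m: "(\<integral>u. u ^ k \<partial>\<tau>) = s k" for k using tau(1) by (simp add: s_def moment_solutions_real_iff)
      have e: "(\<integral>u. f i u \<partial>\<theta>) = ?t * (\<integral>u. u ^ n / (u + ?t) \<partial>\<tau>)"
        using J[OF order_refl _ tau] by (simp add: f_def del: of_nat_Suc times_divide_eq_right)
      have r: "?t * (\<integral>u. u ^ n / (u + ?t) \<partial>\<tau>) = s n - (\<integral>u. u ^ Suc n / (u + ?t) \<partial>\<tau>)"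
        using t.res_recursion(2)[of ?t n] m[of n] by simp
      have "0 \<le> (\<integral>u. u ^ Suc n / (u + ?t) \<partial>\<tau>)"
        by (rule integral_nonneg_AE) (use t.AE_nonneg in \<open>auto elim!: eventually_mono\<close>)
      thus "(\<integral>u. f i u \<partial>\<theta>) \<le> s n" unfolding e r by simp
      have "(\<integral>u. u ^ Suc n / (u + ?t) \<partial>\<tau>) \<le> (\<integral>u. u ^ Suc n * (1 / ?t) \<partial>\<tau>)"
      proof (rule integral_mono_AE)
        show "AE u in \<tau>. u ^ Suc n / (u + ?t) \<le> u ^ Suc n * (1 / ?t)" using t.AE_nonneg
        proof eventually_elim
          case (elim u)
          have "1 / (u + ?t) \<le> 1 / ?t" using elim by (intro divide_left_mono) auto
          from mult_left_mono[OF this, of "u ^ Suc n"] elim show ?case by simp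
        qed
      qed (use t.res_recursion(1)[of ?t "Suc n"] t.integrable_power[of "Suc n"] in auto)
      also have "\<dots> = s (Suc n) * (1 / ?t)" using m[of "Suc n"] by (simp only: integral_mult_left_zero)
      finally show "s n - s (Suc n) * (1 / ?t) \<le> (\<integral>u. f i u \<partial>\<theta>)" unfolding e r by simp
    qed
    have flim: "(\<lambda>i. \<integral>u. f i u \<partial>\<theta>) \<longlonglongrightarrow> s n"
    proof (rule real_tendsto_sandwich)
      show "\<forall>\<^sub>F i in sequentially. s n - s (Suc n) * (1 / real (Suc i)) \<le> (\<integral>u. f i u \<partial>\<theta>)"
        by (intro always_eventually allI fb)
      show "\<forall>\<^sub>F i in sequentially. (\<integral>u. f i u \<partial>\<theta>) \<le> s n" by (intro always_eventually allI fb)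
      have "(\<lambda>i. s n - s (Suc n) * (1 / real (Suc i))) \<longlonglongrightarrow> s n - s (Suc n) * 0"
        by (intro tendsto_intros LIMSEQ_Suc[OF lim_1_over_n])
      thus "(\<lambda>i. s n - s (Suc n) * (1 / real (Suc i))) \<longlonglongrightarrow> s n" by simp
    qed simp
    have mono: "AE u in \<theta>. mono (\<lambda>i. f i u)" using th(3)
    proof eventually_elim
      case (elim u)
      show ?case
      proof (intro incseq_SucI)
        fix i
        have "real (Suc i) / (u + real (Suc i)) \<le> real (Suc (Suc i)) / (u + real (Suc (Suc i)))"
          using elim by (simp add: divide_simps) (simp add: algebra_simps)
        from mult_left_mono[OF this, of "u ^ n"] elim show "f i u \<le> f (Suc i) u"
          by (simp add: f_def mult.commute)
      qed
    qed
    have lim: "AE u in \<theta>. (\<lambda>i. f i u) \<longlonglongrightarrow> u ^ n" using th(3)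
    proof eventually_elim
      case (elim u)
      have "f i u = u ^ n / (u * (1 / real (Suc i)) + 1)" for i
        using elim by (simp add: f_def divide_simps)
      moreover have "(\<lambda>i. u ^ n / (u * (1 / real (Suc i)) + 1)) \<longlonglongrightarrow> u ^ n / (u * 0 + 1)"
        by (intro tendsto_intros LIMSEQ_Suc[OF lim_1_over_n]) auto
      ultimately show ?case by simp
    qed
    have meas: "(\<lambda>u. u ^ n) \<in> borel_measurable \<theta>" by measurable
    show ?case using integrable_monotone_convergence[OF fi mono lim flim meas] integral_monotone_convergence[OF fi mono lim flim meas] by simp
  qed
  thus ?thesis using th unfolding moment_solutions_real_iff moment_measures_real_iff by (simp add: s_def)
qed

text \<open>Zeros of E are isolated unless E vanishes identically; in that case division by 0 makes
  f equal to 0. Isolated zeros are removable singularities because f is continuous.\<close>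

lemma holomorphic_fraction_of_continuous:
  assumes S: "open S" "connected S" and hol: "N holomorphic_on S" "E holomorphic_on S"
    and f: "continuous_on S f" "\<And>z. z \<in> S \<Longrightarrow> f z = - (N z / E z)"
  shows "f holomorphic_on S"
proof (cases "\<forall>z\<in>S. E z = 0")
  case True
  hence "f z = 0" if "z \<in> S" for z using f(2)[OF that] that by simp
  thus ?thesis by (simp cong: holomorphic_cong)
next
  case False
  then obtain \<beta> where \<beta>: "\<beta> \<in> S" "E \<beta> \<noteq> 0" by blast
  show ?thesis
  proof (rule holomorphic_onI)
    fix z assume z: "z \<in> S"
    obtain r where r: "r > 0" "ball z r \<subseteq> S" "\<And>y. y \<in> ball z r - {z} \<Longrightarrow> E y \<noteq> 0"
    proof (cases "E z = 0")
      case True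
      thus ?thesis using isolated_zeros[OF hol(2) S z True \<beta>] that by metis
    next
      case False
      have "open (S \<inter> E -` (- {0}))"
        using continuous_open_preimage[OF holomorphic_on_imp_continuous_on[OF hol(2)] S(1)] by (metis open_Compl closed_singleton)
      moreover have "z \<in> S \<inter> E -` (- {0})" using z False by simp
      ultimately obtain r where "r > 0" "ball z r \<subseteq> S \<inter> E -` (- {0})" using open_contains_ball by metis
      hence "r > 0" "ball z r \<subseteq> S" "\<And>y. y \<in> ball z r - {z} \<Longrightarrow> E y \<noteq> 0" by blast+
      thus ?thesis using that by metis
    qed
    have "(\<lambda>y. - (N y / E y)) holomorphic_on (ball z r - {z})"
      using r by (intro holomorphic_intros holomorphic_on_subset[OF hol(1)] holomorphic_on_subset[OF hol(2)]) auto
    hence "f holomorphic_on (ball z r - {z})"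
      by (rule holomorphic_transform) (use f(2) r(2) in auto)
    hence "f holomorphic_on ball z r"
      by (rule no_isolated_singularity[OF continuous_on_subset[OF f(1) r(2)]]) simp_all
    moreover have "z \<in> ball z r" using r(1) by simp
    ultimately have "f field_differentiable at z" by (metis holomorphic_on_imp_differentiable_at open_ball)
    thus "f field_differentiable at z within S" by (rule field_differentiable_at_within)
  qed
qed

section \<open>Mixed moments from the moments of projections\<close>

context orthant_measure
begin

lemma integrable_prod_inner: "integrable \<nu> (\<lambda>x. prod_list (map (\<lambda>v. v \<bullet> x) vs))"
proof (rule Bochner_Integration.integrable_bound)
  show "integrable \<nu> (\<lambda>x. prod_list (map norm vs) * (1 + norm x) ^ length vs)"
    using integrable_one_plus_norm_power by simp
  have "(\<lambda>x. prod_list (map (\<lambda>v. v \<bullet> x) vs)) \<in> borel_measurable borel"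
    by (induction vs) auto
  thus "(\<lambda>x. prod_list (map (\<lambda>v. v \<bullet> x) vs)) \<in> borel_measurable \<nu>" by (simp only: measurable_eq)
  have "\<bar>prod_list (map (\<lambda>v. v \<bullet> x) vs)\<bar> \<le> prod_list (map norm vs) * (1 + norm x) ^ length vs \<and> 0 \<le> prod_list (map norm vs)" for x
  proof (induction vs)
    case (Cons v vs)
    have "\<bar>v \<bullet> x\<bar> \<le> norm v * norm x" by (rule Cauchy_Schwarz_ineq2)
    also have "\<dots> \<le> norm v * (1 + norm x)" by (intro mult_left_mono) auto
    finally have "\<bar>v \<bullet> x\<bar> * \<bar>prod_list (map (\<lambda>v. v \<bullet> x) vs)\<bar> \<le> (norm v * (1 + norm x)) * (prod_list (map norm vs) * (1 + norm x) ^ length vs)"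
      using Cons by (intro mult_mono) auto
    thus ?case using Cons by (simp add: abs_mult mult_ac)
  qed simp
  thus "AE x in \<nu>. norm (prod_list (map (\<lambda>v. v \<bullet> x) vs)) \<le> norm (prod_list (map norm vs) * (1 + norm x) ^ length vs)"
    by (auto intro!: always_eventually intro: order_trans[OF _ abs_ge_self])
qed

end

text \<open>Polarisation: the moments along the rays of an open cone determine all mixed moments. Each
  step compares the linear coefficients of polynomials in \<open>r\<close> along \<open>a + r v\<close>.\<close>

lemma mixed_moments_eq:
  assumes "orthant_measure \<mu>" "orthant_measure \<nu>"
    and eq: "\<And>a k. a \<in> interior nonneg_orthant \<Longrightarrow> (\<integral>x. (a \<bullet> x) ^ k \<partial>\<nu>) = (\<integral>x. (a \<bullet> x) ^ k \<partial>\<mu>)"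
    and ws: "set ws \<subseteq> nonneg_orthant" and a: "a \<in> interior nonneg_orthant"
  shows "(\<integral>x. (a \<bullet> x) ^ k * prod_list (map (\<lambda>v. v \<bullet> x) ws) \<partial>\<nu>) = (\<integral>x. (a \<bullet> x) ^ k * prod_list (map (\<lambda>v. v \<bullet> x) ws) \<partial>\<mu>)"
  using ws a
proof (induction ws arbitrary: a k)
  case Nil
  thus ?case by (simp add: eq)
next
  case (Cons v ws)
  interpret m: orthant_measure \<mu> by fact
  interpret n: orthant_measure \<nu> by fact
  let ?W = "\<lambda>x. prod_list (map (\<lambda>v. v \<bullet> x) ws)"
  have int: "integrable \<mu> (\<lambda>x. (v \<bullet> x) ^ i * (a \<bullet> x) ^ j * ?W x)" "integrable \<nu> (\<lambda>x. (v \<bullet> x) ^ i * (a \<bullet> x) ^ j * ?W x)" for i j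
    using m.integrable_prod_inner[of "replicate i v @ replicate j a @ ws"] n.integrable_prod_inner[of "replicate i v @ replicate j a @ ws"]
    by (simp_all add: mult.assoc)
  define c where "c i = real (Suc k choose i) * ((\<integral>x. (v \<bullet> x) ^ i * (a \<bullet> x) ^ (Suc k - i) * ?W x \<partial>\<nu>) - (\<integral>x. (v \<bullet> x) ^ i * (a \<bullet> x) ^ (Suc k - i) * ?W x \<partial>\<mu>))" for i
  \<comment> \<open>Up to the factor k + 1 the linear coefficient is the difference of the integrals
    with one more factor v \<bullet> x; the exponent \<open>Suc k\<close> provides the factor a
    \<bullet> x traded for it.\<close>
  have "c 1 = 0"
  proof (rule power_series_zeroI[of 1])
    fix r :: real assume r: "0 \<le> r" "r < 1"
    have ar: "a + r *\<^sub>R v \<in> interior nonneg_orthant"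
      unfolding mem_interior_nonneg_orthant
    proof
      fix b :: 'a assume b: "b \<in> Basis"
      have "0 < a \<bullet> b" using Cons.prems(2) b unfolding mem_interior_nonneg_orthant by blast
      moreover have "0 \<le> v \<bullet> b" using Cons.prems(1) b by (simp add: nonneg_orthant_def)
      ultimately show "0 < (a + r *\<^sub>R v) \<bullet> b" using r by (simp add: inner_add_left add_pos_nonneg)
    qed
    have exp: "((a + r *\<^sub>R v) \<bullet> x) ^ Suc k * ?W x = (\<Sum>i\<le>Suc k. real (Suc k choose i) * r ^ i * ((v \<bullet> x) ^ i * (a \<bullet> x) ^ (Suc k - i) * ?W x))" for x
    proof -
      have "((a + r *\<^sub>R v) \<bullet> x) ^ Suc k = (r * (v \<bullet> x) + a \<bullet> x) ^ Suc k" by (simp add: inner_add_left add.commute)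
      also have "\<dots> = (\<Sum>i\<le>Suc k. real (Suc k choose i) * (r * (v \<bullet> x)) ^ i * (a \<bullet> x) ^ (Suc k - i))" by (rule binomial_ring)
      finally show ?thesis by (simp only: sum_distrib_right sum_distrib_left power_mult_distrib mult_ac)
    qed
    have "(\<integral>x. ((a + r *\<^sub>R v) \<bullet> x) ^ Suc k * ?W x \<partial>\<nu>) = (\<integral>x. ((a + r *\<^sub>R v) \<bullet> x) ^ Suc k * ?W x \<partial>\<mu>)"
      using Cons.IH[OF _ ar, of "Suc k"] Cons.prems by simp
    hence "(\<Sum>i\<le>Suc k. c i * r ^ i) = 0"
      unfolding exp using int by (simp only: Bochner_Integration.integral_sum integrable_mult_right integral_mult_right_zero)
        (simp add: c_def right_diff_distrib left_diff_distrib sum_subtractf mult_ac)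
    moreover have "(\<lambda>i. c i * r ^ i) sums (\<Sum>i\<le>Suc k. c i * r ^ i)"
      by (rule sums_finite) (auto simp: c_def binomial_eq_0)
    ultimately show "(\<lambda>i. c i * r ^ i) sums 0" by simp
  qed simp
  hence "(\<integral>x. (v \<bullet> x) * (a \<bullet> x) ^ k * ?W x \<partial>\<nu>) = (\<integral>x. (v \<bullet> x) * (a \<bullet> x) ^ k * ?W x \<partial>\<mu>)"
    by (simp add: c_def)
  thus ?case by (simp add: mult_ac)
qed

lemma monomial_word_exists: "\<exists>ws. set ws \<subseteq> Basis \<and> (\<forall>x. monomial \<alpha> x = prod_list (map ((\<bullet>) x) ws))"
proof -
  have "\<exists>ws. set ws \<subseteq> A \<and> (\<forall>b\<in>A. count_list ws b = \<alpha> b)" if "finite A" for A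
    using that
  proof induction
    case (insert b A)
    then obtain ws where ws: "set ws \<subseteq> A" "\<forall>b\<in>A. count_list ws b = \<alpha> b" by blast
    have "b \<notin> set ws" using ws(1) insert.hyps by blast
    hence "count_list ws b = 0" by (simp add: count_list_0_iff)
    moreover have "count_list (replicate n c) d = (if c = d then n else 0)" for n and c d :: 'a by (induction n) auto
    ultimately show ?case using ws insert.hyps
      by (intro exI[of _ "replicate (\<alpha> b) b @ ws"]) (auto simp: set_replicate_conv_if)
  qed simp
  from this[OF finite_Basis] obtain ws where "set ws \<subseteq> Basis" "\<forall>b\<in>Basis. count_list ws b = \<alpha> b" by blast
  thus ?thesis by (intro exI[of _ ws]) (auto simp: prod_list_basis_word monomial_def intro!: prod.cong)
qed

lemma push_forward_sets [simp]: "sets (push_forward a \<nu>) = sets borel"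
  by (simp add: push_forward_def)

lemma push_forward_measurable: "(\<lambda>x. a \<bullet> x) \<in> measurable \<nu> borel" if "sets \<nu> = sets (borel :: 'a::euclidean_space measure)"
  using that by (simp cong: measurable_cong_sets)

lemma
  fixes f :: "real \<Rightarrow> 'b::{banach, second_countable_topology}" and \<nu> :: "'a::euclidean_space measure"
  assumes "sets \<nu> = sets borel" "f \<in> borel_measurable borel"
  shows integrable_push_forward: "integrable (push_forward a \<nu>) f \<longleftrightarrow> integrable \<nu> (\<lambda>x. f (a \<bullet> x))"
    and integral_push_forward: "(\<integral>u. f u \<partial>push_forward a \<nu>) = (\<integral>x. f (a \<bullet> x) \<partial>\<nu>)"
  unfolding push_forward_def using assms push_forward_measurable[OF assms(1), of a]
  by (auto intro!: integrable_distr_eq integral_distr)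

lemma push_forward_AE_nonneg:
  assumes "sets \<nu> = sets (borel :: 'a::euclidean_space measure)" "AE x in \<nu>. x \<in> nonneg_orthant" "a \<in> nonneg_orthant"
  shows "AE u in push_forward a \<nu>. 0 \<le> u"
  unfolding push_forward_def
  by (subst AE_distr_iff[OF push_forward_measurable[OF assms(1)]])
    (use assms inner_nonneg_orthant in \<open>auto elim!: eventually_mono\<close>)

context orthant_measure
begin

lemma push_forward_moment_measure:
  assumes "a \<in> nonneg_orthant" shows "push_forward a \<nu> \<in> moment_measures {0..}"
  unfolding moment_measures_real_iff
  using push_forward_AE_nonneg[OF sets_eq AE_orthant assms] integrable_inner_power
  by (simp add: integrable_push_forward[OF sets_eq])

lemma push_forward_solution:
  assumes \<theta>: "\<theta> \<in> moment_solutions \<nu> nonneg_orthant" and a: "a \<in> nonneg_orthant"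
  shows "push_forward a \<theta> \<in> moment_solutions (push_forward a \<nu>) {0..}"
proof -
  interpret t: orthant_measure \<theta> using \<theta> by unfold_locales (simp add: moment_solutions_def)
  have e: "(a \<bullet> x) ^ n = (\<Sum>ws\<in>basis_words n. prod_list (map ((\<bullet>) a) ws) * monomial (count_list ws) x)" for n x
    by (auto simp: inner_power_words basis_words_def prod_list_basis_word intro!: sum.cong)
  have "(\<integral>x. (a \<bullet> x) ^ n \<partial>\<theta>) = (\<integral>x. (a \<bullet> x) ^ n \<partial>\<nu>)" for n
    unfolding e using \<theta> integrable_monomial t.integrable_monomial by (simp add: moment_solutions_def)
  thus ?thesis using t.push_forward_moment_measure[OF a]
    by (simp add: moment_solutions_real_iff integral_push_forward[OF sets_eq] integral_push_forward[OF t.sets_eq])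
qed

lemma stieltjes_transform_push_forward:
  assumes "(a, z) \<in> transform_domain"
  shows "stieltjes_transform \<nu> (a, z) = (\<integral>t. 1 / (complex_of_real t - z) \<partial>push_forward a \<nu>)"
  using assms by (subst integral_push_forward[OF sets_eq]) (simp_all add: stieltjes_transform_def)

text \<open>Integrability comes first: on the orthant a monomial of degree n is at most (One
  \<bullet> x)^n, a power of one projection. The mixed moments then agree by polarisation at
  \<open>One\<close> with exponent 0.\<close>

lemma moment_solutionsI_push_forward:
  fixes \<theta> :: "'a measure"
  assumes sets: "sets \<theta> = sets borel" and AE: "AE x in \<theta>. x \<in> nonneg_orthant"
    and pf: "\<And>a. a \<in> interior nonneg_orthant \<Longrightarrow> push_forward a \<theta> \<in> moment_solutions (push_forward a \<nu>) {0..}"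
  shows "\<theta> \<in> moment_solutions \<nu> nonneg_orthant"
proof -
  have int: "integrable \<theta> (\<lambda>x. (a \<bullet> x) ^ n)" if "a \<in> interior nonneg_orthant" for a n
    using pf[OF that] by (simp add: moment_solutions_real_iff moment_measures_real_iff integrable_push_forward[OF sets])
  have eq: "(\<integral>x. (a \<bullet> x) ^ n \<partial>\<theta>) = (\<integral>x. (a \<bullet> x) ^ n \<partial>\<nu>)" if "a \<in> interior nonneg_orthant" for a n
    using pf[OF that] by (simp add: moment_solutions_real_iff integral_push_forward[OF sets] integral_push_forward[OF sets_eq])
  have sp: "space \<theta> = UNIV" using sets_eq_imp_space_eq[OF sets] by simp
  have "integrable \<theta> (monomial \<alpha>)" for \<alpha>
  proof (rule Bochner_Integration.integrable_bound[OF int[OF One_in_interior, of "\<Sum>b\<in>Basis. \<alpha> b"]])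
    have "monomial \<alpha> \<in> borel_measurable borel" unfolding monomial_def[abs_def] by measurable
    thus "monomial \<alpha> \<in> borel_measurable \<theta>" using sets by (simp cong: measurable_cong_sets)
    show "AE x in \<theta>. norm (monomial \<alpha> x) \<le> norm ((One \<bullet> x) ^ (\<Sum>b\<in>Basis. \<alpha> b))" using AE
    proof eventually_elim
      case (elim x)
      have x: "0 \<le> x \<bullet> b" if "b \<in> Basis" for b using elim that by (simp add: nonneg_orthant_def)
      have le: "x \<bullet> b \<le> One \<bullet> x" if "b \<in> Basis" for b
        using Basis_le_norm[OF that, of x] norm_le_One_inner[OF elim] by simp
      have "monomial \<alpha> x \<le> (\<Prod>b\<in>Basis. (One \<bullet> x) ^ \<alpha> b)"
        unfolding monomial_def using x le by (intro prod_mono) (auto intro!: power_mono)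
      also have "\<dots> = (One \<bullet> x) ^ (\<Sum>b\<in>Basis. \<alpha> b)" by (rule power_sum[symmetric])
      finally show ?case using x by (simp add: monomial_def prod_nonneg)
    qed
  qed
  moreover have "emeasure \<theta> (- nonneg_orthant) = 0"
  proof -
    have m: "- nonneg_orthant \<in> sets \<theta>" unfolding sets by (intro borel_comp borel_closed closed_nonneg_orthant)
    thus ?thesis using AE AE_iff_measurable[OF m, of "\<lambda>x. x \<in> nonneg_orthant"] sp by auto
  qed
  ultimately have mmt: "\<theta> \<in> moment_measures nonneg_orthant" using sets by (simp add: moment_measures_def)
  then interpret t: orthant_measure \<theta> by unfold_locales
  have "(\<integral>x. monomial \<alpha> x \<partial>\<theta>) = (\<integral>x. monomial \<alpha> x \<partial>\<nu>)" for \<alpha>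
  proof -
    obtain ws where ws: "set ws \<subseteq> (Basis :: 'a set)" "\<And>x. monomial \<alpha> x = prod_list (map ((\<bullet>) x) ws)"
      using monomial_word_exists[of \<alpha>] by blast
    have "set ws \<subseteq> nonneg_orthant" using ws(1) by (auto simp: nonneg_orthant_def inner_Basis subset_iff)
    from mixed_moments_eq[OF orthant_measure_axioms t.orthant_measure_axioms eq this One_in_interior, of 0]
    show ?thesis by (simp add: ws(2) inner_commute)
  qed
  thus ?thesis using mmt by (simp add: moment_solutions_def)
qed

end

section \<open>Assembly of the correspondence\<close>

lemma minus_one_islimpt_negative: "- 1 islimpt (complex_of_real ` {..<0})"
  unfolding islimpt_approachable
proof (intro allI impI)
  fix e :: real assume e: "e > 0"
  have "complex_of_real (- 1 - e / 2) \<noteq> - 1" using e by (metis add_diff_cancel_left' add_0_right diff_eq_eq less_irrefl half_gt_zero of_real_1 of_real_eq_iff of_real_minus minus_diff_eq diff_zero)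
  moreover have "dist (complex_of_real (- 1 - e / 2)) (- 1) < e"
    using e by (simp add: dist_norm)
  ultimately show "\<exists>x'\<in>complex_of_real ` {..<0}. x' \<noteq> - 1 \<and> dist x' (- 1) < e"
    using e by (intro bexI[of _ "complex_of_real (- 1 - e / 2)"] conjI imageI) (simp_all only: lessThan_iff, simp)
qed

text \<open>Positivity lets the function G be normalised at \<open>One\<close>; the bound on t times
  the value is what excludes mass at infinity in \<open>simplex_measure_converse\<close>.\<close>

lemma (in indeterminate_measure) weyl_disk_negative:
  assumes "w \<in> weyl_disk \<sigma> (- complex_of_real t)" "t > 0"
  obtains \<tau> where "\<tau> \<in> moment_solutions \<sigma> {0..}" "w = complex_of_real (\<integral>u. 1 / (u + t) \<partial>\<tau>)"
    "0 < (\<integral>u. 1 / (u + t) \<partial>\<tau>)" "t * (\<integral>u. 1 / (u + t) \<partial>\<tau>) \<le> mean \<sigma> 1"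
proof -
  obtain \<tau> where tau: "\<tau> \<in> moment_solutions \<sigma> {0..}" "w = (\<integral>u. 1 / (complex_of_real u - - complex_of_real t) \<partial>\<tau>)"
    using assms(1) unfolding weyl_disk_def by blast
  interpret t: stieltjes_measure \<tau> by (rule moment_solutions_stieltjes[OF tau(1)])
  have w: "w = complex_of_real (\<integral>u. 1 / (u + t) \<partial>\<tau>)"
    unfolding tau(2) integral_complex_of_real[symmetric] by simp
  have m1: "(\<integral>u. 1 \<partial>\<tau>) = mean \<sigma> 1" using fun_cong[OF mean_unique[OF tau(1)], of 1] by (simp add: mean_def)
  have i: "integrable \<tau> (\<lambda>u. 1 / (u + t))" using t.res_recursion(1)[OF assms(2), of 0] by simp
  have nn: "AE u in \<tau>. 0 \<le> 1 / (u + t)" using t.AE_nonneg assms(2) by (auto elim!: eventually_mono)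
  have "(\<integral>u. 1 / (u + t) \<partial>\<tau>) \<noteq> 0"
  proof
    assume "(\<integral>u. 1 / (u + t) \<partial>\<tau>) = 0"
    hence "AE u in \<tau>. 1 / (u + t) = 0" using integral_nonneg_eq_0_iff_AE[OF i nn] by simp
    hence "AE u in \<tau>. (1 :: real) = 0" using t.AE_nonneg by eventually_elim (use assms(2) in auto)
    hence "(\<integral>u. 1 \<partial>\<tau>) = (0 :: real)" by (rule integral_eq_zero_AE)
    thus False using m1 mean_1_pos by simp
  qed
  moreover have "t * (\<integral>u. 1 / (u + t) \<partial>\<tau>) \<le> (\<integral>u. 1 \<partial>\<tau>)"
    unfolding integral_mult_right_zero[symmetric]
  proof (rule integral_mono_AE)
    show "AE u in \<tau>. t * (1 / (u + t)) \<le> 1" using t.AE_nonneg by eventually_elim (use assms(2) in simp)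
  qed (use i in \<open>simp_all del: times_divide_eq_right\<close>)
  ultimately show ?thesis using that[OF tau(1) w] integral_nonneg_AE[OF nn] m1 by simp
qed

theorem theorem26:
  fixes \<mu> :: "(real ^ 'n) measure"
  assumes "\<mu> \<in> moment_measures nonneg_orthant"
    and "\<And>a. a \<in> interior nonneg_orthant \<Longrightarrow> \<not> determinate (push_forward a \<mu>) {0..}"
  shows "bij_betw stieltjes_transform (moment_solutions \<mu> nonneg_orthant)
    {F \<in> extensional transform_domain.
       smooth_on transform_domain F \<and>
       (\<forall>(a, z) \<in> transform_domain. \<forall>r>0.
          F (r *\<^sub>R a, complex_of_real r * z) = complex_of_real (inverse r) * F (a, z)) \<and>
       (\<forall>(a, z) \<in> transform_domain. F (a, z) \<in> weyl_disk (push_forward a \<mu>) z) \<and>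
       (\<exists>\<Psi>. \<forall>a \<in> interior nonneg_orthant.
          nevanlinna (\<Psi> a) \<and>
          analytic_off_nonneg_ge (nev_d0 (push_forward a \<mu>)) (\<Psi> a) \<and>
          (\<forall>z \<in> - \<real>\<^sub>\<ge>\<^sub>0. F (a, z) = nevanlinna_fraction (push_forward a \<mu>) (\<Psi> a) z)) \<and>
       (\<forall>a \<in> interior nonneg_orthant. \<forall>t>0. F (a, - complex_of_real t) \<in> \<real>) \<and>
       completely_monotonic (\<lambda>(a, t). Re (F (a, - complex_of_real t)))}"
    (is "bij_betw _ _ ?T")
proof -
  interpret m: orthant_measure \<mu> using assms(1) by unfold_locales
  have ind: "indeterminate_measure (push_forward a \<mu>)" if "a \<in> interior nonneg_orthant" for a
    using m.push_forward_moment_measure[OF interior_nonneg_orthant_subset[OF that]] assms(2)[OF that]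
    by (simp add: indeterminate_measure_def indeterminate_measure_axioms_def stieltjes_measure_def)
  have om: "orthant_measure \<nu>" if "\<nu> \<in> moment_solutions \<mu> nonneg_orthant" for \<nu>
    using that by unfold_locales (simp add: moment_solutions_def)
  have maps: "stieltjes_transform \<nu> \<in> ?T" if \<nu>: "\<nu> \<in> moment_solutions \<mu> nonneg_orthant" for \<nu>
  proof -
    interpret n: orthant_measure \<nu> by (rule om[OF \<nu>])
    let ?F = "stieltjes_transform \<nu>"
    have sol: "push_forward a \<nu> \<in> moment_solutions (push_forward a \<mu>) {0..}" if "a \<in> interior nonneg_orthant" for a
      by (rule m.push_forward_solution[OF \<nu> interior_nonneg_orthant_subset[OF that]])
    have 1: "?F \<in> extensional transform_domain" by (simp add: stieltjes_transform_def)
    have 2: "?F (r *\<^sub>R a, complex_of_real r * z) = complex_of_real (inverse r) * ?F (a, z)"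
      if "(a, z) \<in> transform_domain" "r > 0" for a z r
    proof -
      have "complex_of_real r * z \<notin> \<real>\<^sub>\<ge>\<^sub>0"
        using that by (auto simp: transform_domain_def complex_nonneg_Reals_iff zero_le_mult_iff)
      hence "(r *\<^sub>R a, complex_of_real r * z) \<in> transform_domain"
        using that by (simp add: transform_domain_def mem_interior_nonneg_orthant)
      moreover have "1 / (complex_of_real ((r *\<^sub>R a) \<bullet> x) - complex_of_real r * z)
        = complex_of_real (inverse r) * (1 / (complex_of_real (a \<bullet> x) - z))" for x
        using that(2) by (simp add: right_diff_distrib[symmetric] field_simps del: right_diff_distrib)
      ultimately show ?thesis using that(1)
        by (simp only: stieltjes_transform_def restrict_apply if_True prod.case integral_mult_right_zero)
    qed
    have 3: "?F (a, z) \<in> weyl_disk (push_forward a \<mu>) z" if "(a, z) \<in> transform_domain" for a z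
      using n.stieltjes_transform_push_forward[OF that] sol[of a] that
      unfolding weyl_disk_def transform_domain_def by auto
    have "\<exists>\<Psi>. nevanlinna \<Psi> \<and> analytic_off_nonneg_ge (nev_d0 (push_forward a \<mu>)) \<Psi> \<and>
          (\<forall>z \<in> - \<real>\<^sub>\<ge>\<^sub>0. ?F (a, z) = nevanlinna_fraction (push_forward a \<mu>) \<Psi> z)" if a: "a \<in> interior nonneg_orthant" for a
    proof -
      interpret i: indeterminate_measure "push_forward a \<mu>" by (rule ind[OF a])
      obtain \<Psi> where \<Psi>: "nevanlinna \<Psi>" "analytic_off_nonneg_ge (nev_d0 (push_forward a \<mu>)) \<Psi>"
        "\<And>z. z \<in> - \<real>\<^sub>\<ge>\<^sub>0 \<Longrightarrow> (\<integral>t. 1 / (complex_of_real t - z) \<partial>push_forward a \<nu>) = nevanlinna_fraction (push_forward a \<mu>) \<Psi> z"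
        using i.nevanlinna_parametrization[OF sol[OF a]] by blast
      have "?F (a, z) = nevanlinna_fraction (push_forward a \<mu>) \<Psi> z" if "z \<in> - \<real>\<^sub>\<ge>\<^sub>0" for z
        using n.stieltjes_transform_push_forward[of a z] \<Psi>(3)[OF that] a that by (simp add: transform_domain_def)
      thus ?thesis using \<Psi>(1,2) by blast
    qed
    hence 4: "\<exists>\<Psi>. \<forall>a \<in> interior nonneg_orthant. nevanlinna (\<Psi> a) \<and> analytic_off_nonneg_ge (nev_d0 (push_forward a \<mu>)) (\<Psi> a) \<and>
          (\<forall>z \<in> - \<real>\<^sub>\<ge>\<^sub>0. ?F (a, z) = nevanlinna_fraction (push_forward a \<mu>) (\<Psi> a) z)"
      by (intro bchoice ballI)
    have 5: "?F (a, - complex_of_real t) \<in> \<real>" if "a \<in> interior nonneg_orthant" "t > 0" for a t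
      using n.stieltjes_transform_negative[OF that] by simp
    have 6: "completely_monotonic (\<lambda>(a, t). Re (?F (a, - complex_of_real t)))"
      by (rule n.completely_monotonic_KR) (auto simp: n.stieltjes_transform_negative)
    show ?thesis using 1 n.smooth_stieltjes_transform 2 3 4 5 6 by auto
  qed
  have inj: "inj_on stieltjes_transform (moment_solutions \<mu> nonneg_orthant)"
  proof (rule inj_onI)
    fix \<nu> \<theta> assume n: "\<nu> \<in> moment_solutions \<mu> nonneg_orthant" and t: "\<theta> \<in> moment_solutions \<mu> nonneg_orthant"
      and eq: "stieltjes_transform \<nu> = stieltjes_transform \<theta>"
    interpret n: orthant_measure \<nu> by (rule om[OF n])
    interpret t: orthant_measure \<theta> by (rule om[OF t])
    show "\<nu> = \<theta>"
    proof (rule orthant_measure_eqI[OF n.finite_measure_axioms n.sets_eq n.AE_orthant t.finite_measure_axioms t.sets_eq t.AE_orthant])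
      fix a :: "real ^ 'n" and s :: real assume a: "a \<in> interior nonneg_orthant" "s > 0"
      have "n.KR (\<lambda>_. 1) 1 (a, s) = t.KR (\<lambda>_. 1) 1 (a, s)"
        using n.stieltjes_transform_negative[OF a] t.stieltjes_transform_negative[OF a] eq by simp
      thus "(\<integral>x. 1 / (a \<bullet> x + s) \<partial>\<nu>) = (\<integral>x. 1 / (a \<bullet> x + s) \<partial>\<theta>)" by (simp add: n.KR_def t.KR_def)
    qed
  qed
  have surj: "\<exists>\<nu>\<in>moment_solutions \<mu> nonneg_orthant. F = stieltjes_transform \<nu>" if F: "F \<in> ?T" for F
  proof -
    have ext: "F \<in> extensional transform_domain" and smF: "smooth_on transform_domain F"
      and hom: "\<And>a z r. (a, z) \<in> transform_domain \<Longrightarrow> r > 0 \<Longrightarrow>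
          F (r *\<^sub>R a, complex_of_real r * z) = complex_of_real (inverse r) * F (a, z)"
      and weyl: "\<And>a z. (a, z) \<in> transform_domain \<Longrightarrow> F (a, z) \<in> weyl_disk (push_forward a \<mu>) z"
      and par: "\<exists>\<Psi>. \<forall>a \<in> interior nonneg_orthant. nevanlinna (\<Psi> a) \<and>
          analytic_off_nonneg_ge (nev_d0 (push_forward a \<mu>)) (\<Psi> a) \<and>
          (\<forall>z \<in> - \<real>\<^sub>\<ge>\<^sub>0. F (a, z) = nevanlinna_fraction (push_forward a \<mu>) (\<Psi> a) z)"
      and cm: "completely_monotonic (\<lambda>(a, t). Re (F (a, - complex_of_real t)))"
      using F by auto
    define G where "G = (\<lambda>(a, t). Re (F (a, - complex_of_real t)))"
    define s0 where "s0 a = mean (push_forward a \<mu>) 1" for a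
    \<comment> \<open>At negative points the Weyl disk consists of positive reals, so G carries all
      of F there. The witness \<tau> may depend on a and t.\<close>
    have G: "\<exists>\<tau>\<in>moment_solutions (push_forward a \<mu>) {0..}. F (a, - complex_of_real t) = complex_of_real (G (a, t)) \<and>
        G (a, t) = (\<integral>u. 1 / (u + t) \<partial>\<tau>) \<and> 0 < G (a, t) \<and> t * G (a, t) \<le> s0 a"
      if a: "a \<in> interior nonneg_orthant" "t > 0" for a t
    proof -
      interpret i: indeterminate_measure "push_forward a \<mu>" by (rule ind[OF a(1)])
      have "F (a, - complex_of_real t) \<in> weyl_disk (push_forward a \<mu>) (- complex_of_real t)"
        by (intro weyl m.negative_in_domain a)
      from i.weyl_disk_negative[OF this a(2)] obtain \<tau> where "\<tau> \<in> moment_solutions (push_forward a \<mu>) {0..}"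
        "F (a, - complex_of_real t) = complex_of_real (\<integral>u. 1 / (u + t) \<partial>\<tau>)"
        "0 < (\<integral>u. 1 / (u + t) \<partial>\<tau>)" "t * (\<integral>u. 1 / (u + t) \<partial>\<tau>) \<le> mean (push_forward a \<mu>) 1" by blast
      thus ?thesis by (intro bexI[of _ \<tau>]) (simp_all add: G_def s0_def)
    qed
    interpret G: homogeneous_cm G
    proof
      show "smooth_on (interior nonneg_orthant) G"
        using cm unfolding interior_nonneg_orthant_prod G_def completely_monotonic_def by blast
      show "0 \<le> (- 1) ^ length ws * fold dir_deriv ws G x" if "set ws \<subseteq> Basis" "x \<in> interior nonneg_orthant" for ws x
        using completely_monotonic_word_sign[OF cm that] by (simp only: G_def)
      show "0 < G One" using G[OF One_in_interior, of 1] by (auto simp: One_prod)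
      fix x :: "(real ^ 'n) \<times> real" and r :: real assume "x \<in> interior nonneg_orthant" and r: "r > 0"
      then obtain a t where x: "x = (a, t)" "a \<in> interior nonneg_orthant" "t > 0"
        by (cases x) (auto simp: mem_interior_prod)
      show "G (r *\<^sub>R x) = G x / r"
      proof -
        have "F (r *\<^sub>R a, - complex_of_real (r * t)) = complex_of_real (inverse r) * F (a, - complex_of_real t)"
          using hom[OF m.negative_in_domain[OF x(2,3)] r] by simp
        moreover have "Re (complex_of_real c * w) = c * Re w" for c w by simp
        ultimately have "Re (F (r *\<^sub>R a, - complex_of_real (r * t))) = inverse r * Re (F (a, - complex_of_real t))"
          by (simp only:)
        thus ?thesis by (simp add: G_def x(1) divide_inverse mult.commute)
      qed
    qed
    obtain \<rho> where \<rho>: "finite_measure \<rho>" "sets \<rho> = sets borel" "AE y in \<rho>. y \<in> unit_simplex"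
      and G\<rho>: "\<And>c. c \<in> interior nonneg_orthant \<Longrightarrow> G c = (\<integral>y. 1 / (c \<bullet> y) \<partial>\<rho>)"
      using G.representation by blast
    have One: "(One :: real ^ 'n) \<in> interior nonneg_orthant" by (rule One_in_interior)
    \<comment> \<open>The total mass of the projection along \<open>One\<close> bounds n G(One, n)
      uniformly in n.\<close>
    have "real n * (\<integral>y. 1 / ((One, real n) \<bullet> y) \<partial>\<rho>) \<le> s0 One" if "n > 0" for n
      using G[OF One, of "real n"] G\<rho>[of "(One, real n)"] One that by (auto simp: mem_interior_prod)
    from simplex_measure_converse[OF \<rho> this]
    obtain \<nu> :: "(real ^ 'n) measure" where \<nu>: "finite_measure \<nu>" "sets \<nu> = sets borel" "AE x in \<nu>. x \<in> nonneg_orthant"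
      and int\<nu>: "\<And>a t. a \<in> interior nonneg_orthant \<Longrightarrow> t > 0 \<Longrightarrow> (\<integral>x. 1 / (a \<bullet> x + t) \<partial>\<nu>) = (\<integral>y. 1 / ((a, t) \<bullet> y) \<partial>\<rho>)"
      by metis
    have G\<nu>: "(\<integral>x. 1 / (a \<bullet> x + t) \<partial>\<nu>) = G (a, t)" if "a \<in> interior nonneg_orthant" "t > 0" for a t
      using int\<nu>[OF that] G\<rho>[of "(a, t)"] that by (simp add: mem_interior_prod)
    have sol: "\<nu> \<in> moment_solutions \<mu> nonneg_orthant"
    proof (rule m.moment_solutionsI_push_forward[OF \<nu>(2,3)])
      fix a :: "real ^ 'n" assume a: "a \<in> interior nonneg_orthant"
      interpret i: indeterminate_measure "push_forward a \<mu>" by (rule ind[OF a])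
      show "push_forward a \<nu> \<in> moment_solutions (push_forward a \<mu>) {0..}"
      proof (rule moment_solutionsI_weyl)
        show "finite_measure (push_forward a \<nu>)" unfolding push_forward_def
          by (rule finite_measure.finite_measure_distr[OF \<nu>(1) push_forward_measurable[OF \<nu>(2)]])
        show "AE u in push_forward a \<nu>. 0 \<le> u"
          by (rule push_forward_AE_nonneg[OF \<nu>(2,3) interior_nonneg_orthant_subset[OF a]])
        show "stieltjes_measure (push_forward a \<mu>)" by (rule i.stieltjes_measure_axioms)
        fix t :: real assume t: "t > 0"
        have "(\<integral>u. 1 / (u + t) \<partial>push_forward a \<nu>) = G (a, t)"
          using G\<nu>[OF a t] by (subst integral_push_forward[OF \<nu>(2)]) simp_all
        thus "\<exists>\<tau>\<in>moment_solutions (push_forward a \<mu>) {0..}. (\<integral>u. 1 / (u + t) \<partial>push_forward a \<nu>) = (\<integral>u. 1 / (u + t) \<partial>\<tau>)"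
          using G[OF a t] by auto
      qed simp
    qed
    interpret n: orthant_measure \<nu> by (rule om[OF sol])
    have "F (a, z) = stieltjes_transform \<nu> (a, z)" if az: "(a, z) \<in> transform_domain" for a z
    proof -
      have a: "a \<in> interior nonneg_orthant" and z: "z \<in> - \<real>\<^sub>\<ge>\<^sub>0" using az by (auto simp: transform_domain_def)
      interpret i: indeterminate_measure "push_forward a \<mu>" by (rule ind[OF a])
      obtain \<Psi> where \<Psi>: "analytic_off_nonneg_ge (nev_d0 (push_forward a \<mu>)) \<Psi>"
         "\<And>z. z \<in> - \<real>\<^sub>\<ge>\<^sub>0 \<Longrightarrow> F (a, z) = nevanlinna_fraction (push_forward a \<mu>) \<Psi> z" using par a by blast
      have cont: "continuous_on (- \<real>\<^sub>\<ge>\<^sub>0) (\<lambda>z. F (a, z))"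
        by (rule continuous_on_compose2[OF smooth_on_continuous[OF smF]])
          (use a in \<open>auto simp: transform_domain_def intro!: continuous_intros\<close>)
      \<comment> \<open>Smoothness in the real sense gives continuity in z; the fraction in (2)
        upgrades it to holomorphy.\<close>
      have holF: "(\<lambda>z. F (a, z)) holomorphic_on (- \<real>\<^sub>\<ge>\<^sub>0)"
      proof (cases \<Psi>)
        case None
        show ?thesis
          by (rule holomorphic_fraction_of_continuous[OF slit_plane_open_connected i.nev_holomorphic(3,4) cont])
            (simp add: \<Psi>(2) None nevanlinna_fraction_def)
      next
        case (Some \<psi>)
        have \<psi>: "\<psi> holomorphic_on (- \<real>\<^sub>\<ge>\<^sub>0)" using \<Psi>(1) by (simp add: Some analytic_off_nonneg_ge_def)
        show ?thesis
          by (rule holomorphic_fraction_of_continuous[OF slit_plane_open_connected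
              holomorphic_on_add[OF holomorphic_on_mult[OF i.nev_holomorphic(3) \<psi>] i.nev_holomorphic(1)]
              holomorphic_on_add[OF holomorphic_on_mult[OF i.nev_holomorphic(4) \<psi>] i.nev_holomorphic(2)] cont])
            (simp add: \<Psi>(2) Some nevanlinna_fraction_def)
      qed
      have holK: "(\<lambda>z. n.K (\<lambda>_. 1) 1 (a, z)) holomorphic_on (- \<real>\<^sub>\<ge>\<^sub>0)"
        by (rule n.K_holomorphic[OF poly_bounded_const a])
      have "F (a, z) - n.K (\<lambda>_. 1) 1 (a, z) = 0"
      \<comment> \<open>The difference vanishes on the negative axis, which accumulates at -1 inside
        the connected slit plane.\<close>
      proof (rule analytic_continuation[where S="- \<real>\<^sub>\<ge>\<^sub>0" and U="complex_of_real ` {..<0}" and \<xi>="- 1" and f="\<lambda>z. F (a, z) - n.K (\<lambda>_. 1) 1 (a, z)"])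
        show "(\<lambda>z. F (a, z) - n.K (\<lambda>_. 1) 1 (a, z)) holomorphic_on - \<real>\<^sub>\<ge>\<^sub>0" by (intro holomorphic_intros holF holK)
        show "- 1 islimpt complex_of_real ` {..<0}" by (rule minus_one_islimpt_negative)
        fix y assume "y \<in> complex_of_real ` {..<0}"
        then obtain t where t: "t > 0" "y = - complex_of_real t" by (auto intro: that[of "- _"])
        have "F (a, y) = complex_of_real (n.KR (\<lambda>_. 1) 1 (a, t))"
          using G[OF a t(1)] G\<nu>[OF a t(1)] by (auto simp: t(2) n.KR_def)
        thus "F (a, y) - n.K (\<lambda>_. 1) 1 (a, y) = 0" using n.KR_eq[of "\<lambda>_. 1" 1 a t] by (simp add: t(2))
      qed (use slit_plane_open_connected z in \<open>auto simp: complex_nonneg_Reals_iff\<close>)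
      thus ?thesis using n.stieltjes_transform_eq[OF az] by simp
    qed
    moreover have "stieltjes_transform \<nu> \<in> extensional transform_domain" by (simp add: stieltjes_transform_def)
    ultimately have "F = stieltjes_transform \<nu>" using ext by (intro extensionalityI[OF ext]) auto
    thus ?thesis using sol by blast
  qed
  show ?thesis unfolding bij_betw_def
  proof (intro conjI inj subset_antisym subsetI)
    show "F \<in> ?T" if "F \<in> stieltjes_transform ` moment_solutions \<mu> nonneg_orthant" for F
      using that maps by blast
    show "F \<in> stieltjes_transform ` moment_solutions \<mu> nonneg_orthant" if "F \<in> ?T" for F
      using surj[OF that] by blast
  qed
qed

end
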